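(* Let $\{(X_i,a_i)\}_{i\ge 0}$ be a controlled Markov chain with finite state space $\mathcal S=\{1,\dots,d\}$, finite action space $\mathcal A=\{1,\dots,k\}$ and transition probabilities $M^{(l)}_{s,t}$. Suppose that the following two conditions hold. (1) For all $(s,l)\in\mathcal S\times\mathcal A$ there exist $0<\alpha<1$ and a deterministic sequence $(T_i)_{i\ge1}$ with $T_i=O(i^{\alpha})$ such that for all $i\ge 1$, $\mathbb E\big[\tau^{(i)}_{s,l}\mid \mathcal F_{\sum_{p=1}^{i-1}\tau^{(p)}_{s,l}}\big]\le T_i$ almost surely. (2) There exists a constant $C_\Delta>1$ independent of $n$ such that $\|\Delta_n\|:=\max_{1\le i\le n}\big(1+\bar\eta_{i,i+1}(n)+\bar\eta_{i,i+2}(n)+\dots+\bar\eta_{i,n}(n)\big)\le C_\Delta$ for all $n$. Let $\xi=\xi(n)\in\mathbb R^{d^2k}$ be the vector whose $\big((s-1)dk+(l-1)d+t\big)$-th element is $\sqrt{N_s^{(l)}}\,\big(\hat M^{(l)}_{s,t}-M^{(l)}_{s,t}\big)$. Then, as $n\to\infty$, $$\xi\ \overset{d}{\rightarrow}\ \mathcal N(0,\Lambda),$$ where the entry $\lambda_{slt,s'l't'}$ of $\Lambda$, giving the covariance between the $\big((s-1)dk+(l-1)d+t\big)$-th and the $\big((s'-1)dk+(l'-1)d+t'\big)$-th elements, is $$\lambda_{slt,s'l't'}=\mathbb 1[(s,l)=(s',l')]\Big(\mathbb 1[t=t']\,M^{(l)}_{s,t}-M^{(l)}_{s,t}M^{(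l')}_{s',t'}\Big).$$
   Context: Controlled Markov chain (CMC): let $\mathcal F_j=\sigma(X_0,a_0,\dots,X_j,a_j)$. A CMC is a process $\{(X_i,a_i)\}_{i\ge0}$ with values in $\mathcal S\times\mathcal A$ such that for all times $i$ and all histories $(s_0,l_0,\dots,s_i,l_i)$ of positive probability, $\mathbb P(X_{i+1}=t\mid X_0=s_0,a_0=l_0,\dots,X_i=s_i,a_i=l_i)=\mathbb P(X_{i+1}=t\mid X_i=s_i,a_i=l_i)=M^{(l_i)}_{s_i,t}$, with $M^{(l)}_{s,t}$ not depending on $i$. The law of $a_i$ given $(X_0,a_0,\dots,X_{i-1},a_{i-1},X_i)$ (the logging policy) is arbitrary: it may be history-dependent and time-inhomogeneous. Counts and estimator, from data $(X_0,a_0),\dots,(X_n,a_n)$: $N_s^{(l)}=N_s^{(l)}(n)=\sum_{i=0}^{n-1}\mathbb 1[X_i=s,a_i=l]$, $N_{s,t}^{(l)}=N_{s,t}^{(l)}(n)=\sum_{i=0}^{n-1}\mathbb 1[X_i=s,X_{i+1}=t,a_i=l]$, $\hat M^{(l)}_{s,t}=N^{(l)}_{s,t}/N^{(l)}_s$ (set to $0$ when $N_s^{(l)}=0$). Return times: $\tau^{(1)}_{s,l}=\min\{i>0:X_i=s,a_i=l\}$ and, for $i\ge2$, $\tau^{(i)}_{s,l}=\min\{m>0: X_{\sum_{j=1}^{i-1}\tau^{(j)}_{s,l}+m}=s,\ a_{\sum_{j=1}^{i-1}\tau^{(j)}_{s,l}+m}=l\}$. $\mathcal F_{\sum_{p=1}^{i-1}\tau^{(p)}_{s,l}}$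 is the $\sigma$-algebra of the corresponding stopping time. Weak mixing coefficients: for $i<j\le n$, let $\bar\eta_{i,j}(n)=\sup\big|\mathbb P((X_j,a_j,\dots,X_n,a_n)\in\mathcal T\mid X_i=s_1,a_i=l_1,\mathcal H_0^{i-1}=h)-\mathbb P((X_j,a_j,\dots,X_n,a_n)\in\mathcal T\mid X_i=s_2,a_i=l_2,\mathcal H_0^{i-1}=h)\big|$, where $\mathcal H_0^{i-1}=((X_0,a_0),\dots,(X_{i-1},a_{i-1}))$ and the supremum is over $\mathcal T\subseteq(\mathcal S\times\mathcal A)^{n-j+1}$, $s_1,s_2\in\mathcal S$, $l_1,l_2\in\mathcal A$, $h\in(\mathcal S\times\mathcal A)^i$ such that both conditioning events have positive probability. *)

theory Defs
  imports "HOL-Probability.Probability" "HOL-Library.Landau_Symbols"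
begin

section \<open>Controlled Markov chains\<close>

text \<open>
  States and actions range over finite types \<open>'s\<close> and \<open>'l\<close>; their cardinalities play the roles
  of \<open>d\<close> and \<open>k\<close>. The transition probability from \<open>s\<close> to \<open>t\<close> under action \<open>l\<close> is \<open>M l s t\<close>.
  The law of \<open>a i\<close> given the past is left unconstrained.
\<close>

definition controlled_markov_chain ::
  "'w measure \<Rightarrow> (nat \<Rightarrow> 'w \<Rightarrow> 's::finite) \<Rightarrow> (nat \<Rightarrow> 'w \<Rightarrow> 'l::finite) \<Rightarrow>
    ('l \<Rightarrow> 's \<Rightarrow> 's \<Rightarrow> real) \<Rightarrow> bool" where
  "controlled_markov_chain P X a M \<longleftrightarrow>
     prob_space P \<and>
     (\<forall>i. X i \<in> measurable P (count_space UNIV)) \<and>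
     (\<forall>i. a i \<in> measurable P (count_space UNIV)) \<and>
     (\<forall>i s l t.
        \<P>(\<omega> in P. \<forall>j\<le>i. X j \<omega> = s j \<and> a j \<omega> = l j) > 0 \<longrightarrow>
          \<P>(\<omega> in P. X (Suc i) \<omega> = t \<bar> \<forall>j\<le>i. X j \<omega> = s j \<and> a j \<omega> = l j) =
            \<P>(\<omega> in P. X (Suc i) \<omega> = t \<bar> X i \<omega> = s i \<and> a i \<omega> = l i) \<and>
          \<P>(\<omega> in P. X (Suc i) \<omega> = t \<bar> X i \<omega> = s i \<and> a i \<omega> = l i) = M (l i) (s i) t)"

section \<open>Counts and the estimator\<close>

definition visit_count ::
  "(nat \<Rightarrow> 'w \<Rightarrow> 's) \<Rightarrow> (nat \<Rightarrow> 'w \<Rightarrow> 'l) \<Rightarrow> nat \<Rightarrow> 's \<Rightarrow> 'l \<Rightarrow> 'w \<Rightarrow> nat" where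
  "visit_count X a n s l \<omega> = (\<Sum>i<n. of_bool (X i \<omega> = s \<and> a i \<omega> = l))"

definition transition_count ::
  "(nat \<Rightarrow> 'w \<Rightarrow> 's) \<Rightarrow> (nat \<Rightarrow> 'w \<Rightarrow> 'l) \<Rightarrow> nat \<Rightarrow> 's \<Rightarrow> 'l \<Rightarrow> 's \<Rightarrow> 'w \<Rightarrow> nat" where
  "transition_count X a n s l t \<omega> =
     (\<Sum>i<n. of_bool (X i \<omega> = s \<and> X (Suc i) \<omega> = t \<and> a i \<omega> = l))"

text \<open>Since \<open>x / 0 = 0\<close>, the estimator is \<open>0\<close> when \<open>(s, l)\<close> has not been visited.\<close>

definition M_hat ::
  "(nat \<Rightarrow> 'w \<Rightarrow> 's) \<Rightarrow> (nat \<Rightarrow> 'w \<Rightarrow> 'l) \<Rightarrow> nat \<Rightarrow> 'l \<Rightarrow> 's \<Rightarrow> 's \<Rightarrow> 'w \<Rightarrow> real" where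
  "M_hat X a n l s t \<omega> =
     real (transition_count X a n s l t \<omega>) / real (visit_count X a n s l \<omega>)"

text \<open>
  Coordinates of a vector in \<open>d\<^sup>2 k\<close>-dimensional space are indexed by triples \<open>(s, l, t)\<close>
  instead of by their lexicographic position \<open>(s - 1) d k + (l - 1) d + t\<close>.
\<close>

definition xi ::
  "(nat \<Rightarrow> 'w \<Rightarrow> 's::finite) \<Rightarrow> (nat \<Rightarrow> 'w \<Rightarrow> 'l::finite) \<Rightarrow> ('l \<Rightarrow> 's \<Rightarrow> 's \<Rightarrow> real) \<Rightarrow>
    nat \<Rightarrow> 'w \<Rightarrow> real ^ ('s \<times> 'l \<times> 's)" where
  "xi X a M n \<omega> =
     (\<chi> i. case i of (s, l, t) \<Rightarrow>
        sqrt (real (visit_count X a n s l \<omega>)) * (M_hat X a n l s t \<omega> - M l s t))"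

definition Lambda ::
  "('l \<Rightarrow> 's \<Rightarrow> 's \<Rightarrow> real) \<Rightarrow>
    real ^ ('s::finite \<times> 'l::finite \<times> 's) ^ ('s \<times> 'l \<times> 's)" where
  "Lambda M =
     (\<chi> i j. case i of (s, l, t) \<Rightarrow> case j of (s', l', t') \<Rightarrow>
        of_bool ((s, l) = (s', l')) * (of_bool (t = t') * M l s t - M l s t * M l' s' t'))"

section \<open>Return times\<close>

text \<open>
  First strictly positive delay after the (possibly infinite) time \<open>r\<close> at which \<open>(s, l)\<close> is
  visited; \<open>\<infinity>\<close> if there is no such visit (\<open>Inf {} = \<infinity>\<close>) or if \<open>r = \<infinity>\<close>.
\<close>

definition next_visit ::
  "(nat \<Rightarrow> 'w \<Rightarrow> 's) \<Rightarrow> (nat \<Rightarrow> 'w \<Rightarrow> 'l) \<Rightarrow> 's \<Rightarrow> 'l \<Rightarrow> enat \<Rightarrow> 'w \<Rightarrow> enat" where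
  "next_visit X a s l r \<omega> =
     Inf {enat m |m. 0 < m \<and> (\<exists>q. r = enat q \<and> X (q + m) \<omega> = s \<and> a (q + m) \<omega> = l)}"

text \<open>The return times are \<open>return_time X a s l i\<close> for \<open>i \<ge> 1\<close>; the value at \<open>i = 0\<close> is not used.\<close>

fun return_time ::
  "(nat \<Rightarrow> 'w \<Rightarrow> 's) \<Rightarrow> (nat \<Rightarrow> 'w \<Rightarrow> 'l) \<Rightarrow> 's \<Rightarrow> 'l \<Rightarrow> nat \<Rightarrow> 'w \<Rightarrow> enat" where
  "return_time X a s l i \<omega> =
     next_visit X a s l (\<Sum>p=1..<i. return_time X a s l p \<omega>) \<omega>"

declare return_time.simps [simp del]

text \<open>
  The filtration generated by the pairs \<open>(X i, a i)\<close>, extended to the time \<open>\<infinity>\<close> by the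
  \<open>\<sigma>\<close>-algebra generated by the whole process.
\<close>

definition history_filtration ::
  "'w measure \<Rightarrow> (nat \<Rightarrow> 'w \<Rightarrow> 's) \<Rightarrow> (nat \<Rightarrow> 'w \<Rightarrow> 'l) \<Rightarrow> enat \<Rightarrow> 'w measure" where
  "history_filtration P X a r =
     sigma (space P) {(\<lambda>\<omega>. (X i \<omega>, a i \<omega>)) -` B \<inter> space P |i B. enat i \<le> r}"

definition return_sigma ::
  "'w measure \<Rightarrow> (nat \<Rightarrow> 'w \<Rightarrow> 's) \<Rightarrow> (nat \<Rightarrow> 'w \<Rightarrow> 'l) \<Rightarrow> 's \<Rightarrow> 'l \<Rightarrow> nat \<Rightarrow> 'w measure" where
  "return_sigma P X a s l i =
     filtration.pre_sigma (space P) (history_filtration P X a)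
       (\<lambda>\<omega>. \<Sum>p=1..<i. return_time X a s l p \<omega>)"

definition expected_return_time ::
  "'w measure \<Rightarrow> (nat \<Rightarrow> 'w \<Rightarrow> 's) \<Rightarrow> (nat \<Rightarrow> 'w \<Rightarrow> 'l) \<Rightarrow> 's \<Rightarrow> 'l \<Rightarrow> nat \<Rightarrow> 'w \<Rightarrow> ennreal" where
  "expected_return_time P X a s l i =
     nn_cond_exp P (return_sigma P X a s l i) (\<lambda>\<omega>. ennreal_of_enat (return_time X a s l i \<omega>))"

text \<open>
  The partial sums of the return times are stopping times and \<open>return_sigma\<close> is a
  sub-\<open>\<sigma>\<close>-algebra of \<open>P\<close>, so that \<open>pre_sigma\<close> and \<open>nn_cond_exp\<close> have their intended meaning
  (the latter is \<open>0\<close> by definition outside of its domain).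
\<close>

lemma space_history_filtration [simp]: "space (history_filtration P X a r) = space P"
  unfolding history_filtration_def by (rule space_measure_of) auto

lemma sets_history_filtration:
  "sets (history_filtration P X a r) =
     sigma_sets (space P) {(\<lambda>\<omega>. (X i \<omega>, a i \<omega>)) -` B \<inter> space P |i B. enat i \<le> r}"
  unfolding history_filtration_def by (rule sets_measure_of) auto

lemma filtration_history: "filtration (space P) (history_filtration P X a)"
  by standard (auto simp: sets_history_filtration intro!: sigma_sets_mono' intro: order_trans)

lemma history_filtration_event:
  assumes "enat i \<le> r"
  shows "{\<omega> \<in> space P. X i \<omega> = s \<and> a i \<omega> = l} \<in> sets (history_filtration P X a r)"
proof -
  have "{\<omega> \<in> space P. X i \<omega> = s \<and> a i \<omega> = l} = (\<lambda>\<omega>. (X i \<omega>, a i \<omega>)) -` {(s, l)} \<inter> space P"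
    by auto
  then show ?thesis
    unfolding sets_history_filtration using assms by (auto intro!: sigma_sets.Basic)
qed

lemma sets_history_filtration_subset:
  fixes X :: "nat \<Rightarrow> 'w \<Rightarrow> 's::finite" and a :: "nat \<Rightarrow> 'w \<Rightarrow> 'l::finite"
  assumes "\<And>i. X i \<in> measurable P (count_space UNIV)"
    and "\<And>i. a i \<in> measurable P (count_space UNIV)"
  shows "sets (history_filtration P X a r) \<subseteq> sets P"
proof -
  have "(\<lambda>\<omega>. (X i \<omega>, a i \<omega>)) -` B \<inter> space P \<in> sets P" for i B
  proof -
    have "(\<lambda>\<omega>. (X i \<omega>, a i \<omega>)) -` B \<inter> space P =
        (\<Union>b\<in>B. (X i -` {fst b} \<inter> space P) \<inter> (a i -` {snd b} \<inter> space P))"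
      by auto
    also have "\<dots> \<in> sets P"
      by (intro sets.finite_UN sets.Int measurable_sets[OF assms(1)] measurable_sets[OF assms(2)])
        auto
    finally show ?thesis .
  qed
  then show ?thesis
    unfolding sets_history_filtration by (intro sets.sigma_sets_subset) auto
qed

lemma next_visit_le_iff:
  "next_visit X a s l r \<omega> \<le> enat k \<longleftrightarrow>
     (\<exists>q m. 0 < m \<and> m \<le> k \<and> r = enat q \<and> X (q + m) \<omega> = s \<and> a (q + m) \<omega> = l)"
proof
  let ?A = "{enat m |m. 0 < m \<and> (\<exists>q. r = enat q \<and> X (q + m) \<omega> = s \<and> a (q + m) \<omega> = l)}"
  assume *: "next_visit X a s l r \<omega> \<le> enat k"
  have ne: "?A \<noteq> {}"
  proof
    assume "?A = {}"
    then have "next_visit X a s l r \<omega> = \<infinity>"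
      unfolding next_visit_def by (simp only: Inf_enat_def if_True refl)
    with * show False
      by simp
  qed
  then obtain x where "x \<in> ?A"
    by blast
  then have "(LEAST x. x \<in> ?A) \<in> ?A"
    by (rule LeastI)
  with ne have "Inf ?A \<in> ?A"
    by (simp only: Inf_enat_def if_False)
  then show "\<exists>q m. 0 < m \<and> m \<le> k \<and> r = enat q \<and> X (q + m) \<omega> = s \<and> a (q + m) \<omega> = l"
    using * unfolding next_visit_def by auto
next
  assume "\<exists>q m. 0 < m \<and> m \<le> k \<and> r = enat q \<and> X (q + m) \<omega> = s \<and> a (q + m) \<omega> = l"
  then show "next_visit X a s l r \<omega> \<le> enat k"
    unfolding next_visit_def by (auto intro!: Inf_lower2)
qed

lemma add_next_visit_le_iff:
  "r + next_visit X a s l r \<omega> \<le> enat k \<longleftrightarrow>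
     (\<exists>j\<le>k. X j \<omega> = s \<and> a j \<omega> = l \<and> (\<exists>q<j. r = enat q))"
proof (cases r)
  case (enat q)
  have "r + next_visit X a s l r \<omega> \<le> enat k \<longleftrightarrow>
      q \<le> k \<and> next_visit X a s l r \<omega> \<le> enat (k - q)"
    unfolding enat by (cases "next_visit X a s l (enat q) \<omega>") auto
  also have "\<dots> \<longleftrightarrow> (\<exists>m. 0 < m \<and> q + m \<le> k \<and> X (q + m) \<omega> = s \<and> a (q + m) \<omega> = l)"
    unfolding next_visit_le_iff enat by auto
  also have "\<dots> \<longleftrightarrow> (\<exists>j\<le>k. X j \<omega> = s \<and> a j \<omega> = l \<and> q < j)"
    by (metis add_diff_inverse_nat less_add_same_cancel1 less_imp_not_less zero_less_diff)
  finally show ?thesis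
    using enat by auto
qed auto

lemma stopping_time_return_time_sum:
  "stopping_time (history_filtration P X a) (\<lambda>\<omega>. \<Sum>p=1..<i. return_time X a s l p \<omega>)"
proof (induction i)
  case 0
  show ?case
    by (simp add: stopping_time_def)
next
  case (Suc i)
  show ?case
  proof (cases "i = 0")
    case True
    then show ?thesis
      by (simp add: stopping_time_def)
  next
    case False
    let ?F = "history_filtration P X a"
    let ?T = "\<lambda>\<omega>. \<Sum>p=1..<i. return_time X a s l p \<omega>"
    have eq: "(\<Sum>p=1..<Suc i. return_time X a s l p \<omega>) = ?T \<omega> + next_visit X a s l (?T \<omega>) \<omega>" for \<omega>
      using False by (subst sum.atLeastLessThan_Suc) (auto simp: return_time.simps[of _ _ _ _ i])
    have "Measurable.pred (?F t) (\<lambda>\<omega>. ?T \<omega> + next_visit X a s l (?T \<omega>) \<omega> \<le> t)" for t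
    proof (cases t)
      case (enat k)
      have 1: "Measurable.pred (?F t) (\<lambda>\<omega>. X j \<omega> = s \<and> a j \<omega> = l)" if "j \<le> k" for j
        using history_filtration_event[of j t P X s a l] that enat by (simp add: pred_def)
      have le: "Measurable.pred (?F t) (\<lambda>\<omega>. ?T \<omega> \<le> enat q)" if "q \<le> k" for q
        using filtration.stopping_time_le_const[OF filtration_history Suc.IH] that enat by simp
      have 2: "Measurable.pred (?F t) (\<lambda>\<omega>. \<exists>q<j. ?T \<omega> = enat q)" if "j \<le> k" for j
      proof (cases j)
        case (Suc j')
        have "(\<exists>q<j. ?T \<omega> = enat q) \<longleftrightarrow> ?T \<omega> \<le> enat j'" for \<omega>
          using Suc by (cases "?T \<omega>") auto
        then show ?thesis
          using le[of j'] Suc that by simp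
      qed simp
      have "Measurable.pred (?F t)
          (\<lambda>\<omega>. \<exists>j\<in>{..k}. (X j \<omega> = s \<and> a j \<omega> = l) \<and> (\<exists>q<j. ?T \<omega> = enat q))"
        by (intro pred_intros_finite pred_intros_logic(3) 1 2) auto
      then show ?thesis
        unfolding enat add_next_visit_le_iff by (simp only: Bex_def atMost_iff conj_assoc)
    qed simp
    then show ?thesis
      unfolding stopping_time_def eq by blast
  qed
qed

lemma subalgebra_return_sigma:
  fixes X :: "nat \<Rightarrow> 'w \<Rightarrow> 's::finite" and a :: "nat \<Rightarrow> 'w \<Rightarrow> 'l::finite"
  assumes "\<And>i. X i \<in> measurable P (count_space UNIV)"
    and "\<And>i. a i \<in> measurable P (count_space UNIV)"
  shows "subalgebra P (return_sigma P X a s l i)"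
proof -
  interpret filtration "space P" "history_filtration P X a"
    by (rule filtration_history)
  let ?T = "\<lambda>\<omega>. \<Sum>p=1..<i. return_time X a s l p \<omega>"
  have "A \<in> sets P" if "A \<in> sets (pre_sigma ?T)" for A
    using sets_pre_sigmaD[OF stopping_time_return_time_sum that, of \<infinity>]
      sets_history_filtration_subset[of X P a \<infinity>] assms by auto
  then show ?thesis
    by (auto simp: subalgebra_def return_sigma_def space_pre_sigma)
qed

lemma borel_measurable_return_time:
  fixes X :: "nat \<Rightarrow> 'w \<Rightarrow> 's::finite" and a :: "nat \<Rightarrow> 'w \<Rightarrow> 'l::finite"
  assumes X: "\<And>i. X i \<in> measurable P (count_space UNIV)"
    and a: "\<And>i. a i \<in> measurable P (count_space UNIV)"
  shows "(\<lambda>\<omega>. ennreal_of_enat (return_time X a s l i \<omega>)) \<in> borel_measurable P"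
proof -
  note [measurable] = X a
  let ?T = "\<lambda>\<omega>. \<Sum>p=1..<i. return_time X a s l p \<omega>"
  have T: "?T \<in> measurable P (count_space UNIV)"
    using measurable_stopping_time[OF stopping_time_return_time_sum
        sets_history_filtration_subset[OF X a] space_history_filtration]
    by (simp add: measurable_cong_sets[OF refl sets_borel_eq_count_space])
  note [measurable] = T
  have le: "Measurable.pred P (\<lambda>\<omega>. return_time X a s l i \<omega> \<le> enat k)" for k
    unfolding return_time.simps[of _ _ _ _ i] next_visit_le_iff by measurable
  have "return_time X a s l i \<in> measurable P (borel :: enat measure)"
  proof (rule borel_measurableI_le)
    fix t :: enat
    show "{\<omega> \<in> space P. return_time X a s l i \<omega> \<le> t} \<in> sets P"
      using le by (cases t) (auto simp: pred_def)
  qed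
  then have "return_time X a s l i \<in> measurable P (count_space UNIV)"
    by (simp add: measurable_cong_sets[OF refl sets_borel_eq_count_space])
  then show ?thesis
    by measurable
qed

section \<open>Weak mixing coefficients\<close>

definition trajectory ::
  "(nat \<Rightarrow> 'w \<Rightarrow> 's) \<Rightarrow> (nat \<Rightarrow> 'w \<Rightarrow> 'l) \<Rightarrow> nat \<Rightarrow> nat \<Rightarrow> 'w \<Rightarrow> ('s \<times> 'l) list" where
  "trajectory X a i j \<omega> = map (\<lambda>m. (X m \<omega>, a m \<omega>)) [i..<j]"

text \<open>
  The supremum is over a subset of \<open>[0, 1]\<close> which is nonempty (take \<open>(s1, l1) = (s2, l2)\<close>),
  so the conditionally complete \<open>Sup\<close> on the reals is the genuine supremum.
\<close>

definition eta_bar ::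
  "'w measure \<Rightarrow> (nat \<Rightarrow> 'w \<Rightarrow> 's) \<Rightarrow> (nat \<Rightarrow> 'w \<Rightarrow> 'l) \<Rightarrow> nat \<Rightarrow> nat \<Rightarrow> nat \<Rightarrow> real" where
  "eta_bar P X a i j n =
     Sup {\<bar>\<P>(\<omega> in P. trajectory X a j (Suc n) \<omega> \<in> T
               \<bar> X i \<omega> = s1 \<and> a i \<omega> = l1 \<and> trajectory X a 0 i \<omega> = h)
           - \<P>(\<omega> in P. trajectory X a j (Suc n) \<omega> \<in> T
               \<bar> X i \<omega> = s2 \<and> a i \<omega> = l2 \<and> trajectory X a 0 i \<omega> = h)\<bar>
          |T s1 l1 s2 l2 h.
             T \<subseteq> {xs. length xs = n - j + 1} \<and> length h = i \<and>
             \<P>(\<omega> in P. X i \<omega> = s1 \<and> a i \<omega> = l1 \<and> trajectory X a 0 i \<omega> = h) > 0 \<and>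
             \<P>(\<omega> in P. X i \<omega> = s2 \<and> a i \<omega> = l2 \<and> trajectory X a 0 i \<omega> = h) > 0}"

definition Delta_norm ::
  "'w measure \<Rightarrow> (nat \<Rightarrow> 'w \<Rightarrow> 's) \<Rightarrow> (nat \<Rightarrow> 'w \<Rightarrow> 'l) \<Rightarrow> nat \<Rightarrow> real" where
  "Delta_norm P X a n = Max ((\<lambda>i. 1 + (\<Sum>j=i+1..n. eta_bar P X a i j n)) ` {1..n})"

section \<open>Multivariate normal laws and convergence in distribution\<close>

definition normal_law :: "real \<Rightarrow> real \<Rightarrow> real measure" where
  "normal_law m v =
     (if v = 0 then return borel m else density lborel (\<lambda>x. ennreal (normal_density m (sqrt v) x)))"

text \<open>
  \<open>\<nu>\<close> is the normal law with mean \<open>\<mu>\<close> and (possibly singular) covariance matrix \<open>\<Sigma>\<close>: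
  every linear functional has the corresponding, possibly degenerate, univariate normal law.
  By the Cramer-Wold theorem this determines \<open>\<nu>\<close>.
\<close>

definition multivariate_normal ::
  "real ^ 'n \<Rightarrow> real ^ 'n ^ 'n \<Rightarrow> (real ^ 'n::finite) measure \<Rightarrow> bool" where
  "multivariate_normal \<mu> \<Sigma> \<nu> \<longleftrightarrow>
     prob_space \<nu> \<and> sets \<nu> = sets borel \<and>
     transpose \<Sigma> = \<Sigma> \<and> (\<forall>u. 0 \<le> u \<bullet> (\<Sigma> *v u)) \<and>
     (\<forall>u. distr \<nu> borel (\<lambda>x. u \<bullet> x) = normal_law (u \<bullet> \<mu>) (u \<bullet> (\<Sigma> *v u)))"

text \<open>
  The library's \<open>weak_conv_m\<close> covers only measures on the real line, so convergence in
  distribution of random vectors is defined by testing against bounded continuous functions.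
\<close>

definition converges_in_distribution ::
  "'w measure \<Rightarrow> (nat \<Rightarrow> 'w \<Rightarrow> 'b::euclidean_space) \<Rightarrow> 'b measure \<Rightarrow> bool" where
  "converges_in_distribution P Y \<nu> \<longleftrightarrow>
     (\<forall>n. Y n \<in> borel_measurable P) \<and>
     (\<forall>f :: 'b \<Rightarrow> real. continuous_on UNIV f \<longrightarrow> bounded (range f) \<longrightarrow>
        (\<lambda>n. integral\<^sup>L (distr P borel (Y n)) f) \<longlonglongrightarrow> integral\<^sup>L \<nu> f)"

end

theory Submission
  imports Defs "HOL-Real_Asymp.Real_Asymp"
begin

text \<open>
  Fix the initial pair \<open>z\<close> and let \<open>b n y\<close> be the conditional expectation, given \<open>(X 0, a 0) = z\<close>, of the
  number of visits to \<open>y\<close> before time \<open>n\<close>. The return time condition and Markov's inequality give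
  \<open>b n y \<ge> c n powr (1 / (1 + \<alpha>))\<close>, which dominates \<open>sqrt n\<close> because \<open>\<alpha> < 1\<close>; the mixing condition
  bounds the increments of the Doob martingale of the visit count, so that its conditional variance
  is \<open>O(n)\<close>. By Chebyshev's inequality the visit count divided by \<open>b n y\<close> tends to \<open>1\<close> in
  probability.

  The linear functionals of \<open>xi\<close> are then, up to an error that vanishes in probability, sums of
  martingale differences normalised by the deterministic \<open>b n y\<close> and stopped once a pair has been
  visited about \<open>2 b n y\<close> times. The one-step conditional characteristic functions depend only on
  the current pair, so the exponential of the stopped sum, compensated by the exponential of half
  the accumulated conditional variance, is a bounded almost-martingale. This yields the limit of
  the characteristic functions given the initial pair. The limit does not depend on the initial
  pair, hence is also the limit of the unconditional characteristic functions, and Levy's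
  continuity theorem applies.
\<close>

text \<open>The policy is arbitrary, so the visited pairs need not form a Markov chain and neither
  regeneration nor an ergodic theorem is at hand; the counts may even grow sublinearly. What
  survives is the law of the next state given the current pair. It makes the numerator of every
  coordinate a martingale, whereas the normaliser, the visit count, depends on the whole run. This
  is why a deterministic proxy for the count is needed before any martingale argument can start.

  The cut-off at about twice the proxy is what keeps the compensator bounded: a count is a priori
  bounded only by \<open>n\<close>, and the exponential of \<open>n / b n y\<close> may explode. The
  cut-off acts only with vanishing probability, so it does not affect the limit.

  The definition of the chain constrains \<open>M\<close> only at pairs that occur with positive
  probability. That every row of \<open>M\<close> is a probability vector, without which
  \<open>Lambda M\<close> need not be a covariance matrix, is itself extracted from the return time
  condition.\<close>

section \<open>Levy's continuity theorem in several dimensions\<close>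

text \<open>The complex span of the characters: on it, convergence of characteristic functions gives
  convergence of integrals by linearity alone.\<close>

inductive trig_poly :: "('b::real_inner \<Rightarrow> complex) \<Rightarrow> bool" where
  exp: "trig_poly (\<lambda>x. c * iexp (u \<bullet> x))"
| add: "trig_poly f \<Longrightarrow> trig_poly g \<Longrightarrow> trig_poly (\<lambda>x. f x + g x)"

lemma trig_poly_const: "trig_poly (\<lambda>_. c)"
  using trig_poly.exp[of c 0] by simp

lemma trig_poly_sum:
  "(\<And>i. i \<in> A \<Longrightarrow> trig_poly (f i)) \<Longrightarrow> trig_poly (\<lambda>x. \<Sum>i\<in>A. f i x)"
  by (induction A rule: infinite_finite_induct) (auto intro: trig_poly_const trig_poly.add)

text \<open>A product of characters is a character, so the span is an algebra. Polynomials in sines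
  therefore stay inside it.\<close>

lemma trig_poly_mult:
  assumes "trig_poly f" "trig_poly g"
  shows "trig_poly (\<lambda>x. f x * g x)"
  using assms
proof (induction f)
  case (exp c u)
  then show ?case
  proof (induction g)
    case (exp d v)
    have "c * iexp (u \<bullet> x) * (d * iexp (v \<bullet> x)) = (c * d) * iexp ((u + v) \<bullet> x)" for x
      by (simp add: inner_add_left distrib_left exp_add)
    then show ?case
      using trig_poly.exp[of "c * d" "u + v"] by (simp only:)
  qed (simp add: distrib_left trig_poly.add)
qed (simp add: distrib_right trig_poly.add)

lemma trig_poly_sin: "trig_poly (\<lambda>x. complex_of_real (sin (u \<bullet> x)))"
proof -
  have "complex_of_real (sin r) = (- \<i> / 2) * iexp r + (\<i> / 2) * iexp (- r)" for r
    by (simp add: cis_conv_exp[symmetric] complex_eq_iff flip: of_real_minus mult_minus_right)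
  then have "(\<lambda>x. complex_of_real (sin (u \<bullet> x))) =
      (\<lambda>x. (- \<i> / 2) * iexp (u \<bullet> x) + (\<i> / 2) * iexp ((- u) \<bullet> x))"
    by (intro ext) (simp only: inner_minus_left)
  then show ?thesis
    by (simp only:) (intro trig_poly.add trig_poly.exp)
qed

lemma continuous_on_trig_poly: "trig_poly f \<Longrightarrow> continuous_on UNIV f"
  by (induction rule: trig_poly.induct) (auto intro!: continuous_intros)

lemma bounded_trig_poly: "trig_poly f \<Longrightarrow> \<exists>B. \<forall>x. norm (f x) \<le> B"
proof (induction rule: trig_poly.induct)
  case (exp c u)
  then show ?case by (auto simp: norm_mult intro!: exI[of _ "norm c"])
next
  case (add f g)
  then obtain B C where "\<forall>x. norm (f x) \<le> B" "\<forall>x. norm (g x) \<le> C" by blast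
  then have "\<forall>x. norm (f x + g x) \<le> B + C" by (meson add_mono norm_triangle_le)
  then show ?case by blast
qed

section \<open>Approximation on boxes by trigonometric polynomials\<close>

definition sin_coords :: "real \<Rightarrow> 'b::euclidean_space \<Rightarrow> 'b" where
  "sin_coords R x = (\<Sum>b\<in>Basis. sin ((x \<bullet> b) / R) *\<^sub>R b)"

definition arcsin_coords :: "real \<Rightarrow> 'b::euclidean_space \<Rightarrow> 'b" where
  "arcsin_coords R x = (\<Sum>b\<in>Basis. (R * arcsin (x \<bullet> b)) *\<^sub>R b)"

lemma trig_poly_real_polynomial_sin_coords:
  "real_polynomial_function p \<Longrightarrow> trig_poly (\<lambda>x. complex_of_real (p (sin_coords R x)))"
proof (induction rule: real_polynomial_function.induct)
  case (linear f)
  interpret f: bounded_linear f by fact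
  have "trig_poly (\<lambda>x. \<Sum>b\<in>Basis. complex_of_real (sin ((b /\<^sub>R R) \<bullet> x)) * complex_of_real (f b))"
    by (intro trig_poly_sum trig_poly_mult trig_poly_sin trig_poly_const)
  also have "(\<lambda>x. \<Sum>b\<in>Basis. complex_of_real (sin ((b /\<^sub>R R) \<bullet> x)) * complex_of_real (f b)) =
      (\<lambda>x. complex_of_real (f (sin_coords R x)))"
    by (simp add: sin_coords_def f.sum f.scaleR inner_commute[of _ "_ :: 'a"] divide_inverse_commute)
  finally show ?case .
next
  case (add f g)
  then show ?case using trig_poly.add by simp
next
  case (mult f g)
  then show ?case using trig_poly_mult by simp
qed (auto intro: trig_poly_const)

lemma sin_coords_in_cube: "sin_coords R x \<in> cbox (- (\<Sum>Basis)) (\<Sum>Basis)"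
  by (auto simp: mem_box sin_coords_def inner_sum_left_Basis)

lemma arcsin_sin_coords:
  assumes "R > 0" "\<And>b. b \<in> Basis \<Longrightarrow> \<bar>x \<bullet> b\<bar> \<le> R"
  shows "arcsin_coords R (sin_coords R x) = x"
proof (rule euclidean_eqI)
  fix b :: 'a assume b: "b \<in> Basis"
  have "\<bar>(x \<bullet> b) / R\<bar> \<le> 1" using assms b by (simp add: abs_divide)
  \<comment> \<open>Dividing by \<open>R\<close> puts the argument into [-1, 1], well inside the
    interval [-pi/2, pi/2] on which \<open>arcsin\<close> inverts \<open>sin\<close>.\<close>
  then have "- (pi / 2) \<le> (x \<bullet> b) / R" "(x \<bullet> b) / R \<le> pi / 2" using pi_gt3 by linarith+
  then have "arcsin (sin ((x \<bullet> b) / R)) = (x \<bullet> b) / R"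
    by (intro arcsin_sin) auto
  then show "arcsin_coords R (sin_coords R x) \<bullet> b = x \<bullet> b"
    using b \<open>R > 0\<close> by (simp add: arcsin_coords_def sin_coords_def)
qed

lemma continuous_on_arcsin_coords:
  "continuous_on (cbox (- (\<Sum>Basis)) (\<Sum>Basis)) (arcsin_coords R)"
  unfolding arcsin_coords_def
  by (auto intro!: continuous_intros simp: mem_box inner_sum_left_Basis)

text \<open>
  Given a box, \<open>f\<close> is replaced by \<open>f \<circ> arcsin_coords R \<circ> sin_coords R\<close>: it agrees with \<open>f\<close> on the
  box and, being periodic, it is a uniform limit of trigonometric polynomials on the whole space.
\<close>

lemma trig_poly_approx:
  fixes f :: "'b::euclidean_space \<Rightarrow> real"
  assumes f: "continuous_on UNIV f" and B: "\<And>x. \<bar>f x\<bar> \<le> B" and R: "R > 0" and e: "e > 0"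
  obtains p where "trig_poly (\<lambda>x. complex_of_real (p x))"
    "\<And>x. \<bar>p x\<bar> \<le> B + e"
    "\<And>x. (\<And>b. b \<in> Basis \<Longrightarrow> \<bar>x \<bullet> b\<bar> \<le> R) \<Longrightarrow> \<bar>f x - p x\<bar> \<le> e"
proof -
  let ?C = "cbox (- (\<Sum>Basis)) (\<Sum>Basis) :: 'b set"
  have "continuous_on ?C (\<lambda>x. f (arcsin_coords R x))"
    by (rule continuous_on_compose2[OF f continuous_on_arcsin_coords]) auto
  then obtain q where q: "real_polynomial_function q"
    "\<And>x. x \<in> ?C \<Longrightarrow> \<bar>f (arcsin_coords R x) - q x\<bar> < e"
    using Stone_Weierstrass_real_polynomial_function[of ?C] compact_cbox e by blast
  have *: "\<bar>f (arcsin_coords R (sin_coords R x)) - q (sin_coords R x)\<bar> < e" for x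
    by (intro q(2) sin_coords_in_cube)
  show thesis
  proof (rule that[of "\<lambda>x. q (sin_coords R x)"])
    show "trig_poly (\<lambda>x. complex_of_real (q (sin_coords R x)))"
      by (rule trig_poly_real_polynomial_sin_coords[OF q(1)])
    show "\<bar>q (sin_coords R x)\<bar> \<le> B + e" for x
      using *[of x] B[of "arcsin_coords R (sin_coords R x)"] by linarith
    show "\<bar>f x - q (sin_coords R x)\<bar> \<le> e" if "\<And>b. b \<in> Basis \<Longrightarrow> \<bar>x \<bullet> b\<bar> \<le> R" for x
      using *[of x] arcsin_sin_coords[OF R, of x] that by simp
  qed
qed

text \<open>Off the box of radius \<open>R\<close> the difference \<open>f - p\<close> is at most
  \<open>2 * B + e\<close> and some coordinate exceeds \<open>R\<close>, where \<open>h\<close> is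
  at least 1; so the error is charged to the sum of \<open>h\<close> over the coordinates. A general
  majorant \<open>h\<close> of the tail indicator leaves room for a continuous one, whose integrals
  pass to weak limits.\<close>

lemma integral_approx:
  fixes f p :: "'b::euclidean_space \<Rightarrow> real"
  assumes "prob_space \<mu>" and sets: "sets \<mu> = sets borel"
    and f[measurable]: "f \<in> borel_measurable borel" and p[measurable]: "p \<in> borel_measurable borel"
    and fB: "\<And>x. \<bar>f x\<bar> \<le> B" and pB: "\<And>x. \<bar>p x\<bar> \<le> B + e"
    and fp: "\<And>x. (\<And>b. b \<in> Basis \<Longrightarrow> \<bar>x \<bullet> b\<bar> \<le> R) \<Longrightarrow> \<bar>f x - p x\<bar> \<le> e" and "e > 0"
    and h[measurable]: "h \<in> borel_measurable borel" and h: "\<And>x. R \<le> \<bar>x\<bar> \<Longrightarrow> 1 \<le> h x"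
      "\<And>x. 0 \<le> h x" "\<And>x. h x \<le> (1::real)"
  shows "\<bar>integral\<^sup>L \<mu> f - integral\<^sup>L \<mu> p\<bar> \<le> e + (2 * B + e) * (\<Sum>b\<in>Basis. (LINT x|\<mu>. h (x \<bullet> b)))"
proof -
  interpret prob_space \<mu> by fact
  note [measurable_cong] = sets
  have int: "integrable \<mu> f" "integrable \<mu> p"
    using integrable_const_bound[of f B] integrable_const_bound[of p "B + e"] fB pB by auto
  have inth: "integrable \<mu> (\<lambda>x. h (x \<bullet> b))" for b
    using h by (intro integrable_const_bound[of _ 1]) auto
  have B0: "0 \<le> B" using fB[of 0] by linarith
  have "\<bar>f x - p x\<bar> \<le> e + (2 * B + e) * (\<Sum>b\<in>Basis. h (x \<bullet> b))" for x
  proof (cases "\<forall>b\<in>Basis. \<bar>x \<bullet> b\<bar> \<le> R")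
    case True
    then have "\<bar>f x - p x\<bar> \<le> e" by (intro fp) auto
    moreover have "0 \<le> (2 * B + e) * (\<Sum>b\<in>Basis. h (x \<bullet> b))"
      using B0 \<open>e > 0\<close> h(2) by (intro mult_nonneg_nonneg sum_nonneg) auto
    ultimately show ?thesis by linarith
  next
    case False
    then obtain b where b: "b \<in> Basis" "R < \<bar>x \<bullet> b\<bar>" by auto
    then have "1 \<le> h (x \<bullet> b)" by (intro h(1)) auto
    also have "\<dots> \<le> (\<Sum>b\<in>Basis. h (x \<bullet> b))"
      using b h(2) by (intro member_le_sum) auto
    finally have "(2 * B + e) * 1 \<le> (2 * B + e) * (\<Sum>b\<in>Basis. h (x \<bullet> b))"
      using B0 \<open>e > 0\<close> by (intro mult_left_mono) auto
    moreover have "\<bar>f x - p x\<bar> \<le> (2 * B + e) * 1" using fB[of x] pB[of x] by (simp add: abs_le_iff)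
    ultimately show ?thesis using \<open>e > 0\<close> by simp
  qed
  then have "\<bar>LINT x|\<mu>. f x - p x\<bar> \<le> (LINT x|\<mu>. e + (2 * B + e) * (\<Sum>b\<in>Basis. h (x \<bullet> b)))"
    using int inth by (intro integral_abs_bound[THEN order_trans] integral_mono) auto
  also have "\<dots> = e + (2 * B + e) * (\<Sum>b\<in>Basis. (LINT x|\<mu>. h (x \<bullet> b)))"
    using inth by (simp add: prob_space)
  finally show ?thesis using int by simp
qed

lemma tendsto_tail_function:
  assumes "real_distribution \<mu>"
  shows "((\<lambda>n. LINT x|\<mu>. min 1 (max 0 (\<bar>x\<bar> - real n))) \<longlongrightarrow> 0) sequentially"
proof -
  interpret real_distribution \<mu> by fact
  have "(\<lambda>n. LINT x|\<mu>. min 1 (max 0 (\<bar>x\<bar> - real n))) \<longlonglongrightarrow> (LINT x|\<mu>. 0)"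
  proof (rule integral_dominated_convergence[where w="\<lambda>_. 1"])
    show "AE x in \<mu>. (\<lambda>n. min 1 (max 0 (\<bar>x\<bar> - real n))) \<longlonglongrightarrow> 0"
    proof (rule AE_I2)
      fix x :: real
      have "\<forall>\<^sub>F n in sequentially. min 1 (max 0 (\<bar>x\<bar> - real n)) = 0"
        using eventually_ge_at_top[of "nat \<lceil>\<bar>x\<bar>\<rceil>"] by eventually_elim (auto simp: min_def max_def; linarith)
      then show "(\<lambda>n. min 1 (max 0 (\<bar>x\<bar> - real n))) \<longlonglongrightarrow> 0"
        by (simp add: tendsto_eventually)
    qed
  qed auto
  then show ?thesis by simp
qed

text \<open>Tightness is obtained coordinatewise: the characteristic function of
  \<open>b \<bullet> Y n\<close> at \<open>t\<close> is that of \<open>Y n\<close> at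
  \<open>t *\<^sub>R b\<close>, so the one-dimensional continuity theorem applies and controls the
  tails for all large \<open>n\<close>. On the remaining box the test function is replaced by a
  trigonometric polynomial.\<close>

theorem converges_in_distribution_if_char:
  fixes Y :: "nat \<Rightarrow> 'w \<Rightarrow> 'b::euclidean_space"
  assumes P: "prob_space P" and Y[measurable]: "\<And>n. Y n \<in> borel_measurable P"
    and \<nu>: "prob_space \<nu>" "sets \<nu> = sets borel"
    and char: "\<And>u. (\<lambda>n. LINT \<omega>|P. iexp (u \<bullet> Y n \<omega>)) \<longlonglongrightarrow> (LINT x|\<nu>. iexp (u \<bullet> x))"
  shows "converges_in_distribution P Y \<nu>"
  unfolding converges_in_distribution_def
proof (intro conjI allI impI)
  interpret P: prob_space P by fact
  interpret \<nu>: prob_space \<nu> by fact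
  note [measurable_cong] = \<nu>(2)
  let ?D = "\<lambda>n. distr P borel (Y n)"
  interpret D: prob_space "?D n" for n by (rule P.prob_space_distr) simp
  have trig: "(\<lambda>n. LINT x|?D n. p x) \<longlonglongrightarrow> (LINT x|\<nu>. p x)" if "trig_poly p" for p
    using that
  proof (induction p)
    case (exp c u)
    have "(LINT x|?D n. c * iexp (u \<bullet> x)) = c * (LINT \<omega>|P. iexp (u \<bullet> Y n \<omega>))" for n
      by (subst integral_distr) auto
    moreover have "(LINT x|\<nu>. c * iexp (u \<bullet> x)) = c * (LINT x|\<nu>. iexp (u \<bullet> x))" by simp
    ultimately show ?case using tendsto_mult_left[OF char[of u], of c] by (simp only:)
  next
    case (add f g)
    have int: "integrable \<mu> h" if "trig_poly h" "prob_space \<mu>" "sets \<mu> = sets borel"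
      for \<mu> and h :: "'b \<Rightarrow> complex"
    proof -
      interpret prob_space \<mu> by fact
      obtain B where "\<forall>x. norm (h x) \<le> B" using bounded_trig_poly \<open>trig_poly h\<close> by blast
      moreover have "h \<in> borel_measurable \<mu>"
        using borel_measurable_continuous_onI[OF continuous_on_trig_poly[OF that(1)]] that(3)
        by (simp cong: measurable_cong_sets)
      ultimately show ?thesis by (intro integrable_const_bound) auto
    qed
    have "(LINT x|\<mu>. f x + g x) = (LINT x|\<mu>. f x) + (LINT x|\<mu>. g x)"
      if "prob_space \<mu>" "sets \<mu> = sets borel" for \<mu>
      using int[OF add.hyps(1) that] int[OF add.hyps(2) that] by simp
    then show ?case using add.IH \<nu> D.prob_space_axioms by (simp add: tendsto_add)
  qed
  fix f :: "'b \<Rightarrow> real"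
  assume f: "continuous_on UNIV f" and "bounded (range f)"
  then obtain B where B: "\<And>x. \<bar>f x\<bar> \<le> B" by (auto simp: bounded_iff)
  have [measurable]: "f \<in> borel_measurable borel" by (rule borel_measurable_continuous_onI[OF f])
  have B0: "0 \<le> B" using B[of 0] by linarith
  define h where "h k x = min 1 (max 0 (\<bar>x\<bar> - real k))" for k and x :: real
  have hm[measurable]: "h k \<in> borel_measurable borel" for k unfolding h_def by measurable
  have h_conv: "(\<lambda>n. LINT x|?D n. h k (x \<bullet> b)) \<longlonglongrightarrow> (LINT x|\<nu>. h k (x \<bullet> b))" for k b
  proof -
    have wc: "weak_conv_m (\<lambda>n. distr P borel (\<lambda>\<omega>. b \<bullet> Y n \<omega>)) (distr \<nu> borel (\<lambda>x. b \<bullet> x))"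
    proof (rule levy_continuity)
      show "real_distribution (distr P borel (\<lambda>\<omega>. b \<bullet> Y n \<omega>))" for n
        by (rule P.real_distribution_distr) auto
      show "real_distribution (distr \<nu> borel (\<lambda>x. b \<bullet> x))"
        by (rule \<nu>.real_distribution_distr) auto
      show "(\<lambda>n. char (distr P borel (\<lambda>\<omega>. b \<bullet> Y n \<omega>)) t) \<longlonglongrightarrow> char (distr \<nu> borel (\<lambda>x. b \<bullet> x)) t" for t
        using char[of "t *\<^sub>R b"] by (simp add: char_def integral_distr)
    qed
    have "(\<lambda>n. LINT x|distr P borel (\<lambda>\<omega>. b \<bullet> Y n \<omega>). h k x) \<longlonglongrightarrow> (LINT x|distr \<nu> borel (\<lambda>x. b \<bullet> x). h k x)"
    proof (rule weak_conv_imp_integral_bdd_continuous_conv[OF _ _ wc])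
      show "norm (h k x) \<le> 1" for x by (auto simp: h_def)
    qed (auto simp: h_def intro!: continuous_intros P.real_distribution_distr \<nu>.real_distribution_distr)
    then show ?thesis by (simp add: integral_distr inner_commute)
  qed
  show "(\<lambda>n. integral\<^sup>L (?D n) f) \<longlonglongrightarrow> integral\<^sup>L \<nu> f"
  proof (rule LIMSEQ_I)
    fix r :: real assume "r > 0"
    \<comment> \<open>The final error is below \<open>3 * e + 2 * ((2 * B + 1) * e)\<close>; the
      denominator makes twice this at most \<open>r\<close>, and the cap at 1 gives
      \<open>2 * B + e \<le> 2 * B + 1\<close>.\<close>
    define e where "e = min 1 (r / (6 + 4 * (2 * B + 1)))"
    have den: "6 + 4 * (2 * B + 1) > 0" using B0 by (intro add_pos_nonneg) auto
    have e: "e > 0" "e \<le> 1" "(6 + 4 * (2 * B + 1)) * e \<le> r"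
    proof -
      show "e > 0" "e \<le> 1" using \<open>r > 0\<close> den by (auto simp: e_def)
      have "e \<le> r / (6 + 4 * (2 * B + 1))" by (simp add: e_def)
      then show "(6 + 4 * (2 * B + 1)) * e \<le> r" using den by (simp only: pos_le_divide_eq mult.commute)
    qed
    have "\<forall>\<^sub>F k in sequentially. (\<Sum>b\<in>Basis. LINT x|\<nu>. h k (x \<bullet> b)) < e"
    proof (rule order_tendstoD)
      have "(\<lambda>k. LINT x|\<nu>. h k (x \<bullet> b)) \<longlonglongrightarrow> 0" for b
        using tendsto_tail_function[OF \<nu>.real_distribution_distr, of "\<lambda>x. x \<bullet> b"]
        by (simp add: integral_distr h_def)
      then show "(\<lambda>k. \<Sum>b\<in>Basis. LINT x|\<nu>. h k (x \<bullet> b)) \<longlonglongrightarrow> 0"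
        by (auto intro: tendsto_null_sum)
    qed (rule e)
    then obtain k where k: "(\<Sum>b\<in>Basis. LINT x|\<nu>. h k (x \<bullet> b)) < e"
      by (auto simp: eventually_sequentially)
    \<comment> \<open>The ramp \<open>h k\<close> climbs from 0 at distance \<open>k\<close> to 1 at
      distance \<open>k + 1\<close>, hence the box of radius \<open>k + 1\<close>.\<close>
    define R where "R = real k + 1"
    have "R > 0" by (simp add: R_def)
    obtain p where p: "trig_poly (\<lambda>x. complex_of_real (p x))" "\<And>x. \<bar>p x\<bar> \<le> B + e"
      "\<And>x. (\<And>b. b \<in> Basis \<Longrightarrow> \<bar>x \<bullet> b\<bar> \<le> R) \<Longrightarrow> \<bar>f x - p x\<bar> \<le> e"
      using trig_poly_approx[OF f B \<open>R > 0\<close> \<open>e > 0\<close>] by blast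
    have [measurable]: "p \<in> borel_measurable borel"
      using borel_measurable_continuous_onI[OF continuous_on_trig_poly[OF p(1)]]
      by (simp add: borel_measurable_complex_iff)
    have approx: "\<bar>integral\<^sup>L \<mu> f - integral\<^sup>L \<mu> p\<bar> \<le> e + (2 * B + e) * (\<Sum>b\<in>Basis. (LINT x|\<mu>. h k (x \<bullet> b)))"
      if "prob_space \<mu>" "sets \<mu> = sets borel" for \<mu>
      using that by (intro integral_approx[where R=R] B p e) (auto simp: h_def R_def)
    have "(\<lambda>n. \<Sum>b\<in>Basis. LINT x|?D n. h k (x \<bullet> b)) \<longlonglongrightarrow> (\<Sum>b\<in>Basis. LINT x|\<nu>. h k (x \<bullet> b))"
      by (intro tendsto_sum h_conv)
    from order_tendstoD(2)[OF this k]
    have ev1: "\<forall>\<^sub>F n in sequentially. (\<Sum>b\<in>Basis. LINT x|?D n. h k (x \<bullet> b)) < e" .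
    have "(\<lambda>n. complex_of_real (LINT x|?D n. p x)) \<longlonglongrightarrow> complex_of_real (LINT x|\<nu>. p x)"
      using trig[OF p(1)] by simp
    then have "(\<lambda>n. (LINT x|?D n. p x)) \<longlonglongrightarrow> (LINT x|\<nu>. p x)"
      using tendsto_of_real_iff by blast
    from tendstoD[OF this e(1)]
    have "\<forall>\<^sub>F n in sequentially. \<bar>(LINT x|?D n. p x) - (LINT x|\<nu>. p x)\<bar> < e"
      by (simp add: dist_real_def)
    with ev1 have "\<forall>\<^sub>F n in sequentially. \<bar>integral\<^sup>L (?D n) f - integral\<^sup>L \<nu> f\<bar> < r"
    proof eventually_elim
      case (elim n)
      have 1: "\<bar>integral\<^sup>L (?D n) f - integral\<^sup>L (?D n) p\<bar> \<le> e + (2 * B + e) * (\<Sum>b\<in>Basis. LINT x|?D n. h k (x \<bullet> b))"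
        by (rule approx) (auto intro: D.prob_space_axioms)
      have 2: "\<bar>integral\<^sup>L \<nu> f - integral\<^sup>L \<nu> p\<bar> \<le> e + (2 * B + e) * (\<Sum>b\<in>Basis. LINT x|\<nu>. h k (x \<bullet> b))"
        by (rule approx[OF \<nu>])
      have 3: "(2 * B + e) * s \<le> (2 * B + 1) * e" if "s < e" for s
      proof -
        have "(2 * B + e) * s \<le> (2 * B + e) * e" using that B0 e(1) by (intro mult_left_mono) auto
        also have "\<dots> \<le> (2 * B + 1) * e" using e(1,2) by (intro mult_right_mono) auto
        finally show ?thesis .
      qed
      have "\<bar>integral\<^sup>L (?D n) f - integral\<^sup>L \<nu> f\<bar> < 3 * e + 2 * ((2 * B + 1) * e)"
        using 1 2 3[OF elim(1)] 3[OF k] elim(2) by linarith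
      also have "\<dots> \<le> (6 + 4 * (2 * B + 1)) * e"
        using B0 e(1) by (simp add: algebra_simps)
      finally show ?case using e(3) by linarith
    qed
    then show "\<exists>no. \<forall>n\<ge>no. norm (integral\<^sup>L (?D n) f - integral\<^sup>L \<nu> f) < r"
      by (auto simp: eventually_sequentially)
  qed
qed simp

section \<open>Multivariate normal laws\<close>

lemma iexp_sum: "iexp (\<Sum>i\<in>A. f i) = (\<Prod>i\<in>A. iexp (f i))"
  by (induction A rule: infinite_finite_induct) (auto simp: distrib_left exp_add)

lemma char_normal_law:
  assumes "0 \<le> v"
  shows "char (normal_law 0 v) t = exp (- (v * t\<^sup>2) / 2)"
proof (cases "v = 0")
  case True
  then show ?thesis
    by (simp add: normal_law_def char_def integral_return)
next
  case False
  with assms have v: "v > 0" by simp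
  let ?N = "density lborel (\<lambda>x. ennreal (normal_density 0 (sqrt v) x))"
  interpret N: prob_space std_normal_distribution
    by (rule prob_space_normal_density) simp
  have "distributed std_normal_distribution lborel (\<lambda>x. x) std_normal_density"
    by (auto simp: distributed_def distr_id2 cong: distr_cong)
  then have "distributed std_normal_distribution lborel (\<lambda>x. 0 + sqrt v * x) (normal_density (0 + sqrt v * 0) (\<bar>sqrt v\<bar> * 1))"
    using v by (intro N.normal_density_affine) auto
  then have "?N = distr std_normal_distribution lborel (\<lambda>x. sqrt v * x)"
    using v by (simp add: distributed_def)
  then have "?N = distr std_normal_distribution borel (\<lambda>x. sqrt v * x)"
    by (simp cong: distr_cong)
  then have "char ?N t = char std_normal_distribution (t * sqrt v)"
    by (simp add: char_def integral_distr mult.assoc)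
  then show ?thesis
    using v False by (simp add: normal_law_def char_std_normal_distribution power_mult_distrib mult.commute)
qed

lemma real_distribution_normal_law:
  assumes "0 \<le> v"
  shows "real_distribution (normal_law 0 v)"
proof -
  have "prob_space (normal_law 0 v)"
    using assms by (auto simp: normal_law_def intro!: prob_space_return prob_space_normal_density)
  then show ?thesis
    by (simp add: real_distribution_def real_distribution_axioms_def normal_law_def)
qed

lemma iexp_linear_std_normal_product:
  fixes v :: "'m::finite \<Rightarrow> real"
  shows "(LINT z|(\<Pi>\<^sub>M i\<in>UNIV. std_normal_distribution). iexp (\<Sum>i\<in>UNIV. v i * z i)) =
    exp (- (\<Sum>i\<in>UNIV. (v i)\<^sup>2) / 2)"
proof -
  interpret N: prob_space std_normal_distribution
    by (rule prob_space_normal_density) simp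
  interpret product_sigma_finite "\<lambda>_::'m. std_normal_distribution" by standard
  have "(LINT z|(\<Pi>\<^sub>M i\<in>UNIV. std_normal_distribution). iexp (\<Sum>i\<in>UNIV. v i * z i)) =
      (LINT z|(\<Pi>\<^sub>M i\<in>UNIV. std_normal_distribution). (\<Prod>i\<in>UNIV. iexp (v i * z i)))"
    by (simp only: iexp_sum)
  also have "\<dots> = (\<Prod>i\<in>UNIV. char std_normal_distribution (v i))"
    unfolding char_def by (rule product_integral_prod) (auto intro: N.integrable_iexp)
  also have "\<dots> = exp (\<Sum>i\<in>UNIV. - (v i)\<^sup>2 / 2)"
    by (simp add: char_std_normal_distribution exp_sum)
  finally show ?thesis by (simp add: sum_negf sum_divide_distrib)
qed

text \<open>The law is the image of independent standard normals under \<open>A\<close>, which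
  treats singular covariances like all others. The factored form makes symmetry immediate and turns
  the quadratic form into the squared length of \<open>transpose A *v u\<close>.\<close>

lemma multivariate_normal_exists:
  fixes A :: "real ^ 'm ^ 'n"
  obtains \<nu> where "multivariate_normal 0 (A ** transpose A) \<nu>"
    "\<And>u. (LINT x|\<nu>. iexp (u \<bullet> x)) = exp (- (u \<bullet> ((A ** transpose A) *v u)) / 2)"
proof -
  let ?Z = "\<Pi>\<^sub>M i\<in>(UNIV :: 'm set). std_normal_distribution"
  interpret N: prob_space std_normal_distribution
    by (rule prob_space_normal_density) simp
  interpret product_prob_space "\<lambda>_::'m. std_normal_distribution" UNIV by standard
  define g :: "('m \<Rightarrow> real) \<Rightarrow> real ^ 'n" where "g z = A *v (\<chi> i. z i)" for z
  have g: "g z = (\<Sum>i\<in>UNIV. z i *\<^sub>R column i A)" for z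
    by (simp add: g_def matrix_mult_sum vec_lambda_beta scalar_mult_eq_scaleR)
  have [measurable]: "g \<in> borel_measurable ?Z" unfolding g by measurable
  define \<nu> where "\<nu> = distr ?Z borel g"
  have sets: "sets \<nu> = sets borel" by (simp add: \<nu>_def)
  interpret \<nu>: prob_space \<nu> unfolding \<nu>_def by (rule prob_space_distr) simp
  have inner_g: "u \<bullet> g z = (\<Sum>i\<in>UNIV. (transpose A *v u) $ i * z i)" for u z
  proof -
    have "u \<bullet> g z = (transpose A *v u) \<bullet> (\<chi> i. z i)"
      by (simp add: g_def dot_lmul_matrix[symmetric] transpose_matrix_vector)
    then show ?thesis by (simp add: inner_vec_def)
  qed
  have quad: "u \<bullet> ((A ** transpose A) *v u) = (\<Sum>i\<in>UNIV. ((transpose A *v u) $ i)\<^sup>2)" for u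
  proof -
    have "u \<bullet> ((A ** transpose A) *v u) = (transpose A *v u) \<bullet> (transpose A *v u)"
      by (simp add: matrix_vector_mul_assoc[symmetric] dot_lmul_matrix[symmetric] transpose_matrix_vector)
    then show ?thesis by (simp add: inner_vec_def power2_eq_square)
  qed
  have char: "(LINT x|\<nu>. iexp (u \<bullet> x)) = exp (- (u \<bullet> ((A ** transpose A) *v u)) / 2)" for u
    unfolding \<nu>_def
    by (subst integral_distr) (auto simp: inner_g quad iexp_linear_std_normal_product simp del: of_real_sum of_real_mult)
  have "distr \<nu> borel (\<lambda>x. u \<bullet> x) = normal_law 0 (u \<bullet> ((A ** transpose A) *v u))" for u
  proof (rule Levy_uniqueness)
    have [simp]: "0 \<le> u \<bullet> ((A ** transpose A) *v u)" by (simp add: quad sum_nonneg)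
    have m: "(\<lambda>x. u \<bullet> x) \<in> borel_measurable \<nu>"
      by (simp add: measurable_cong_sets[OF sets refl])
    show "real_distribution (distr \<nu> borel (\<lambda>x. u \<bullet> x))"
      by (rule \<nu>.real_distribution_distr) (rule m)
    show "real_distribution (normal_law 0 (u \<bullet> ((A ** transpose A) *v u)))"
      by (simp add: real_distribution_normal_law)
    show "char (distr \<nu> borel (\<lambda>x. u \<bullet> x)) = char (normal_law 0 (u \<bullet> ((A ** transpose A) *v u)))"
    proof
      fix t
      have "char (distr \<nu> borel (\<lambda>x. u \<bullet> x)) t = (LINT x|\<nu>. iexp ((t *\<^sub>R u) \<bullet> x))"
        using m by (simp add: char_def integral_distr)
      also have "\<dots> = char (normal_law 0 (u \<bullet> ((A ** transpose A) *v u))) t"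
        unfolding char by (simp add: char_normal_law matrix_vector_mult_scaleR power2_eq_square algebra_simps)
      finally show "char (distr \<nu> borel (\<lambda>x. u \<bullet> x)) t = char (normal_law 0 (u \<bullet> ((A ** transpose A) *v u))) t" .
    qed
  qed
  then have "multivariate_normal 0 (A ** transpose A) \<nu>"
    using sets \<nu>.prob_space_axioms
    by (auto simp: multivariate_normal_def matrix_transpose_mul quad sum_nonneg)
  from that[OF this char] show thesis .
qed

text \<open>
  With \<open>D = diag p\<close> and \<open>q = sqrt p\<close> (so \<open>q\<^sup>T q = 1\<close> and \<open>D\<^sup>1\<^sup>/\<^sup>2 q = p\<close>), the multinomial covariance
  \<open>D - p p\<^sup>T\<close> equals \<open>B B\<^sup>T\<close> for \<open>B = D\<^sup>1\<^sup>/\<^sup>2 - p q\<^sup>T\<close>.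
\<close>

definition Lambda_root ::
  "('l \<Rightarrow> 's \<Rightarrow> 's \<Rightarrow> real) \<Rightarrow> real ^ ('s::finite \<times> 'l::finite \<times> 's) ^ ('s \<times> 'l \<times> 's)" where
  "Lambda_root M = (\<chi> i j. case i of (s, l, t) \<Rightarrow> case j of (s', l', t') \<Rightarrow>
     of_bool ((s, l) = (s', l')) * (of_bool (t = t') * sqrt (M l s t) - M l s t * sqrt (M l' s' t')))"

lemma sum_triple:
  "(\<Sum>i\<in>UNIV. f i) = (\<Sum>s\<in>UNIV. \<Sum>l\<in>UNIV. \<Sum>t\<in>UNIV. f (s, l, t))"
  for f :: "'s::finite \<times> 'l::finite \<times> 't::finite \<Rightarrow> real"
  by (simp add: sum.cartesian_product split_def flip: UNIV_Times_UNIV)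

lemma sum_of_bool_mult:
  "(\<Sum>x\<in>UNIV. of_bool (y = x) * f x) = (f y :: real)" for y :: "'a::finite"
  by (simp add: if_distrib[of "\<lambda>b. b * _"] of_bool_def cong: if_cong)

lemma Lambda_root:
  fixes M :: "'l::finite \<Rightarrow> 's::finite \<Rightarrow> 's \<Rightarrow> real"
  assumes nonneg: "\<And>l s t. 0 \<le> M l s t" and sum1: "\<And>l s. (\<Sum>t\<in>UNIV. M l s t) = 1"
  shows "Lambda_root M ** transpose (Lambda_root M) = Lambda M"
proof -
  have "(Lambda_root M ** transpose (Lambda_root M)) $ (s, l, t) $ (s', l', t') = Lambda M $ (s, l, t) $ (s', l', t')"
    for s l t s' l' t'
  proof -
    have "(Lambda_root M ** transpose (Lambda_root M)) $ (s, l, t) $ (s', l', t') =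
      (\<Sum>s''\<in>UNIV. of_bool (s = s'') * (\<Sum>l''\<in>UNIV. of_bool (l = l'') * (\<Sum>t''\<in>UNIV.
         (of_bool (t = t'') * sqrt (M l s t) - M l s t * sqrt (M l'' s'' t'')) *
         (of_bool ((s', l') = (s'', l'')) * (of_bool (t' = t'') * sqrt (M l' s' t') - M l' s' t' * sqrt (M l'' s'' t''))))))"
      unfolding matrix_matrix_mult_def transpose_def Lambda_root_def sum_triple sum_distrib_left
      by (intro sum.cong refl | simp add: of_bool_def)+
    also have "\<dots> = of_bool ((s, l) = (s', l')) * (\<Sum>t''\<in>UNIV.
         (of_bool (t = t'') * sqrt (M l s t) - M l s t * sqrt (M l s t'')) *
         (of_bool (t' = t'') * sqrt (M l s t') - M l s t' * sqrt (M l s t'')))"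
      unfolding sum_of_bool_mult by (auto simp: of_bool_def)
    \<comment> \<open>The four products give the entry of \<open>D\<close>, that of
      \<open>p p\<^sup>T\<close> twice with a minus sign, and that of \<open>p p\<^sup>T\<close>
      once more with a plus sign because the row sums to 1.\<close>
    also have "(\<Sum>t''\<in>UNIV.
         (of_bool (t = t'') * sqrt (M l s t) - M l s t * sqrt (M l s t'')) *
         (of_bool (t' = t'') * sqrt (M l s t') - M l s t' * sqrt (M l s t''))) =
       (\<Sum>t''\<in>UNIV. of_bool (t = t'') * (of_bool (t' = t'') * (sqrt (M l s t) * sqrt (M l s t')))) -
       (\<Sum>t''\<in>UNIV. of_bool (t = t'') * (M l s t' * (sqrt (M l s t) * sqrt (M l s t'')))) -
       (\<Sum>t''\<in>UNIV. of_bool (t' = t'') * (M l s t * (sqrt (M l s t') * sqrt (M l s t'')))) +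
       (\<Sum>t''\<in>UNIV. M l s t * M l s t' * M l s t'')"
      unfolding sum.distrib[symmetric] sum_subtractf[symmetric]
      by (intro sum.cong refl) (use nonneg in \<open>auto simp: algebra_simps\<close>)
    also have "\<dots> = of_bool (t = t') * M l s t - M l s t * M l s t'"
      unfolding sum_of_bool_mult sum_distrib_left[symmetric] sum1 using nonneg by auto
    finally show ?thesis by (auto simp: Lambda_def)
  qed
  then show ?thesis by (simp add: vec_eq_iff split_paired_all)
qed

section \<open>Growth of the visit counts\<close>

lemma visit_count_Suc:
  "visit_count X a (Suc n) s l \<omega> = visit_count X a n s l \<omega> + of_bool (X n \<omega> = s \<and> a n \<omega> = l)"
  by (simp add: visit_count_def)

lemma visit_count_mono: "m \<le> n \<Longrightarrow> visit_count X a m s l \<omega> \<le> visit_count X a n s l \<omega>"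
  unfolding visit_count_def by (intro sum_mono2) auto

lemma visit_count_le: "visit_count X a n s l \<omega> \<le> n"
  unfolding visit_count_def by (rule order_trans[OF sum_bounded_above[where K=1]]) auto

text \<open>The sum is the time of the \<open>m\<close>-th visit at a positive time; a visit at time
  0 is counted without being a return, so only an inequality holds. \<open>Suc k\<close> appears
  because the count up to \<open>n\<close> looks at the times below \<open>n\<close>.\<close>

lemma le_visit_count_if_return_time_sum_le:
  "(\<Sum>p=1..<Suc m. return_time X a s l p \<omega>) \<le> enat k \<Longrightarrow> m \<le> visit_count X a (Suc k) s l \<omega>"
proof (induction m arbitrary: k)
  case (Suc m)
  let ?T = "\<Sum>p=1..<Suc m. return_time X a s l p \<omega>"
  have "(\<Sum>p=1..<Suc (Suc m). return_time X a s l p \<omega>) = ?T + next_visit X a s l ?T \<omega>"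
    by (subst sum.atLeastLessThan_Suc) (auto simp: return_time.simps[of _ _ _ _ "Suc m"])
  with Suc.prems obtain j q where j: "j \<le> k" "X j \<omega> = s" "a j \<omega> = l" "q < j" "?T = enat q"
    by (auto simp: add_next_visit_le_iff)
  then have "m \<le> visit_count X a (Suc q) s l \<omega>" by (intro Suc.IH) simp
  also have "\<dots> \<le> visit_count X a j s l \<omega>" using j by (intro visit_count_mono) simp
  finally have "Suc m \<le> visit_count X a (Suc j) s l \<omega>" using j by (simp add: visit_count_Suc)
  also have "\<dots> \<le> visit_count X a (Suc k) s l \<omega>" using j by (intro visit_count_mono) simp
  finally show ?case .
qed simp

text \<open>Fewer than \<open>m\<close> visits before \<open>n\<close> push the \<open>m\<close>-th
  return to time \<open>n\<close> or later. Markov's inequality then needs only the expectations of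
  the return times, and these follow by integrating the conditional bounds.\<close>

lemma prob_visit_count_less:
  fixes X :: "nat \<Rightarrow> 'w \<Rightarrow> 's::finite" and a :: "nat \<Rightarrow> 'w \<Rightarrow> 'l::finite"
  assumes P: "prob_space P"
    and X: "\<And>i. X i \<in> measurable P (count_space UNIV)"
    and a: "\<And>i. a i \<in> measurable P (count_space UNIV)"
    and T: "\<And>i. i \<ge> 1 \<Longrightarrow> AE \<omega> in P. expected_return_time P X a s l i \<omega> \<le> ennreal (T i)"
    and T_nonneg: "\<And>i. i \<ge> 1 \<Longrightarrow> 0 \<le> T i" and n: "n > 0"
  shows "\<P>(\<omega> in P. visit_count X a n s l \<omega> < m) \<le> (\<Sum>i=1..m. T i) / n"
proof -
  interpret prob_space P by fact
  note [measurable] = X a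
  let ?t = "\<lambda>i \<omega>. ennreal_of_enat (return_time X a s l i \<omega>)"
  have [measurable]: "?t i \<in> borel_measurable P" for i
    by (rule borel_measurable_return_time[OF X a])
  have [measurable]: "visit_count X a n s l \<in> measurable P (count_space UNIV)"
    unfolding visit_count_def by measurable
  have int: "(\<integral>\<^sup>+\<omega>. ?t i \<omega> \<partial>P) \<le> ennreal (T i)" if "i \<ge> 1" for i
  proof -
    interpret finite_measure_subalgebra P "return_sigma P X a s l i"
      by (simp add: finite_measure_subalgebra_def finite_measure_subalgebra_axioms_def
          subalgebra_return_sigma[OF X a] finite_measure_axioms)
    \<comment> \<open>Testing the conditional expectation against the constant 1 yields the tower
      property.\<close>
    have "(\<integral>\<^sup>+\<omega>. ?t i \<omega> \<partial>P) = (\<integral>\<^sup>+\<omega>. 1 * nn_cond_exp P (return_sigma P X a s l i) (?t i) \<omega> \<partial>P)"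
      by (subst nn_cond_exp_intg) auto
    also have "\<dots> \<le> (\<integral>\<^sup>+\<omega>. ennreal (T i) \<partial>P)"
      using T[OF that] by (intro nn_integral_mono_AE) (simp add: expected_return_time_def)
    also have "\<dots> = ennreal (T i)" by (simp add: emeasure_space_1)
    finally show ?thesis .
  qed
  let ?S = "\<lambda>\<omega>. \<Sum>i=1..m. ?t i \<omega>"
  have sub: "{\<omega> \<in> space P. visit_count X a n s l \<omega> < m} \<subseteq> {\<omega> \<in> space P. 1 \<le> ennreal (1 / n) * ?S \<omega>}"
  proof safe
    fix \<omega> assume "visit_count X a n s l \<omega> < m"
    then have "\<not> (\<Sum>p=1..<Suc m. return_time X a s l p \<omega>) \<le> enat (n - 1)"
      using le_visit_count_if_return_time_sum_le[where k="n - 1" and m=m and X=X and a=a and s=s and l=l and \<omega>=\<omega>] n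
      by auto
    then have "enat n \<le> (\<Sum>p=1..<Suc m. return_time X a s l p \<omega>)"
      using n by (cases "\<Sum>p=1..<Suc m. return_time X a s l p \<omega>") auto
    then have "ennreal_of_enat (enat n) \<le> ?S \<omega>"
      by (simp only: ennreal_of_enat_le_iff sum_ennreal_of_enat atLeastLessThanSuc_atLeastAtMost)
    then have "ennreal (1 / n) * ennreal n \<le> ennreal (1 / n) * ?S \<omega>"
      by (intro mult_left_mono) (auto simp: ennreal_of_nat_eq_real_of_nat)
    then show "1 \<le> ennreal (1 / n) * ?S \<omega>"
      using n by (simp flip: ennreal_mult)
  qed
  have "emeasure P {\<omega> \<in> space P. visit_count X a n s l \<omega> < m} \<le> ennreal (1 / n) * (\<integral>\<^sup>+\<omega>. ?S \<omega> * indicator (space P) \<omega> \<partial>P)"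
    by (rule order_trans[OF emeasure_mono[OF sub] nn_integral_Markov_inequality])
       (auto simp del: sum_ennreal_of_enat)
  also have "(\<integral>\<^sup>+\<omega>. ?S \<omega> * indicator (space P) \<omega> \<partial>P) = (\<integral>\<^sup>+\<omega>. ?S \<omega> \<partial>P)"
    by (intro nn_integral_cong) simp
  also have "\<dots> = (\<Sum>i=1..m. \<integral>\<^sup>+\<omega>. ?t i \<omega> \<partial>P)" by (rule nn_integral_sum) simp
  also have "ennreal (1 / n) * \<dots> \<le> ennreal (1 / n) * (\<Sum>i=1..m. ennreal (T i))"
    by (intro mult_left_mono sum_mono int) auto
  also have "\<dots> = ennreal ((\<Sum>i=1..m. T i) / n)"
    using T_nonneg by (subst sum_ennreal, simp, subst ennreal_mult[symmetric]) (auto intro: sum_nonneg)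
  finally have "emeasure P {\<omega> \<in> space P. visit_count X a n s l \<omega> < m} \<le> ennreal ((\<Sum>i=1..m. T i) / n)" .
  moreover have "0 \<le> (\<Sum>i=1..m. T i) / n"
    using T_nonneg by (intro divide_nonneg_nonneg sum_nonneg) auto
  ultimately show ?thesis
    by (simp only: emeasure_eq_measure ennreal_le_iff)
qed

text \<open>Adding the finitely many exceptional values to the constant extends the asymptotic bound
  down to \<open>i = 1\<close>; this works because \<open>real i powr \<alpha>\<close> is at least 1
  there.\<close>

lemma bigo_powr_bound:
  assumes "T \<in> O(\<lambda>i. real i powr \<alpha>)" "0 < \<alpha>"
  obtains C where "C > 0" "\<And>i. i \<ge> 1 \<Longrightarrow> T i \<le> C * real i powr \<alpha>"
proof -
  obtain c N where c: "c > 0" "\<And>i. i \<ge> N \<Longrightarrow> \<bar>T i\<bar> \<le> c * real i powr \<alpha>"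
    using assms(1) by (auto simp: bigo_def eventually_sequentially)
  define C where "C = c + (\<Sum>i<N. \<bar>T i\<bar>)"
  have "T i \<le> C * real i powr \<alpha>" if "i \<ge> 1" for i
  proof -
    have p: "1 \<le> real i powr \<alpha>" using that assms(2) by (simp add: ge_one_powr_ge_zero)
    show ?thesis
    proof (cases "i \<ge> N")
      case True
      have "T i \<le> c * real i powr \<alpha>" using c(2)[OF True] by simp
      also have "\<dots> \<le> C * real i powr \<alpha>" by (intro mult_right_mono) (auto simp: C_def sum_nonneg)
      finally show ?thesis .
    next
      case False
      then have "\<bar>T i\<bar> \<le> (\<Sum>i<N. \<bar>T i\<bar>)" by (intro member_le_sum) auto
      then have "T i \<le> C * 1" using c(1) by (simp add: C_def)
      also have "\<dots> \<le> C * real i powr \<alpha>"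
        using p c(1) by (intro mult_left_mono) (auto simp: C_def sum_nonneg add_nonneg_nonneg)
      finally show ?thesis .
    qed
  qed
  moreover have "C > 0" using c(1) by (simp add: C_def add_pos_nonneg sum_nonneg)
  ultimately show thesis using that by blast
qed

text \<open>
  The threshold \<open>nat \<lfloor>(\<epsilon> n / C) powr (1 / (1 + \<alpha>))\<rfloor>\<close> comes from Markov's inequality for the
  \<open>m\<close>-th visit time, whose mean is at most \<open>C m powr (1 + \<alpha>)\<close>.
\<close>

lemma visit_count_growth:
  fixes X :: "nat \<Rightarrow> 'w \<Rightarrow> 's::finite" and a :: "nat \<Rightarrow> 'w \<Rightarrow> 'l::finite"
  assumes P: "prob_space P"
    and X: "\<And>i. X i \<in> measurable P (count_space UNIV)"
    and a: "\<And>i. a i \<in> measurable P (count_space UNIV)"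
    and \<alpha>: "0 < \<alpha>" "\<alpha> < 1" and T: "T \<in> O(\<lambda>i. real i powr \<alpha>)"
    and ert: "\<And>i. i \<ge> 1 \<Longrightarrow> AE \<omega> in P. expected_return_time P X a s l i \<omega> \<le> ennreal (T i)"
    and \<epsilon>: "\<epsilon> > 0"
  obtains m :: "nat \<Rightarrow> nat" where "(\<lambda>n. sqrt n / m n) \<longlonglongrightarrow> 0"
    "filterlim m at_top sequentially"
    "\<And>n. n > 0 \<Longrightarrow> \<P>(\<omega> in P. visit_count X a n s l \<omega> < m n) \<le> \<epsilon>"
proof -
  obtain C where C: "C > 0" "\<And>i. i \<ge> 1 \<Longrightarrow> T i \<le> C * real i powr \<alpha>"
    using bigo_powr_bound[OF T \<alpha>(1)] by blast
  define c where "c = \<epsilon> / C"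
  have c: "c > 0" using \<epsilon> C by (simp add: c_def)
  define m where "m n = nat \<lfloor>(c * real n) powr (1 / (1 + \<alpha>))\<rfloor>" for n
  \<comment> \<open>The power bound supplies nonnegativity, which is not known of \<open>T\<close>,
    and monotonicity in \<open>i\<close>, used below to bound the sum by \<open>m n\<close> equal
    terms.\<close>
  have ert': "AE \<omega> in P. expected_return_time P X a s l i \<omega> \<le> ennreal (C * real i powr \<alpha>)" if "i \<ge> 1" for i
    using ert[OF that] by eventually_elim (use C(2)[OF that] in \<open>auto intro: order_trans ennreal_leI\<close>)
  have "\<P>(\<omega> in P. visit_count X a n s l \<omega> < m n) \<le> \<epsilon>" if "n > 0" for n
  proof -
    have "\<P>(\<omega> in P. visit_count X a n s l \<omega> < m n) \<le> (\<Sum>i=1..m n. C * real i powr \<alpha>) / n"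
      by (rule prob_visit_count_less[OF P X a ert' _ that]) (use C in auto)
    also have "\<dots> \<le> (\<Sum>i=1..m n. C * real (m n) powr \<alpha>) / n"
      using C \<alpha> by (intro divide_right_mono sum_mono mult_left_mono powr_mono2) auto
    also have "\<dots> = C * real (m n) powr (1 + \<alpha>) / n"
      by (cases "m n = 0") (auto simp: powr_add)
    also have "\<dots> \<le> C * ((c * real n) powr (1 / (1 + \<alpha>))) powr (1 + \<alpha>) / n"
      using C \<alpha> by (intro divide_right_mono mult_left_mono powr_mono2) (auto simp: m_def)
    also have "\<dots> = C * (c * real n) / n"
      using \<alpha> c by (simp add: powr_powr)
    also have "\<dots> = \<epsilon>" using that C by (simp add: c_def)
    finally show ?thesis .
  qed
  moreover have lim: "(\<lambda>n. sqrt n / real (m n)) \<longlonglongrightarrow> 0"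
  proof -
    define \<beta> where "\<beta> = 1 / (1 + \<alpha>)"
    have \<beta>: "1 / 2 < \<beta>" using \<alpha> by (simp add: \<beta>_def field_simps)
    have top: "filterlim (\<lambda>n::nat. (c * real n) powr \<beta>) at_top sequentially"
      using c \<beta> by real_asymp
    \<comment> \<open>Taking the floor loses at most 1, which is at most half of the power once the
      power is at least 2; hence the factor 2 in the comparison.\<close>
    have "\<forall>\<^sub>F n in sequentially. 2 \<le> (c * real n) powr \<beta>"
      using top by (simp add: filterlim_at_top)
    then have "\<forall>\<^sub>F n in sequentially. norm (sqrt n / real (m n)) \<le> 2 * (sqrt n / (c * real n) powr \<beta>)"
    proof eventually_elim
      case (elim n)
      have "(c * real n) powr \<beta> / 2 \<le> (c * real n) powr \<beta> - 1" using elim by simp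
      also have "\<dots> \<le> real (m n)" unfolding m_def \<beta>_def by linarith
      finally have "(c * real n) powr \<beta> / 2 \<le> real (m n)" .
      moreover have "n > 0" by (rule ccontr) (use elim in auto)
      ultimately have "sqrt n / real (m n) \<le> sqrt n / ((c * real n) powr \<beta> / 2)"
        using elim by (intro divide_left_mono mult_pos_pos) (auto intro: less_le_trans[of 0 "(c * real n) powr \<beta> / 2"])
      then show ?case by (simp add: mult.commute)
    qed
    moreover have "(\<lambda>n::nat. 2 * (sqrt n / (c * real n) powr \<beta>)) \<longlonglongrightarrow> 0"
      using c \<beta> by real_asymp
    ultimately show ?thesis by (rule Lim_null_comparison)
  qed
  moreover have "filterlim m at_top sequentially"
  proof -
    have "filterlim (\<lambda>n::nat. (c * real n) powr (1 / (1 + \<alpha>))) at_top sequentially"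
      using c \<alpha> by real_asymp
    then show ?thesis unfolding m_def
      by (rule filterlim_compose[OF filterlim_nat_sequentially filterlim_compose[OF filterlim_floor_sequentially]])
  qed
  ultimately show thesis using that by blast
qed

section \<open>Variance of the visit counts\<close>

locale finite_process = prob_space P for P :: "'w measure" +
  fixes X :: "nat \<Rightarrow> 'w \<Rightarrow> 's::finite" and a :: "nat \<Rightarrow> 'w \<Rightarrow> 'l::finite"
  assumes X_measurable [measurable]: "\<And>i. X i \<in> measurable P (count_space UNIV)"
    and a_measurable [measurable]: "\<And>i. a i \<in> measurable P (count_space UNIV)"
begin

lemma trajectory_Suc: "trajectory X a 0 (Suc n) \<omega> = trajectory X a 0 n \<omega> @ [(X n \<omega>, a n \<omega>)]"
  by (simp add: trajectory_def)

lemma length_trajectory [simp]: "length (trajectory X a i j \<omega>) = j - i"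
  by (simp add: trajectory_def)

lemma trajectory_eq_iff:
  "trajectory X a i j \<omega> = h \<longleftrightarrow> length h = j - i \<and> (\<forall>k<j - i. (X (i + k) \<omega>, a (i + k) \<omega>) = h ! k)"
  by (auto simp: trajectory_def list_eq_iff_nth_eq)

lemma measurable_trajectory [measurable]: "trajectory X a i j \<in> measurable P (count_space UNIV)"
proof (rule measurable_count_space_eq2_countable[THEN iffD2], intro conjI ballI)
  show "trajectory X a i j -` {h} \<inter> space P \<in> sets P" for h
  proof -
    have "Measurable.pred P (\<lambda>\<omega>. trajectory X a i j \<omega> = h)"
      unfolding trajectory_eq_iff by measurable
    then show ?thesis by (simp add: pred_def vimage_def Int_def conj_commute)
  qed
qed auto

text \<open>The unnormalised conditional expectation \<open>E[f; path = h]\<close>. It is additive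
  over the one-step extensions of \<open>h\<close> and vanishes on null paths; dividing by
  \<open>path_prob h\<close> gives the conditional expectation. Real values serve the counts,
  complex ones the characteristic functions.\<close>

definition on_path :: "('w \<Rightarrow> 'b::{banach, second_countable_topology, real_normed_algebra_1}) \<Rightarrow> ('s \<times> 'l) list \<Rightarrow> 'b" where
  "on_path f h = (LINT \<omega>|P. of_bool (trajectory X a 0 (length h) \<omega> = h) * f \<omega>)"

abbreviation path_prob :: "('s \<times> 'l) list \<Rightarrow> real" where
  "path_prob \<equiv> on_path (\<lambda>_. 1)"

lemma path_prob_eq: "path_prob h = \<P>(\<omega> in P. trajectory X a 0 (length h) \<omega> = h)"
proof -
  have "path_prob h = (LINT \<omega>|P. indicator {\<omega> \<in> space P. trajectory X a 0 (length h) \<omega> = h} \<omega>)"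
    unfolding on_path_def by (intro Bochner_Integration.integral_cong) (auto simp: indicator_def)
  also have "\<dots> = \<P>(\<omega> in P. trajectory X a 0 (length h) \<omega> = h)" by simp
  finally show ?thesis .
qed

lemma path_prob_nonneg: "0 \<le> path_prob h"
  by (simp add: path_prob_eq)

lemma integrable_on_path:
  fixes f :: "'w \<Rightarrow> 'b::{banach, second_countable_topology, real_normed_field}"
  assumes [measurable]: "f \<in> borel_measurable P" and B: "\<And>\<omega>. norm (f \<omega>) \<le> B"
  shows "integrable P (\<lambda>\<omega>. of_bool (trajectory X a 0 i \<omega> = h) * f \<omega>)"
proof (rule integrable_const_bound[of _ B])
  have "0 \<le> B" using B order_trans norm_ge_zero by blast
  then show "AE \<omega> in P. norm (of_bool (trajectory X a 0 i \<omega> = h) * f \<omega>) \<le> B"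
    using B by (auto simp: of_bool_def)
  have [measurable]: "Measurable.pred P (\<lambda>\<omega>. trajectory X a 0 i \<omega> = h)" by measurable
  show "(\<lambda>\<omega>. of_bool (trajectory X a 0 i \<omega> = h) * f \<omega>) \<in> borel_measurable P"
    unfolding of_bool_def by measurable
qed

lemma on_path_split:
  fixes f :: "'w \<Rightarrow> 'b::{banach, second_countable_topology, real_normed_field}"
  assumes [measurable]: "f \<in> borel_measurable P" and B: "\<And>\<omega>. norm (f \<omega>) \<le> B"
  shows "on_path f h = (\<Sum>z\<in>UNIV. on_path f (h @ [z]))"
proof -
  have *: "of_bool (trajectory X a 0 (length h) \<omega> = h) * f \<omega> =
      (\<Sum>z\<in>UNIV. of_bool (trajectory X a 0 (length (h @ [z])) \<omega> = h @ [z]) * f \<omega>)" for \<omega>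
  proof -
    have "(\<Sum>z\<in>UNIV. of_bool (trajectory X a 0 (length (h @ [z])) \<omega> = h @ [z]) * f \<omega>) =
        (\<Sum>z\<in>UNIV. if z = (X (length h) \<omega>, a (length h) \<omega>)
           then of_bool (trajectory X a 0 (length h) \<omega> = h) * f \<omega> else 0)"
      by (intro sum.cong) (auto simp: trajectory_Suc)
    also have "\<dots> = of_bool (trajectory X a 0 (length h) \<omega> = h) * f \<omega>"
      by (subst sum.delta) auto
    finally show ?thesis by (rule sym)
  qed
  show ?thesis
    unfolding on_path_def * by (rule Bochner_Integration.integral_sum) (rule integrable_on_path[OF assms])
qed

lemma finite_lists_length [simp]: "finite {h :: ('s \<times> 'l) list. length h = n}"
  using finite_lists_length_eq[of "UNIV :: ('s \<times> 'l) set" n] by simp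

lemma integral_eq_sum_on_path:
  fixes f :: "'w \<Rightarrow> 'b::{banach, second_countable_topology, real_normed_field}"
  assumes [measurable]: "f \<in> borel_measurable P" and B: "\<And>\<omega>. norm (f \<omega>) \<le> B"
  shows "(LINT \<omega>|P. f \<omega>) = (\<Sum>h | length h = n. on_path f h)"
proof -
  have *: "f \<omega> = (\<Sum>h | length h = n. of_bool (trajectory X a 0 n \<omega> = h) * f \<omega>)" for \<omega>
  proof -
    have "(\<Sum>h | length h = n. of_bool (trajectory X a 0 n \<omega> = h) * f \<omega>) =
        (\<Sum>h | length h = n. if h = trajectory X a 0 n \<omega> then f \<omega> else 0)"
      by (intro sum.cong) auto
    then show ?thesis by (simp add: sum.delta)
  qed
  have "(LINT \<omega>|P. f \<omega>) = (\<Sum>h | length h = n. LINT \<omega>|P. of_bool (trajectory X a 0 n \<omega> = h) * f \<omega>)"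
    by (subst *, rule Bochner_Integration.integral_sum) (rule integrable_on_path[OF assms])
  then show ?thesis by (simp add: on_path_def)
qed

end

text \<open>With masses \<open>p\<close> and values \<open>F / p\<close>, the left side splits into
  squared mean plus variance. The mean is a weighted average of values that all lie within
  \<open>C\<close> of any given one, so no value is farther than \<open>C\<close> from it.\<close>

lemma sum_square_div_le:
  fixes p F :: "'z::finite \<Rightarrow> real"
  assumes p: "\<And>z. 0 \<le> p z" and F: "\<And>z. p z = 0 \<Longrightarrow> F z = 0"
    and osc: "\<And>z z'. 0 < p z \<Longrightarrow> 0 < p z' \<Longrightarrow> \<bar>F z / p z - F z' / p z'\<bar> \<le> C"
  shows "(\<Sum>z\<in>UNIV. (F z)\<^sup>2 / p z) \<le> (\<Sum>z\<in>UNIV. F z)\<^sup>2 / (\<Sum>z\<in>UNIV. p z) + C\<^sup>2 * (\<Sum>z\<in>UNIV. p z)"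
proof (cases "(\<Sum>z\<in>UNIV. p z) = 0")
  case True
  then have "p z = 0" for z using p by (simp add: sum_nonneg_eq_0_iff)
  then show ?thesis by simp
next
  case False
  define q where "q = (\<Sum>z\<in>UNIV. p z)"
  define e where "e z = F z / p z" for z
  define m where "m = (\<Sum>z\<in>UNIV. F z) / q"
  have q: "q > 0" using False p by (simp add: q_def sum_nonneg less_le)
  have Fe: "F z = p z * e z" for z using F[of z] by (simp add: e_def)
  have qm: "(\<Sum>z\<in>UNIV. p z * e z) = q * m" using q by (simp add: m_def Fe)
  have dev: "\<bar>e z - m\<bar> \<le> C" if "p z > 0" for z
  proof -
    have "q * (e z - m) = (\<Sum>z'\<in>UNIV. p z' * (e z - e z'))"
      by (simp add: right_diff_distrib sum_subtractf qm) (simp add: q_def sum_distrib_right)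
    also have "\<bar>\<dots>\<bar> \<le> (\<Sum>z'\<in>UNIV. p z' * C)"
    proof (rule order_trans[OF sum_abs sum_mono])
      fix z' show "\<bar>p z' * (e z - e z')\<bar> \<le> p z' * C"
        using osc[OF that, of z'] p[of z'] by (cases "p z' = 0") (auto simp: abs_mult e_def intro!: mult_left_mono)
    qed
    also have "\<dots> = q * C" by (simp add: q_def sum_distrib_right)
    finally show ?thesis using q by (simp add: abs_mult)
  qed
  have "(\<Sum>z\<in>UNIV. (F z)\<^sup>2 / p z) = (\<Sum>z\<in>UNIV. p z * (e z)\<^sup>2)"
    by (intro sum.cong) (auto simp: Fe power2_eq_square)
  also have "\<dots> = (\<Sum>z\<in>UNIV. p z * (e z - m)\<^sup>2 + 2 * m * (p z * e z) - p z * m\<^sup>2)"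
    by (intro sum.cong) (auto simp: power2_eq_square algebra_simps)
  also have "\<dots> = (\<Sum>z\<in>UNIV. p z * (e z - m)\<^sup>2) + 2 * m * (q * m) - q * m\<^sup>2"
    by (simp add: sum.distrib sum_subtractf sum_distrib_left[symmetric] sum_distrib_right[symmetric] qm flip: q_def)
  also have "\<dots> = (\<Sum>z\<in>UNIV. p z * (e z - m)\<^sup>2) + q * m\<^sup>2"
    by (simp add: power2_eq_square)
  also have "(\<Sum>z\<in>UNIV. p z * (e z - m)\<^sup>2) \<le> (\<Sum>z\<in>UNIV. p z * C\<^sup>2)"
  proof (rule sum_mono)
    fix z show "p z * (e z - m)\<^sup>2 \<le> p z * C\<^sup>2"
    proof (cases "p z = 0")
      case False
      then have "p z > 0" using p[of z] by simp
      from dev[OF this] have "\<bar>e z - m\<bar>\<^sup>2 \<le> C\<^sup>2" by (intro power_mono) auto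
      then show ?thesis using p by (intro mult_left_mono) auto
    qed simp
  qed
  also have "q * m\<^sup>2 = (\<Sum>z\<in>UNIV. F z)\<^sup>2 / q" using q by (simp add: m_def power2_eq_square)
  finally show ?thesis by (simp add: q_def sum_distrib_right mult.commute)
qed

lemma sum_lists_Suc:
  fixes f :: "'z::finite list \<Rightarrow> 'b::comm_monoid_add"
  shows "(\<Sum>g | length g = Suc i. f g) = (\<Sum>g | length g = i. \<Sum>z\<in>UNIV. f (g @ [z]))"
proof -
  have "(\<Sum>g | length g = i. \<Sum>z\<in>UNIV. f (g @ [z])) = (\<Sum>(g, z)\<in>{g. length g = i} \<times> UNIV. f (g @ [z]))"
    by (simp add: sum.cartesian_product)
  also have "\<dots> = (\<Sum>g | length g = Suc i. f g)"
  proof (rule sum.reindex_bij_witness[where i="\<lambda>g. (butlast g, last g)" and j="\<lambda>(g, z). g @ [z]"])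
    show "(case (butlast g, last g) of (g, z) \<Rightarrow> g @ [z]) = g" if "g \<in> {g. length g = Suc i}" for g :: "'z list"
      using that by (cases g rule: rev_cases) auto
  qed auto
  finally show ?thesis ..
qed

context finite_process
begin

lemma on_path_eq_0:
  assumes "path_prob h = 0"
  shows "on_path f h = (0 :: 'b :: {banach, second_countable_topology, real_normed_field})"
proof -
  have "{\<omega> \<in> space P. trajectory X a 0 (length h) \<omega> = h} \<in> sets P" by measurable
  then have "AE \<omega> in P. \<not> trajectory X a 0 (length h) \<omega> = h"
    using assms by (simp add: path_prob_eq prob_eq_0 AE_conj_iff)
  then have "AE \<omega> in P. of_bool (trajectory X a 0 (length h) \<omega> = h) * f \<omega> = 0"
    by eventually_elim simp
  then show ?thesis unfolding on_path_def
    by (rule integral_eq_zero_AE)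
qed

text \<open>
  The variance is computed along the Doob martingale of \<open>f\<close>: with \<open>e h = E[f | path = h]\<close>, each step
  adds at most \<open>C\<^sup>2\<close> to the second moment of \<open>e\<close>.
\<close>

lemma second_moment_le:
  fixes f :: "'w \<Rightarrow> real"
  assumes f[measurable]: "f \<in> borel_measurable P" and B: "\<And>\<omega>. norm (f \<omega>) \<le> B"
    and osc: "\<And>g z z'. length g < i \<Longrightarrow> path_prob (h @ g @ [z]) > 0 \<Longrightarrow> path_prob (h @ g @ [z']) > 0 \<Longrightarrow>
      \<bar>on_path f (h @ g @ [z]) / path_prob (h @ g @ [z]) - on_path f (h @ g @ [z']) / path_prob (h @ g @ [z'])\<bar> \<le> C"
  shows "(\<Sum>g | length g = i. (on_path f (h @ g))\<^sup>2 / path_prob (h @ g)) \<le>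
      (on_path f h)\<^sup>2 / path_prob h + real i * C\<^sup>2 * path_prob h"
proof -
  let ?q = "\<lambda>h. (on_path f h)\<^sup>2 / path_prob h"
  have split: "path_prob h = (\<Sum>z\<in>UNIV. path_prob (h @ [z]))" for h
    by (rule on_path_split[of _ 1]) auto
  \<comment> \<open>Every level of the tree of extensions carries the same total mass, so each step
    of the martingale costs the same amount \<open>C\<^sup>2 * path_prob h\<close>.\<close>
  have mass: "(\<Sum>g | length g = j. path_prob (h @ g)) = path_prob h" for j
  proof (induction j)
    case (Suc j)
    have "(\<Sum>g | length g = Suc j. path_prob (h @ g)) = (\<Sum>g | length g = j. \<Sum>z\<in>UNIV. path_prob ((h @ g) @ [z]))"
      by (simp only: sum_lists_Suc append_assoc)
    also have "\<dots> = (\<Sum>g | length g = j. path_prob (h @ g))"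
      by (simp only: split[symmetric])
    finally show ?case using Suc by (simp only:)
  qed simp
  have "j \<le> i \<Longrightarrow> (\<Sum>g | length g = j. ?q (h @ g)) \<le> ?q h + real j * C\<^sup>2 * path_prob h" for j
  proof (induction j)
    case (Suc j)
    have "(\<Sum>g | length g = Suc j. ?q (h @ g)) = (\<Sum>g | length g = j. \<Sum>z\<in>UNIV. ?q (h @ g @ [z]))"
      by (simp only: sum_lists_Suc append_assoc)
    also have "\<dots> \<le> (\<Sum>g | length g = j. ?q (h @ g) + C\<^sup>2 * path_prob (h @ g))"
    proof (rule sum_mono)
      fix g :: "('s \<times> 'l) list" assume "g \<in> {g. length g = j}"
      then have g: "length g < i" using Suc.prems by simp
      have "(\<Sum>z\<in>UNIV. ?q (h @ g @ [z])) \<le> (\<Sum>z\<in>UNIV. on_path f (h @ g @ [z]))\<^sup>2 / (\<Sum>z\<in>UNIV. path_prob (h @ g @ [z])) +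
         C\<^sup>2 * (\<Sum>z\<in>UNIV. path_prob (h @ g @ [z]))"
        by (rule sum_square_div_le[OF path_prob_nonneg on_path_eq_0 osc[OF g]])
      also have "(\<Sum>z\<in>UNIV. on_path f (h @ g @ [z])) = on_path f (h @ g)"
        using on_path_split[OF f B, of "h @ g"] by (simp only: append_assoc)
      also have "(\<Sum>z\<in>UNIV. path_prob (h @ g @ [z])) = path_prob (h @ g)"
        using split[of "h @ g"] by (simp only: append_assoc)
      finally show "(\<Sum>z\<in>UNIV. ?q (h @ g @ [z])) \<le> ?q (h @ g) + C\<^sup>2 * path_prob (h @ g)" .
    qed
    also have "\<dots> = (\<Sum>g | length g = j. ?q (h @ g)) + C\<^sup>2 * path_prob h"
      by (simp only: sum.distrib sum_distrib_left[symmetric] mass)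
    also have "\<dots> \<le> (?q h + real j * C\<^sup>2 * path_prob h) + C\<^sup>2 * path_prob h"
      using Suc by (intro add_right_mono Suc.IH) simp
    also have "\<dots> = ?q h + real (Suc j) * C\<^sup>2 * path_prob h"
      by (simp add: algebra_simps)
    finally show ?case .
  qed simp
  then show "(\<Sum>g | length g = i. ?q (h @ g)) \<le> ?q h + real i * C\<^sup>2 * path_prob h" by simp
qed

lemma eta_bar_bound:
  assumes ij: "length h < j" "j \<le> n" and pos: "path_prob (h @ [z]) > 0" "path_prob (h @ [z']) > 0"
  shows "\<bar>on_path (\<lambda>\<omega>. of_bool ((X j \<omega>, a j \<omega>) = y)) (h @ [z]) / path_prob (h @ [z]) -
      on_path (\<lambda>\<omega>. of_bool ((X j \<omega>, a j \<omega>) = y)) (h @ [z']) / path_prob (h @ [z'])\<bar>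
    \<le> eta_bar P X a (length h) j n"
proof -
  let ?i = "length h"
  \<comment> \<open>The coefficient quantifies over sets of whole trajectories from \<open>j\<close>
    to \<open>n\<close>; a statement about time \<open>j\<close> alone becomes a condition on the
    head.\<close>
  let ?T = "{xs. length xs = n - j + 1 \<and> hd xs = y}"
  let ?S = "{\<bar>\<P>(\<omega> in P. trajectory X a j (Suc n) \<omega> \<in> T
               \<bar> X ?i \<omega> = s1 \<and> a ?i \<omega> = l1 \<and> trajectory X a 0 ?i \<omega> = h)
           - \<P>(\<omega> in P. trajectory X a j (Suc n) \<omega> \<in> T
               \<bar> X ?i \<omega> = s2 \<and> a ?i \<omega> = l2 \<and> trajectory X a 0 ?i \<omega> = h)\<bar>
          |T s1 l1 s2 l2 h.
             T \<subseteq> {xs. length xs = n - j + 1} \<and> length h = ?i \<and>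
             \<P>(\<omega> in P. X ?i \<omega> = s1 \<and> a ?i \<omega> = l1 \<and> trajectory X a 0 ?i \<omega> = h) > 0 \<and>
             \<P>(\<omega> in P. X ?i \<omega> = s2 \<and> a ?i \<omega> = l2 \<and> trajectory X a 0 ?i \<omega> = h) > 0}"
  have cp: "0 \<le> \<P>(\<omega> in P. A \<omega> \<bar> C \<omega>)" "\<P>(\<omega> in P. A \<omega> \<bar> C \<omega>) \<le> 1" if "Measurable.pred P C" for A C
  proof -
    show "0 \<le> \<P>(\<omega> in P. A \<omega> \<bar> C \<omega>)" by (simp add: cond_prob_def)
    have "\<P>(\<omega> in P. A \<omega> \<and> C \<omega>) \<le> \<P>(\<omega> in P. C \<omega>)"
      using that by (intro finite_measure_mono) auto
    then show "\<P>(\<omega> in P. A \<omega> \<bar> C \<omega>) \<le> 1"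
      by (simp add: cond_prob_def divide_le_eq_1 zero_less_measure_iff less_le)
  qed
  \<comment> \<open>A real \<open>Sup\<close> bounds its set only if the set is bounded above. Here
    conditional probabilities lie in [0, 1], the value 0 being assigned to null conditions.\<close>
  have bdd: "bdd_above ?S"
  proof (rule bdd_aboveI[of _ 1])
    have "\<bar>\<P>(\<omega> in P. A \<omega> \<bar> C \<omega>) - \<P>(\<omega> in P. A \<omega> \<bar> D \<omega>)\<bar> \<le> 1"
      if "Measurable.pred P C" "Measurable.pred P D" for A C D
      using cp(1)[OF that(1), of A] cp(2)[OF that(1), of A] cp(1)[OF that(2), of A] cp(2)[OF that(2), of A] by linarith
    note bound = this
    show "r \<le> 1" if "r \<in> ?S" for r
    proof -
      from that obtain T s1 l1 s2 l2 g where r: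
        "r = \<bar>\<P>(\<omega> in P. trajectory X a j (Suc n) \<omega> \<in> T
               \<bar> X ?i \<omega> = s1 \<and> a ?i \<omega> = l1 \<and> trajectory X a 0 ?i \<omega> = g)
           - \<P>(\<omega> in P. trajectory X a j (Suc n) \<omega> \<in> T
               \<bar> X ?i \<omega> = s2 \<and> a ?i \<omega> = l2 \<and> trajectory X a 0 ?i \<omega> = g)\<bar>"
        by (elim CollectE exE conjE)
      show ?thesis unfolding r by (rule bound; measurable)
    qed
  qed
  have path: "path_prob (h @ [w]) = \<P>(\<omega> in P. X ?i \<omega> = fst w \<and> a ?i \<omega> = snd w \<and> trajectory X a 0 ?i \<omega> = h)" for w
    unfolding path_prob_eq by (rule arg_cong[of _ _ prob]) (auto simp: trajectory_Suc)
  have hd: "trajectory X a j (Suc n) \<omega> \<in> ?T \<longleftrightarrow> (X j \<omega>, a j \<omega>) = y" for \<omega>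
    using ij by (simp add: trajectory_def hd_map upt_conv_Cons del: upt_Suc)
  have on: "on_path (\<lambda>\<omega>. of_bool ((X j \<omega>, a j \<omega>) = y)) (h @ [w]) / path_prob (h @ [w]) =
      \<P>(\<omega> in P. trajectory X a j (Suc n) \<omega> \<in> ?T
        \<bar> X ?i \<omega> = fst w \<and> a ?i \<omega> = snd w \<and> trajectory X a 0 ?i \<omega> = h)" for w
  proof -
    have "on_path (\<lambda>\<omega>. of_bool ((X j \<omega>, a j \<omega>) = y) :: real) (h @ [w]) =
      (LINT \<omega>|P. indicator {\<omega> \<in> space P. (X j \<omega>, a j \<omega>) = y \<and> X ?i \<omega> = fst w \<and> a ?i \<omega> = snd w \<and> trajectory X a 0 ?i \<omega> = h} \<omega>)"
      unfolding on_path_def by (intro Bochner_Integration.integral_cong) (auto simp: trajectory_Suc indicator_def)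
    then have "on_path (\<lambda>\<omega>. of_bool ((X j \<omega>, a j \<omega>) = y) :: real) (h @ [w]) =
       \<P>(\<omega> in P. (X j \<omega>, a j \<omega>) = y \<and> X ?i \<omega> = fst w \<and> a ?i \<omega> = snd w \<and> trajectory X a 0 ?i \<omega> = h)"
      by simp
    then show ?thesis
      unfolding cond_prob_def path hd by simp
  qed
  show ?thesis
    unfolding on eta_bar_def
  proof (rule cSup_upper[OF _ bdd], rule CollectI, rule exI[of _ ?T], rule exI[of _ "fst z"],
      rule exI[of _ "snd z"], rule exI[of _ "fst z'"], rule exI[of _ "snd z'"], rule exI[of _ h], intro conjI refl)
    show "0 < \<P>(\<omega> in P. X ?i \<omega> = fst z \<and> a ?i \<omega> = snd z \<and> trajectory X a 0 ?i \<omega> = h)"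
      "0 < \<P>(\<omega> in P. X ?i \<omega> = fst z' \<and> a ?i \<omega> = snd z' \<and> trajectory X a 0 ?i \<omega> = h)"
      using pos unfolding path .
  qed auto
qed

text \<open>Comparing \<open>z\<close> with itself puts 0 into the set over which the supremum is
  taken.\<close>

lemma eta_bar_nonneg:
  assumes "length h < j" "j \<le> n" "path_prob (h @ [z]) > 0"
  shows "0 \<le> eta_bar P X a (length h) j n"
  using eta_bar_bound[OF assms(1,2,3,3), of undefined] by simp

lemma visit_count_measurable [measurable]:
  "visit_count X a n s l \<in> measurable P (count_space UNIV)"
  unfolding visit_count_def by measurable

text \<open>Replacing the pair at time \<open>length h\<close> changes the conditional mean of the
  count by at most 1 for that time itself and by a mixing coefficient for each later time; earlier
  times are fixed by \<open>h\<close>. The total is bounded by a row of \<open>Delta_norm\<close>,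
  available only for times from 1 on, hence the initial path \<open>[z]\<close>.\<close>

lemma visit_count_variance:
  assumes C: "Delta_norm P X a n \<le> C" and n: "n > 0" and pos: "path_prob [z] > 0"
  shows "on_path (\<lambda>\<omega>. (real (visit_count X a n s l \<omega>))\<^sup>2) [z] \<le>
    (on_path (\<lambda>\<omega>. real (visit_count X a n s l \<omega>)) [z])\<^sup>2 / path_prob [z] + n * C\<^sup>2 * path_prob [z]"
proof -
  let ?f = "\<lambda>\<omega>. real (visit_count X a n s l \<omega>)"
  let ?I = "\<lambda>j \<omega>. of_bool ((X j \<omega>, a j \<omega>) = (s, l)) :: real"
  have f: "?f \<in> borel_measurable P" by measurable
  have B: "norm (?f \<omega>) \<le> real n" for \<omega>
    using sum_bounded_above[of "{..<n}" "\<lambda>i. of_bool (X i \<omega> = s \<and> a i \<omega> = l)" "1::nat"]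
    by (simp add: visit_count_def)
  have I: "?I j \<in> borel_measurable P" "norm (?I j \<omega>) \<le> 1" for j \<omega>
  proof -
    have [measurable]: "Measurable.pred P (\<lambda>\<omega>. X j \<omega> = s \<and> a j \<omega> = l)" by measurable
    show "?I j \<in> borel_measurable P" unfolding of_bool_def by simp
  qed auto
  have sum_I: "on_path ?f h = (\<Sum>j<n. on_path (?I j) h)" for h
  proof -
    have "on_path ?f h = (LINT \<omega>|P. (\<Sum>j<n. of_bool (trajectory X a 0 (length h) \<omega> = h) * ?I j \<omega>))"
      unfolding on_path_def visit_count_def of_nat_sum sum_distrib_left by simp
    also have "\<dots> = (\<Sum>j<n. on_path (?I j) h)" unfolding on_path_def
      by (rule Bochner_Integration.integral_sum) (rule integrable_on_path[OF I])
    finally show ?thesis .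
  qed
  have osc: "\<bar>on_path ?f (h @ [x]) / path_prob (h @ [x]) - on_path ?f (h @ [x']) / path_prob (h @ [x'])\<bar> \<le> C"
    if h: "0 < length h" "length h < n" and p: "path_prob (h @ [x]) > 0" "path_prob (h @ [x']) > 0" for h x x'
  proof -
    let ?i = "length h"
    let ?d = "\<lambda>j. \<bar>on_path (?I j) (h @ [x]) / path_prob (h @ [x]) - on_path (?I j) (h @ [x']) / path_prob (h @ [x'])\<bar>"
    have 1: "?d j \<le> (if j = ?i then 1 else if ?i < j then eta_bar P X a ?i j n else 0)" if "j < n" for j
    proof -
      have past: "on_path (?I j) (h @ [w]) / path_prob (h @ [w]) = of_bool ((h @ [w]) ! j = (s, l))"
        if "j \<le> ?i" "path_prob (h @ [w]) > 0" for w
      proof -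
        have *: "of_bool (trajectory X a 0 (length (h @ [w])) \<omega> = h @ [w]) * ?I j \<omega> =
          of_bool (trajectory X a 0 (length (h @ [w])) \<omega> = h @ [w]) * of_bool ((h @ [w]) ! j = (s, l))" for \<omega>
        proof (cases "trajectory X a 0 (length (h @ [w])) \<omega> = h @ [w]")
          case True
          from True[symmetric] have "(h @ [w]) ! j = (X j \<omega>, a j \<omega>)"
            using that(1) by (simp add: trajectory_def nth_append del: upt_Suc)
          then show ?thesis by simp
        qed simp
        have "on_path (?I j) (h @ [w]) = path_prob (h @ [w]) * of_bool ((h @ [w]) ! j = (s, l))"
          unfolding on_path_def * by (simp only: mult_1_right integral_mult_left_zero)
        then show ?thesis using that by simp
      qed
      consider "j < ?i" | "j = ?i" | "?i < j" by linarith
      then show ?thesis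
      proof cases
        case 1 then show ?thesis using past[OF _ p(1)] past[OF _ p(2)] by (simp add: nth_append)
      next
        case 2 then show ?thesis using past[OF _ p(1)] past[OF _ p(2)] by simp
      next
        case 3 then show ?thesis using eta_bar_bound[OF 3 _ p, of n "(s, l)"] that by simp
      qed
    qed
    have "\<bar>on_path ?f (h @ [x]) / path_prob (h @ [x]) - on_path ?f (h @ [x']) / path_prob (h @ [x'])\<bar> \<le> (\<Sum>j<n. ?d j)"
      unfolding sum_I sum_divide_distrib sum_subtractf[symmetric] by (rule sum_abs)
    also have "\<dots> \<le> (\<Sum>j<n. if j = ?i then 1 else if ?i < j then eta_bar P X a ?i j n else 0)"
      by (intro sum_mono 1) simp
    also have "\<dots> = (\<Sum>j<n. (if j = ?i then 1 else 0) + (if ?i < j then eta_bar P X a ?i j n else 0))"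
      by (intro sum.cong) auto
    also have "\<dots> = 1 + (\<Sum>j\<in>{?i<..<n}. eta_bar P X a ?i j n)"
    proof -
      have "{..<n} \<inter> {j. ?i < j} = {?i<..<n}" by auto
      then show ?thesis using h by (simp add: sum.distrib sum.If_cases)
    qed
    \<comment> \<open>The count stops before time \<open>n\<close>, whereas the row of
      \<open>Delta_norm\<close> includes \<open>j = n\<close>; the extra coefficient is
      nonnegative.\<close>
    also have "\<dots> \<le> 1 + (\<Sum>j=?i+1..n. eta_bar P X a ?i j n)"
      by (intro add_left_mono sum_mono2) (auto intro!: eta_bar_nonneg p)
    also have "\<dots> \<le> Delta_norm P X a n"
      unfolding Delta_norm_def using h by (intro Max_ge finite_imageI imageI) (auto simp: Suc_le_eq)
    also have "\<dots> \<le> C" by (rule C)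
    finally show ?thesis .
  qed
  have le: "(\<Sum>g | length g = n - 1. (on_path ?f ([z] @ g))\<^sup>2 / path_prob ([z] @ g)) \<le>
      (on_path ?f [z])\<^sup>2 / path_prob [z] + real (n - 1) * C\<^sup>2 * path_prob [z]"
  proof (rule second_moment_le[OF f B])
    fix g x x' assume "length g < n - 1" "path_prob ([z] @ g @ [x]) > 0" "path_prob ([z] @ g @ [x']) > 0"
    then show "\<bar>on_path ?f ([z] @ g @ [x]) / path_prob ([z] @ g @ [x]) -
        on_path ?f ([z] @ g @ [x']) / path_prob ([z] @ g @ [x'])\<bar> \<le> C"
      using osc[of "z # g" x x'] by simp
  qed
  \<comment> \<open>A path of length \<open>n\<close> determines the count up to \<open>n\<close>,
    so at the last level of the Doob martingale the squared conditional mean is the conditional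
    second moment. The pair \<open>z\<close> takes up one position, which leaves
    \<open>n - 1\<close>.\<close>
  have "(\<Sum>g | length g = n - 1. (on_path ?f ([z] @ g))\<^sup>2 / path_prob ([z] @ g)) =
      (\<Sum>g | length g = n - 1. on_path (\<lambda>\<omega>. (?f \<omega>)\<^sup>2) ([z] @ g))"
  proof (rule sum.cong[OF refl])
    fix g :: "('s \<times> 'l) list" assume g: "g \<in> {g. length g = n - 1}"
    define c where "c = (\<Sum>j<n. of_bool ((z # g) ! j = (s, l)) :: real)"
    have val: "?f \<omega> = c" if "trajectory X a 0 (length (z # g)) \<omega> = z # g" for \<omega>
    proof -
      have "X j \<omega> = s \<and> a j \<omega> = l \<longleftrightarrow> (z # g) ! j = (s, l)" if "j < n" for j
      proof -
        have "(X j \<omega>, a j \<omega>) = (z # g) ! j"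
          using that \<open>trajectory X a 0 (length (z # g)) \<omega> = z # g\<close>[unfolded trajectory_eq_iff] g by auto
        then show ?thesis by (metis prod.inject)
      qed
      then show ?thesis
        unfolding c_def visit_count_def of_nat_sum by (intro sum.cong) simp_all
    qed
    have *: "on_path (\<lambda>\<omega>. \<phi> (?f \<omega>)) (z # g) = \<phi> c * path_prob (z # g)" for \<phi> :: "real \<Rightarrow> real"
    proof -
      have "on_path (\<lambda>\<omega>. \<phi> (?f \<omega>)) (z # g) =
          (LINT \<omega>|P. \<phi> c * (of_bool (trajectory X a 0 (length (z # g)) \<omega> = z # g) * 1))"
        unfolding on_path_def
      proof (rule Bochner_Integration.integral_cong[OF refl])
        fix \<omega>
        show "of_bool (trajectory X a 0 (length (z # g)) \<omega> = z # g) * \<phi> (?f \<omega>) =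
            \<phi> c * (of_bool (trajectory X a 0 (length (z # g)) \<omega> = z # g) * 1)"
          using val[of \<omega>] by (cases "trajectory X a 0 (length (z # g)) \<omega> = z # g") auto
      qed
      then show ?thesis unfolding on_path_def by (simp only: integral_mult_right_zero)
    qed
    have "on_path ?f (z # g) = c * path_prob (z # g)" by (rule *)
    moreover have "on_path (\<lambda>\<omega>. (?f \<omega>)\<^sup>2) (z # g) = c\<^sup>2 * path_prob (z # g)" by (rule *)
    ultimately show "(on_path ?f ([z] @ g))\<^sup>2 / path_prob ([z] @ g) = on_path (\<lambda>\<omega>. (?f \<omega>)\<^sup>2) ([z] @ g)"
      by (simp add: power2_eq_square)
  qed
  also have "\<dots> = on_path (\<lambda>\<omega>. (?f \<omega>)\<^sup>2) [z]"
  proof -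
    have f2: "(\<lambda>\<omega>. (?f \<omega>)\<^sup>2) \<in> borel_measurable P" by measurable
    have B2: "norm ((?f \<omega>)\<^sup>2) \<le> (real n)\<^sup>2" for \<omega>
      using power_mono[OF B[of \<omega>], where n=2] by simp
    have "on_path (\<lambda>\<omega>. (?f \<omega>)\<^sup>2) h = (\<Sum>g | length g = i. on_path (\<lambda>\<omega>. (?f \<omega>)\<^sup>2) (h @ g))" for h i
    proof (induction i)
      case (Suc i)
      have "(\<Sum>g | length g = Suc i. on_path (\<lambda>\<omega>. (?f \<omega>)\<^sup>2) (h @ g)) =
          (\<Sum>g | length g = i. \<Sum>z\<in>UNIV. on_path (\<lambda>\<omega>. (?f \<omega>)\<^sup>2) ((h @ g) @ [z]))"
        unfolding sum_lists_Suc append_assoc ..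
      also have "\<dots> = (\<Sum>g | length g = i. on_path (\<lambda>\<omega>. (?f \<omega>)\<^sup>2) (h @ g))"
        by (simp only: on_path_split[OF f2 B2, symmetric])
      finally show ?case using Suc by (simp only:)
    qed simp
    from sym[OF this[of "[z]" "n - 1"]] show ?thesis .
  qed
  finally have eq: "(\<Sum>g | length g = n - 1. (on_path ?f ([z] @ g))\<^sup>2 / path_prob ([z] @ g)) =
      on_path (\<lambda>\<omega>. (?f \<omega>)\<^sup>2) [z]" .
  have "real (n - 1) * C\<^sup>2 * path_prob [z] \<le> real n * C\<^sup>2 * path_prob [z]"
    using pos by (intro mult_right_mono) auto
  with le show ?thesis unfolding eq by linarith
qed

end

section \<open>Exponential martingales of a controlled chain\<close>

context finite_process
begin

text \<open>Dependence on the pairs at times below \<open>n\<close>, stated pointwise. Since there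
  are finitely many trajectories of each length, it entails boundedness, measurability and
  integrability at once. \<open>adapted (Suc k)\<close> admits the action at time \<open>k\<close>
  but not the next state.\<close>

definition adapted :: "nat \<Rightarrow> ('w \<Rightarrow> 'b) \<Rightarrow> bool" where
  "adapted n f \<longleftrightarrow> (\<forall>\<omega> \<omega>'. (\<forall>j<n. X j \<omega> = X j \<omega>' \<and> a j \<omega> = a j \<omega>') \<longrightarrow> f \<omega> = f \<omega>')"

lemma adaptedD:
  "adapted n f \<Longrightarrow> \<forall>j<n. X j \<omega> = X j \<omega>' \<and> a j \<omega> = a j \<omega>' \<Longrightarrow> f \<omega> = f \<omega>'"
  by (simp add: adapted_def)

lemma adapted_factor:
  assumes "adapted n f"
  shows "\<exists>F. \<forall>\<omega>. f \<omega> = F (trajectory X a 0 n \<omega>)"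
proof -
  define F where "F g = f (SOME \<omega>. trajectory X a 0 n \<omega> = g)" for g
  have "f \<omega> = F (trajectory X a 0 n \<omega>)" for \<omega>
  proof -
    have "trajectory X a 0 n (SOME \<omega>'. trajectory X a 0 n \<omega>' = trajectory X a 0 n \<omega>) = trajectory X a 0 n \<omega>"
      by (rule someI) (rule refl)
    then have "\<forall>j<n. X j (SOME \<omega>'. trajectory X a 0 n \<omega>' = trajectory X a 0 n \<omega>) = X j \<omega> \<and>
        a j (SOME \<omega>'. trajectory X a 0 n \<omega>' = trajectory X a 0 n \<omega>) = a j \<omega>"
      by (auto simp: trajectory_def)
    then show ?thesis using assms unfolding adapted_def F_def by metis
  qed
  then show ?thesis by blast
qed

lemma adapted_bounded:
  fixes f :: "'w \<Rightarrow> 'b::real_normed_vector"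
  assumes "adapted n f"
  obtains B where "\<And>\<omega>. norm (f \<omega>) \<le> B"
proof -
  obtain F where F: "\<And>\<omega>. f \<omega> = F (trajectory X a 0 n \<omega>)" using adapted_factor[OF assms] by blast
  show thesis
  proof (rule that[of "\<Sum>g | length g = n. norm (F g)"])
    fix \<omega> show "norm (f \<omega>) \<le> (\<Sum>g | length g = n. norm (F g))"
      unfolding F by (rule member_le_sum) auto
  qed
qed

lemma adapted_measurable:
  fixes f :: "'w \<Rightarrow> 'b::topological_space"
  assumes "adapted n f"
  shows "f \<in> borel_measurable P"
proof -
  obtain F where F: "\<And>\<omega>. f \<omega> = F (trajectory X a 0 n \<omega>)" using adapted_factor[OF assms] by blast
  have "(\<lambda>\<omega>. F (trajectory X a 0 n \<omega>)) \<in> borel_measurable P"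
    by (rule measurable_compose[OF measurable_trajectory]) simp
  then show ?thesis by (simp add: F[abs_def])
qed

lemma adapted_integrable:
  fixes f :: "'w \<Rightarrow> 'b::{banach, second_countable_topology}"
  assumes "adapted n f"
  shows "integrable P f"
proof -
  obtain B where "\<And>\<omega>. norm (f \<omega>) \<le> B" using adapted_bounded[OF assms] by blast
  then show ?thesis using adapted_measurable[OF assms] by (intro integrable_const_bound) auto
qed

end

text \<open>The Markov property is multiplied out: in the form \<open>step\<close> it also covers
  null histories, where both sides vanish, and it passes to the measure conditioned on the initial
  pair.\<close>

locale controlled_chain = finite_process P X a
  for P :: "'w measure" and X :: "nat \<Rightarrow> 'w \<Rightarrow> 's::finite" and a :: "nat \<Rightarrow> 'w \<Rightarrow> 'l::finite" +
  fixes M :: "'l \<Rightarrow> 's \<Rightarrow> 's \<Rightarrow> real"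
  assumes step: "\<And>h s l t. \<P>(\<omega> in P. trajectory X a 0 (Suc (length h)) \<omega> = h @ [(s, l)] \<and> X (Suc (length h)) \<omega> = t) =
      M l s t * path_prob (h @ [(s, l)])"
    and M_nonneg: "\<And>l s t. 0 \<le> M l s t"
    and M_sum: "\<And>l s. (\<Sum>t\<in>UNIV. M l s t) = 1"
begin

abbreviation Z :: "nat \<Rightarrow> 'w \<Rightarrow> 's \<times> 'l" where "Z k \<omega> \<equiv> (X k \<omega>, a k \<omega>)"

definition kernel_mean :: "('s \<times> 'l \<Rightarrow> 's \<Rightarrow> 'b) \<Rightarrow> 's \<times> 'l \<Rightarrow> 'b::real_normed_algebra_1" where
  "kernel_mean \<phi> z = (\<Sum>t\<in>UNIV. of_real (M (snd z) (fst z) t) * \<phi> z t)"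

text \<open>On a path of length \<open>Suc k\<close> the factor \<open>f\<close> is constant and the
  current pair is the last entry, so only the next state is random, with the law given by
  \<open>step\<close>.\<close>

lemma one_step:
  fixes f :: "'w \<Rightarrow> 'b::{banach, second_countable_topology, real_normed_field}"
  assumes "adapted (Suc k) f"
  shows "(LINT \<omega>|P. f \<omega> * \<phi> (Z k \<omega>) (X (Suc k) \<omega>)) = (LINT \<omega>|P. f \<omega> * kernel_mean \<phi> (Z k \<omega>))"
proof -
  obtain F where F: "\<And>\<omega>. f \<omega> = F (trajectory X a 0 (Suc k) \<omega>)" using adapted_factor[OF assms] by blast
  have lhs: "adapted (Suc (Suc k)) (\<lambda>\<omega>. f \<omega> * \<phi> (Z k \<omega>) (X (Suc k) \<omega>))"
    using assms unfolding adapted_def by (metis less_Suc_eq)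
  have rhs: "adapted (Suc k) (\<lambda>\<omega>. f \<omega> * kernel_mean \<phi> (Z k \<omega>))"
    using assms unfolding adapted_def by (metis less_Suc_eq)
  obtain B where B: "\<And>\<omega>. norm (f \<omega> * \<phi> (Z k \<omega>) (X (Suc k) \<omega>)) \<le> B" using adapted_bounded[OF lhs] by blast
  obtain C where C: "\<And>\<omega>. norm (f \<omega> * kernel_mean \<phi> (Z k \<omega>)) \<le> C" using adapted_bounded[OF rhs] by blast
  have "on_path (\<lambda>\<omega>. f \<omega> * \<phi> (Z k \<omega>) (X (Suc k) \<omega>)) h = on_path (\<lambda>\<omega>. f \<omega> * kernel_mean \<phi> (Z k \<omega>)) h"
    if h: "length h = Suc k" for h
  proof -
    obtain g s l where g: "h = g @ [(s, l)]" "length g = k"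
      using h by (cases h rule: rev_cases) auto
    let ?I = "\<lambda>\<omega>. of_bool (trajectory X a 0 (Suc k) \<omega> = g @ [(s, l)]) :: 'b"
    let ?J = "\<lambda>t \<omega>. indicator {\<omega> \<in> space P. trajectory X a 0 (Suc k) \<omega> = g @ [(s, l)] \<and> X (Suc k) \<omega> = t} \<omega> :: real"
    have last: "Z k \<omega> = (s, l)" if "trajectory X a 0 (Suc k) \<omega> = g @ [(s, l)]" for \<omega>
      using that by (simp add: trajectory_Suc)
    have J: "integrable P (?J t)" for t
      by (intro integrable_real_indicator) (auto simp: emeasure_eq_measure)
    have J_int: "integrable P (\<lambda>\<omega>. F h * \<phi> (s, l) t * of_real (?J t \<omega>))" for t
      by (intro integrable_mult_right integrable_of_real J)
    have "on_path (\<lambda>\<omega>. f \<omega> * \<phi> (Z k \<omega>) (X (Suc k) \<omega>)) h =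
        (LINT \<omega>|P. (\<Sum>t\<in>UNIV. F h * \<phi> (s, l) t * of_real (?J t \<omega>)))"
      unfolding on_path_def
    proof (rule Bochner_Integration.integral_cong[OF refl])
      fix \<omega> assume \<omega>: "\<omega> \<in> space P"
      have "(\<Sum>t\<in>UNIV. F h * \<phi> (s, l) t * of_real (?J t \<omega>)) =
          (\<Sum>t\<in>UNIV. if t = X (Suc k) \<omega> then ?I \<omega> * (F h * \<phi> (s, l) t) else 0)"
        using \<omega> by (intro sum.cong) (auto simp: indicator_def)
      also have "\<dots> = ?I \<omega> * (F h * \<phi> (s, l) (X (Suc k) \<omega>))" by (subst sum.delta) auto
      also have "\<dots> = of_bool (trajectory X a 0 (length h) \<omega> = h) * (f \<omega> * \<phi> (Z k \<omega>) (X (Suc k) \<omega>))"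
        using last[of \<omega>] g(2) by (cases "trajectory X a 0 (Suc k) \<omega> = g @ [(s, l)]") (simp_all add: g(1) F)
      finally show "of_bool (trajectory X a 0 (length h) \<omega> = h) * (f \<omega> * \<phi> (Z k \<omega>) (X (Suc k) \<omega>)) =
        (\<Sum>t\<in>UNIV. F h * \<phi> (s, l) t * of_real (?J t \<omega>))" ..
    qed
    also have "\<dots> = (\<Sum>t\<in>UNIV. F h * \<phi> (s, l) t * of_real (M l s t * path_prob h))"
    proof -
      have "(LINT \<omega>|P. (\<Sum>t\<in>UNIV. F h * \<phi> (s, l) t * of_real (?J t \<omega>))) =
          (\<Sum>t\<in>UNIV. LINT \<omega>|P. F h * \<phi> (s, l) t * of_real (?J t \<omega>))"
        by (rule Bochner_Integration.integral_sum) (rule J_int)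
      also have "\<dots> = (\<Sum>t\<in>UNIV. F h * \<phi> (s, l) t * of_real (M l s t * path_prob h))"
      proof (rule sum.cong[OF refl])
        fix t
        have "(LINT \<omega>|P. ?J t \<omega>) = M l s t * path_prob h"
          using step[of g s l t] g by simp
        then show "(LINT \<omega>|P. F h * \<phi> (s, l) t * of_real (?J t \<omega>)) = F h * \<phi> (s, l) t * of_real (M l s t * path_prob h)"
          by (simp only: integral_mult_right_zero integral_of_real[OF J])
      qed
      finally show ?thesis .
    qed
    also have "\<dots> = F h * kernel_mean \<phi> (s, l) * of_real (path_prob h)"
      by (simp add: kernel_mean_def sum_distrib_left sum_distrib_right mult_ac)
    also have "\<dots> = on_path (\<lambda>\<omega>. f \<omega> * kernel_mean \<phi> (Z k \<omega>)) h"
    proof -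
      have "on_path (\<lambda>\<omega>. f \<omega> * kernel_mean \<phi> (Z k \<omega>)) h =
         (LINT \<omega>|P. F h * kernel_mean \<phi> (s, l) * of_real (of_bool (trajectory X a 0 (length h) \<omega> = h) * 1))"
        unfolding on_path_def
      proof (rule Bochner_Integration.integral_cong[OF refl])
        fix \<omega>
        show "of_bool (trajectory X a 0 (length h) \<omega> = h) * (f \<omega> * kernel_mean \<phi> (Z k \<omega>)) =
          F h * kernel_mean \<phi> (s, l) * of_real (of_bool (trajectory X a 0 (length h) \<omega> = h) * 1)"
          using last[of \<omega>] g(2) by (cases "trajectory X a 0 (Suc k) \<omega> = g @ [(s, l)]") (simp_all add: g(1) F)
      qed
      also have "\<dots> = F h * kernel_mean \<phi> (s, l) * of_real (path_prob h)"
      proof -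
        have "integrable P (\<lambda>\<omega>. of_bool (trajectory X a 0 (length h) \<omega> = h) * (1 :: real))"
          by (rule integrable_on_path[of _ 1]) auto
        then show ?thesis
          unfolding on_path_def by (simp only: integral_mult_right_zero integral_of_real)
      qed
      finally show ?thesis ..
    qed
    finally show ?thesis .
  qed
  then show ?thesis
    using integral_eq_sum_on_path[OF adapted_measurable[OF lhs] B, of "Suc k"]
      integral_eq_sum_on_path[OF adapted_measurable[OF rhs] C, of "Suc k"]
    by simp
qed

abbreviation visits :: "nat \<Rightarrow> 's \<times> 'l \<Rightarrow> 'w \<Rightarrow> nat" where
  "visits n z \<equiv> visit_count X a n (fst z) (snd z)"

lemma visits_Suc: "visits (Suc k) z \<omega> = visits k z \<omega> + of_bool (Z k \<omega> = z)"
  by (cases z) (simp add: visit_count_def)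

text \<open>The cut-off is decided by the pairs up to time \<open>k\<close>, before
  \<open>X (Suc k)\<close> is drawn, so switching terms off in this way preserves the martingale
  property.\<close>

definition active :: "('s \<times> 'l \<Rightarrow> nat) \<Rightarrow> nat \<Rightarrow> 'w \<Rightarrow> real" where
  "active K k \<omega> = of_bool (visits k (Z k \<omega>) \<omega> < K (Z k \<omega>))"

definition stopped_sum :: "('s \<times> 'l \<Rightarrow> nat) \<Rightarrow> ('s \<times> 'l \<Rightarrow> 's \<Rightarrow> real) \<Rightarrow> nat \<Rightarrow> 'w \<Rightarrow> real" where
  "stopped_sum K \<phi> n \<omega> = (\<Sum>k<n. active K k \<omega> * \<phi> (Z k \<omega>) (X (Suc k) \<omega>))"

lemma stopped_sum_Suc:
  "stopped_sum K \<phi> (Suc n) \<omega> = stopped_sum K \<phi> n \<omega> + active K n \<omega> * \<phi> (Z n \<omega>) (X (Suc n) \<omega>)"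
  by (simp add: stopped_sum_def)

text \<open>Sorting the times by current pair, \<open>z\<close> is active on exactly its first
  \<open>K z\<close> visits. For nonnegative weights, a sum along the trajectory thus acquires a
  bound independent of \<open>n\<close> and of the trajectory.\<close>

lemma sum_active:
  "(\<Sum>k<n. active K k \<omega> * \<psi> (Z k \<omega>)) = (\<Sum>z\<in>UNIV. \<psi> z * real (min (visits n z \<omega>) (K z)))"
proof (induction n)
  case (Suc n)
  have "(\<Sum>z\<in>UNIV. \<psi> z * real (min (visits (Suc n) z \<omega>) (K z))) =
      (\<Sum>z\<in>UNIV. \<psi> z * real (min (visits n z \<omega>) (K z)) + (if z = Z n \<omega> then active K n \<omega> * \<psi> z else 0))"
    by (intro sum.cong) (auto simp: visits_Suc active_def min_def algebra_simps)
  also have "\<dots> = (\<Sum>z\<in>UNIV. \<psi> z * real (min (visits n z \<omega>) (K z))) + active K n \<omega> * \<psi> (Z n \<omega>)"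
    unfolding sum.distrib by (subst sum.delta) auto
  finally show ?case using Suc by simp
qed (simp add: visit_count_def)

lemma visits_cong:
  "(\<And>j. j < n \<Longrightarrow> Z j \<omega> = Z j \<omega>') \<Longrightarrow> visits n z \<omega> = visits n z \<omega>'"
  unfolding visit_count_def by (intro sum.cong) auto

lemma adapted_active: "adapted (Suc k) (active K k)"
  unfolding adapted_def
proof (intro allI impI)
  fix \<omega> \<omega>' assume *: "\<forall>j<Suc k. X j \<omega> = X j \<omega>' \<and> a j \<omega> = a j \<omega>'"
  then have "visits k z \<omega> = visits k z \<omega>'" for z by (intro visits_cong) auto
  from this[of "Z k \<omega>'"] * show "active K k \<omega> = active K k \<omega>'" by (simp add: active_def)
qed

lemma adapted_mono: "adapted m f \<Longrightarrow> m \<le> n \<Longrightarrow> adapted n f"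
  unfolding adapted_def using less_le_trans by meson

lemma adapted_comp2:
  assumes "adapted n f" "adapted n g"
  shows "adapted n (\<lambda>\<omega>. \<phi> (f \<omega>) (g \<omega>))"
  using assms unfolding adapted_def by metis

lemma adapted_comp: "adapted n f \<Longrightarrow> adapted n (\<lambda>\<omega>. \<phi> (f \<omega>))"
  unfolding adapted_def by metis

lemma adapted_X: "k < n \<Longrightarrow> adapted n (X k)" and adapted_Z: "k < n \<Longrightarrow> adapted n (Z k)"
  unfolding adapted_def by auto

text \<open>The summand for time \<open>n - 1\<close> already looks at \<open>X n\<close>, which
  accounts for \<open>Suc n\<close>.\<close>

lemma adapted_stopped_sum: "adapted (Suc n) (stopped_sum K \<phi> n)"
proof (induction n)
  case 0
  show ?case by (simp add: adapted_def stopped_sum_def)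
next
  case (Suc n)
  have eq: "stopped_sum K \<phi> (Suc n) = (\<lambda>\<omega>. stopped_sum K \<phi> n \<omega> + active K n \<omega> * \<phi> (Z n \<omega>) (X (Suc n) \<omega>))"
    by (simp add: stopped_sum_Suc fun_eq_iff)
  show ?case unfolding eq
    by (intro adapted_comp2[where \<phi>=plus] adapted_comp2[where \<phi>=times] adapted_comp2[where \<phi>=\<phi>] adapted_X adapted_Z
        adapted_mono[OF Suc] adapted_mono[OF adapted_active]) auto
qed

lemma kernel_mean_const: "kernel_mean (\<lambda>z t. \<psi> z) z = \<psi> z"
  using M_sum[of "snd z" "fst z"] by (simp add: kernel_mean_def flip: sum_distrib_right of_real_sum)

text \<open>Orthogonality of martingale differences: in the square of the next partial sum the cross
  term has conditional mean 0, and \<open>active\<close> equals its own square. The predictable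
  quadratic variation on the right is again a stopped sum, to which \<open>sum_active\<close>
  applies.\<close>

lemma second_moment_stopped_sum:
  assumes mean: "\<And>z. kernel_mean \<phi> z = 0"
  shows "(LINT \<omega>|P. (stopped_sum K \<phi> n \<omega>)\<^sup>2) =
    (LINT \<omega>|P. stopped_sum K (\<lambda>z t. kernel_mean (\<lambda>z t. (\<phi> z t)\<^sup>2) z) n \<omega>)"
proof (induction n)
  case 0
  show ?case by (simp add: stopped_sum_def)
next
  case (Suc n)
  let ?S = "stopped_sum K \<phi> n" and ?A = "active K n"
  have act: "?A \<omega> = 0 \<or> ?A \<omega> = 1" for \<omega> by (auto simp: active_def of_bool_def)
  have ad: "adapted (Suc (Suc n)) (\<lambda>\<omega>. \<psi> (?S \<omega>) (?A \<omega>) (Z n \<omega>) (X (Suc n) \<omega>))" for \<psi> :: "real \<Rightarrow> real \<Rightarrow> _ \<Rightarrow> _ \<Rightarrow> real"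
  proof -
    have "adapted (Suc (Suc n)) ?S" "adapted (Suc (Suc n)) ?A"
      "adapted (Suc (Suc n)) (X (Suc n))" "adapted (Suc (Suc n)) (Z n)"
      by (auto intro: adapted_mono[OF adapted_stopped_sum] adapted_mono[OF adapted_active] adapted_X adapted_Z)
    note D = this[THEN adaptedD]
    show ?thesis unfolding adapted_def
    proof (intro allI impI)
      fix \<omega> \<omega>' assume *: "\<forall>j<Suc (Suc n). X j \<omega> = X j \<omega>' \<and> a j \<omega> = a j \<omega>'"
      show "\<psi> (?S \<omega>) (?A \<omega>) (Z n \<omega>) (X (Suc n) \<omega>) = \<psi> (?S \<omega>') (?A \<omega>') (Z n \<omega>') (X (Suc n) \<omega>')"
        unfolding D(1)[OF *] D(2)[OF *] D(3)[OF *] D(4)[OF *] ..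
    qed
  qed
  have "(LINT \<omega>|P. (stopped_sum K \<phi> (Suc n) \<omega>)\<^sup>2) =
    (LINT \<omega>|P. (?S \<omega>)\<^sup>2 + ((2 * ?S \<omega> * ?A \<omega>) * \<phi> (Z n \<omega>) (X (Suc n) \<omega>) + ?A \<omega> * (\<phi> (Z n \<omega>) (X (Suc n) \<omega>))\<^sup>2))"
  proof (intro Bochner_Integration.integral_cong refl)
    fix \<omega>
    show "(stopped_sum K \<phi> (Suc n) \<omega>)\<^sup>2 =
      (?S \<omega>)\<^sup>2 + ((2 * ?S \<omega> * ?A \<omega>) * \<phi> (Z n \<omega>) (X (Suc n) \<omega>) + ?A \<omega> * (\<phi> (Z n \<omega>) (X (Suc n) \<omega>))\<^sup>2)"
      using act[of \<omega>] unfolding stopped_sum_Suc by (elim disjE) (simp_all add: power2_sum)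
  qed
  also have "\<dots> = (LINT \<omega>|P. (?S \<omega>)\<^sup>2) + ((LINT \<omega>|P. (2 * ?S \<omega> * ?A \<omega>) * \<phi> (Z n \<omega>) (X (Suc n) \<omega>))
      + (LINT \<omega>|P. ?A \<omega> * (\<phi> (Z n \<omega>) (X (Suc n) \<omega>))\<^sup>2))"
  proof -
    have i: "integrable P (\<lambda>\<omega>. (?S \<omega>)\<^sup>2)" "integrable P (\<lambda>\<omega>. (2 * ?S \<omega> * ?A \<omega>) * \<phi> (Z n \<omega>) (X (Suc n) \<omega>))"
      "integrable P (\<lambda>\<omega>. ?A \<omega> * (\<phi> (Z n \<omega>) (X (Suc n) \<omega>))\<^sup>2)"
      using ad[of "\<lambda>s _ _ _. s\<^sup>2"] ad[of "\<lambda>s y z t. 2 * s * y * \<phi> z t"] ad[of "\<lambda>s y z t. y * (\<phi> z t)\<^sup>2"]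
      by (auto intro: adapted_integrable)
    show ?thesis
      by (subst Bochner_Integration.integral_add[OF i(1)], intro Bochner_Integration.integrable_add i(2,3))
         (subst Bochner_Integration.integral_add[OF i(2,3)], rule refl)
  qed
  also have "(LINT \<omega>|P. (2 * ?S \<omega> * ?A \<omega>) * \<phi> (Z n \<omega>) (X (Suc n) \<omega>)) = 0"
  proof -
    have "adapted (Suc n) (\<lambda>\<omega>. 2 * ?S \<omega> * ?A \<omega>)"
      by (intro adapted_comp2[where \<phi>=times] adapted_comp[where \<phi>="\<lambda>x. 2 * x"] adapted_stopped_sum adapted_active)
    from one_step[OF this, of \<phi>] show ?thesis by (simp add: mean)
  qed
  also have "(LINT \<omega>|P. ?A \<omega> * (\<phi> (Z n \<omega>) (X (Suc n) \<omega>))\<^sup>2) =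
      (LINT \<omega>|P. ?A \<omega> * kernel_mean (\<lambda>z t. (\<phi> z t)\<^sup>2) (Z n \<omega>))"
    by (rule one_step[OF adapted_active])
  also have "(LINT \<omega>|P. (?S \<omega>)\<^sup>2) + (0 + (LINT \<omega>|P. ?A \<omega> * kernel_mean (\<lambda>z t. (\<phi> z t)\<^sup>2) (Z n \<omega>))) =
     (LINT \<omega>|P. stopped_sum K (\<lambda>z t. kernel_mean (\<lambda>z t. (\<phi> z t)\<^sup>2) z) (Suc n) \<omega>)"
  proof -
    have i: "integrable P (stopped_sum K (\<lambda>z t. kernel_mean (\<lambda>z t. (\<phi> z t)\<^sup>2) z) n)"
      by (rule adapted_integrable[OF adapted_stopped_sum])
    have j: "integrable P (\<lambda>\<omega>. ?A \<omega> * kernel_mean (\<lambda>z t. (\<phi> z t)\<^sup>2) (Z n \<omega>))"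
      by (rule adapted_integrable[OF ad[of "\<lambda>s y z t. y * kernel_mean (\<lambda>z t. (\<phi> z t)\<^sup>2) z"]])
    have "(LINT \<omega>|P. stopped_sum K (\<lambda>z t. kernel_mean (\<lambda>z t. (\<phi> z t)\<^sup>2) z) (Suc n) \<omega>) =
      (LINT \<omega>|P. stopped_sum K (\<lambda>z t. kernel_mean (\<lambda>z t. (\<phi> z t)\<^sup>2) z) n \<omega> + ?A \<omega> * kernel_mean (\<lambda>z t. (\<phi> z t)\<^sup>2) (Z n \<omega>))"
      by (simp only: stopped_sum_Suc)
    then show ?thesis using Suc by (simp add: Bochner_Integration.integral_add[OF i j])
  qed
  finally show ?case .
qed

text \<open>
  Were the increments conditionally Gaussian with variance \<open>2 \<psi>\<close>, then \<open>exp (i S + \<Sum> \<psi>)\<close> would be a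
  martingale; the defect of a step is \<open>kernel_mean (exp (i \<phi> + \<psi>)) - 1\<close>.
\<close>

lemma exponential_martingale_defect:
  fixes \<psi> :: "'s \<times> 'l \<Rightarrow> real" and \<phi> :: "'s \<times> 'l \<Rightarrow> 's \<Rightarrow> real"
  assumes \<psi>: "\<And>z. 0 \<le> \<psi> z" and L: "(\<Sum>z\<in>UNIV. \<psi> z * real (K z)) \<le> L"
  defines "\<rho> z \<equiv> cmod (kernel_mean (\<lambda>z t. iexp (\<phi> z t) * exp (\<psi> z) - 1) z)"
  shows "cmod ((LINT \<omega>|P. iexp (stopped_sum K \<phi> n \<omega>) * exp (stopped_sum K (\<lambda>z t. \<psi> z) n \<omega>)) - 1) \<le>
    exp L * (\<Sum>z\<in>UNIV. \<rho> z * real (K z))"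
proof -
  let ?Y = "\<lambda>n \<omega>. iexp (stopped_sum K \<phi> n \<omega>) * complex_of_real (exp (stopped_sum K (\<lambda>z t. \<psi> z) n \<omega>))"
  have \<psi>_sum: "stopped_sum K (\<lambda>z t. \<psi> z) n \<omega> \<le> L" for n \<omega>
  proof -
    have "stopped_sum K (\<lambda>z t. \<psi> z) n \<omega> = (\<Sum>z\<in>UNIV. \<psi> z * real (min (visits n z \<omega>) (K z)))"
      unfolding stopped_sum_def by (rule sum_active)
    also have "\<dots> \<le> (\<Sum>z\<in>UNIV. \<psi> z * real (K z))" by (intro sum_mono mult_left_mono \<psi>) auto
    finally show ?thesis using L by linarith
  qed
  have adY: "adapted (Suc n) (?Y n)" for n
    by (intro adapted_comp2[where \<phi>="\<lambda>x y. iexp x * complex_of_real (exp y)"] adapted_stopped_sum)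
  have ad\<rho>: "adapted (Suc n) (\<lambda>\<omega>. active K n \<omega> * \<rho> (Z n \<omega>))" for n
    by (intro adapted_comp2[where \<phi>="\<lambda>x y. x * \<rho> y"] adapted_active adapted_Z) auto
  \<comment> \<open>On an inactive step \<open>?Y\<close> does not move. On an active one it is
    multiplied by a factor whose conditional mean is at distance \<open>\<rho>\<close> from 1, while
    \<open>?Y\<close> itself has modulus at most \<open>exp L\<close>.\<close>
  have step: "cmod ((LINT \<omega>|P. ?Y (Suc n) \<omega>) - (LINT \<omega>|P. ?Y n \<omega>)) \<le> exp L * (LINT \<omega>|P. active K n \<omega> * \<rho> (Z n \<omega>))" for n
  proof -
    let ?r = "\<lambda>z t. iexp (\<phi> z t) * exp (\<psi> z) - 1"
    have adf: "adapted (Suc n) (\<lambda>\<omega>. ?Y n \<omega> * complex_of_real (active K n \<omega>))"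
      by (intro adapted_comp2[where \<phi>="\<lambda>x y. x * complex_of_real y"] adY adapted_active)
    have "(LINT \<omega>|P. ?Y (Suc n) \<omega>) - (LINT \<omega>|P. ?Y n \<omega>) = (LINT \<omega>|P. ?Y (Suc n) \<omega> - ?Y n \<omega>)"
      using adapted_integrable[OF adY] by (intro Bochner_Integration.integral_diff[symmetric])
    also have "\<dots> = (LINT \<omega>|P. (?Y n \<omega> * complex_of_real (active K n \<omega>)) * ?r (Z n \<omega>) (X (Suc n) \<omega>))"
    proof (intro Bochner_Integration.integral_cong refl)
      fix \<omega>
      show "?Y (Suc n) \<omega> - ?Y n \<omega> = (?Y n \<omega> * complex_of_real (active K n \<omega>)) * ?r (Z n \<omega>) (X (Suc n) \<omega>)"
      proof (cases "visits n (Z n \<omega>) \<omega> < K (Z n \<omega>)")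
        case True
        then have "active K n \<omega> = 1" by (simp add: active_def)
        then show ?thesis
          by (simp add: stopped_sum_Suc distrib_left exp_add right_diff_distrib mult_ac)
      next
        case False
        then have "active K n \<omega> = 0" by (simp add: active_def)
        then show ?thesis by (simp add: stopped_sum_Suc)
      qed
    qed
    also have "\<dots> = (LINT \<omega>|P. (?Y n \<omega> * complex_of_real (active K n \<omega>)) * kernel_mean ?r (Z n \<omega>))"
      by (rule one_step[OF adf])
    finally have eq: "(LINT \<omega>|P. ?Y (Suc n) \<omega>) - (LINT \<omega>|P. ?Y n \<omega>) =
        (LINT \<omega>|P. (?Y n \<omega> * complex_of_real (active K n \<omega>)) * kernel_mean ?r (Z n \<omega>))" .
    have "cmod (LINT \<omega>|P. (?Y n \<omega> * complex_of_real (active K n \<omega>)) * kernel_mean ?r (Z n \<omega>)) \<le>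
        (LINT \<omega>|P. exp L * (active K n \<omega> * \<rho> (Z n \<omega>)))"
    proof (rule order_trans[OF integral_norm_bound integral_mono])
      have "adapted (Suc n) (\<lambda>\<omega>. cmod (?Y n \<omega> * complex_of_real (active K n \<omega>) * kernel_mean ?r (Z n \<omega>)))"
        by (intro adapted_comp2[where \<phi>="\<lambda>x y. cmod (x * kernel_mean ?r y)"] adf adapted_Z) auto
      then show "integrable P (\<lambda>\<omega>. cmod (?Y n \<omega> * complex_of_real (active K n \<omega>) * kernel_mean ?r (Z n \<omega>)))"
        by (rule adapted_integrable)
      show "integrable P (\<lambda>\<omega>. exp L * (active K n \<omega> * \<rho> (Z n \<omega>)))"
        by (intro integrable_mult_right adapted_integrable[OF ad\<rho>])
      fix \<omega>
      have "cmod (?Y n \<omega>) \<le> exp L" using \<psi>_sum[of n \<omega>] by (simp add: norm_mult)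
      moreover have act: "0 \<le> active K n \<omega>" by (simp add: active_def)
      ultimately have "cmod (?Y n \<omega>) * (active K n \<omega> * \<rho> (Z n \<omega>)) \<le> exp L * (active K n \<omega> * \<rho> (Z n \<omega>))"
        by (intro mult_right_mono mult_nonneg_nonneg) (auto simp: \<rho>_def)
      moreover have "cmod (?Y n \<omega> * complex_of_real (active K n \<omega>) * kernel_mean ?r (Z n \<omega>)) =
          cmod (?Y n \<omega>) * (active K n \<omega> * \<rho> (Z n \<omega>))"
        using act unfolding \<rho>_def by (simp only: norm_mult norm_of_real abs_of_nonneg mult.assoc)
      ultimately show "cmod (?Y n \<omega> * complex_of_real (active K n \<omega>) * kernel_mean ?r (Z n \<omega>)) \<le> exp L * (active K n \<omega> * \<rho> (Z n \<omega>))"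
        by (simp only:)
    qed
    then show ?thesis unfolding eq by (simp only: integral_mult_right_zero)
  qed
  \<comment> \<open>Telescoping from \<open>?Y 0 = 1\<close>. The number of steps drops out
    afterwards, because \<open>sum_active\<close> admits at most \<open>K z\<close> defects per
    pair.\<close>
  have "cmod ((LINT \<omega>|P. ?Y n \<omega>) - 1) \<le> exp L * (\<Sum>k<n. LINT \<omega>|P. active K k \<omega> * \<rho> (Z k \<omega>))"
  proof (induction n)
    case 0
    show ?case by (simp add: stopped_sum_def prob_space)
  next
    case (Suc n)
    have "cmod ((LINT \<omega>|P. ?Y (Suc n) \<omega>) - 1) \<le> cmod ((LINT \<omega>|P. ?Y n \<omega>) - 1) + cmod ((LINT \<omega>|P. ?Y (Suc n) \<omega>) - (LINT \<omega>|P. ?Y n \<omega>))"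
      by (rule order_trans[OF _ norm_triangle_ineq]) simp
    then show ?case using Suc step[of n] by (simp add: distrib_left)
  qed
  also have "(\<Sum>k<n. LINT \<omega>|P. active K k \<omega> * \<rho> (Z k \<omega>)) = (LINT \<omega>|P. (\<Sum>k<n. active K k \<omega> * \<rho> (Z k \<omega>)))"
    by (rule Bochner_Integration.integral_sum[symmetric]) (rule adapted_integrable[OF ad\<rho>])
  also have "\<dots> \<le> (LINT \<omega>|P. (\<Sum>z\<in>UNIV. \<rho> z * real (K z)))"
  proof (rule integral_mono)
    show "integrable P (\<lambda>\<omega>. \<Sum>k<n. active K k \<omega> * \<rho> (Z k \<omega>))"
      by (rule Bochner_Integration.integrable_sum) (rule adapted_integrable[OF ad\<rho>])
    show "(\<Sum>k<n. active K k \<omega> * \<rho> (Z k \<omega>)) \<le> (\<Sum>z\<in>UNIV. \<rho> z * real (K z))" for \<omega>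
      unfolding sum_active by (intro sum_mono mult_left_mono) (auto simp: \<rho>_def)
  qed simp
  also have "\<dots> = (\<Sum>z\<in>UNIV. \<rho> z * real (K z))" by (simp add: prob_space)
  finally show ?thesis by (simp add: mult_left_mono)
qed

end

section \<open>Elementary estimates and the one-step defect\<close>

lemma exp_defect_bounds:
  fixes y :: real
  assumes "0 \<le> y"
  shows "\<bar>exp y * (1 - y) - 1\<bar> \<le> exp y * y\<^sup>2"
proof -
  \<comment> \<open>The bound comes from the sandwich \<open>1 - y \<le> exp (- y) \<le> 1 / (1 + y)
    \<le> 1 - y + y\<^sup>2\<close>.\<close>
  have 1: "1 - y \<le> exp (- y)" using exp_ge_add_one_self[of "- y"] by simp
  have "exp (- y) \<le> 1 / (1 + y)"
    using assms exp_ge_add_one_self[of y] by (simp add: exp_minus field_simps)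
  also have "1 / (1 + y) \<le> 1 - y + y\<^sup>2"
  proof -
    have "1 \<le> (1 - y + y\<^sup>2) * (1 + y)" using assms by (simp add: algebra_simps power2_eq_square)
    then show ?thesis using assms by (simp add: divide_le_eq)
  qed
  finally have 2: "exp (- y) - (1 - y) \<le> y\<^sup>2" by simp
  have "exp y * (1 - y) - 1 = - (exp y * (exp (- y) - (1 - y)))"
    by (simp add: algebra_simps flip: exp_add)
  then have "\<bar>exp y * (1 - y) - 1\<bar> = exp y * (exp (- y) - (1 - y))"
    using 1 by (simp add: abs_mult)
  also have "\<dots> \<le> exp y * y\<^sup>2" using 2 by (intro mult_left_mono) auto
  finally show ?thesis .
qed

lemma abs_one_minus_exp_le: "\<bar>1 - exp x\<bar> \<le> \<bar>x\<bar> * exp \<bar>x\<bar>" for x :: real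
proof (cases "x \<ge> 0")
  case True
  have "exp x * (1 - x) \<le> exp x * exp (- x)"
    using exp_ge_add_one_self[of "- x"] by (intro mult_left_mono) auto
  then have "exp x - 1 \<le> x * exp x" by (simp add: algebra_simps flip: exp_add)
  with True show ?thesis by simp
next
  case False
  have "1 - exp x \<le> - x" using exp_ge_add_one_self[of x] by linarith
  also have "- x * 1 \<le> - x * exp (- x)" using False by (intro mult_left_mono) auto
  then have "- x \<le> - x * exp (- x)" by simp
  finally show ?thesis using False by simp
qed

lemma abs_sqrt_minus_one_le:
  assumes "0 \<le> x"
  shows "\<bar>sqrt x - 1\<bar> \<le> \<bar>x - 1\<bar>"
proof -
  have "x - 1 = (sqrt x - 1) * (sqrt x + 1)" using assms by (simp add: algebra_simps)
  then have "\<bar>x - 1\<bar> = \<bar>sqrt x - 1\<bar> * (sqrt x + 1)" using assms by (simp only: abs_mult) simp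
  also have "\<dots> \<ge> \<bar>sqrt x - 1\<bar> * 1" using assms by (intro mult_left_mono) auto
  finally show ?thesis by simp
qed

context controlled_chain
begin

lemma kernel_mean_real: "kernel_mean \<phi> z = (\<Sum>t\<in>UNIV. M (snd z) (fst z) t * \<phi> z t)" for \<phi> :: "_ \<Rightarrow> _ \<Rightarrow> real"
  by (simp add: kernel_mean_def)

lemma kernel_mean_nonneg: "(\<And>t. 0 \<le> \<phi> z t) \<Longrightarrow> 0 \<le> kernel_mean \<phi> z" for \<phi> :: "_ \<Rightarrow> _ \<Rightarrow> real"
  unfolding kernel_mean_real by (intro sum_nonneg mult_nonneg_nonneg M_nonneg)

lemma M_sum_complex: "(\<Sum>t\<in>UNIV. complex_of_real (M l s t)) = 1"
  using M_sum[of l s] by (simp flip: of_real_sum)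

text \<open>In the second-order Taylor expansion the linear term vanishes by centring and the
  quadratic term is exactly \<open>y = v / (2 * b z)\<close>, so compensation by
  \<open>exp y\<close> leaves the cubic remainder and \<open>exp y * (1 - y) - 1\<close>. The
  remainder has order \<open>b z\<close> to the power -3/2; the second error is quadratic in
  \<open>y\<close>, and \<open>1 \<le> b z\<close> absorbs its surplus power.\<close>

lemma kernel_mean_iexp_defect:
  fixes c :: "'s \<times> 'l \<Rightarrow> 's \<Rightarrow> real"
  assumes mean: "kernel_mean c z = 0" and b: "1 \<le> b z"
  defines "v \<equiv> kernel_mean (\<lambda>z t. (c z t)\<^sup>2) z" and "w \<equiv> kernel_mean (\<lambda>z t. \<bar>c z t\<bar> ^ 3) z"
  shows "cmod (kernel_mean (\<lambda>z t. iexp (c z t / sqrt (b z)) * exp (kernel_mean (\<lambda>z t. (c z t)\<^sup>2) z / (2 * b z)) - 1) z)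
    \<le> exp v * (w + v\<^sup>2) / (b z * sqrt (b z))"
proof -
  define y where "y = v / (2 * b z)"
  define r where "r = sqrt (b z)"
  have v: "0 \<le> v" and w: "0 \<le> w" unfolding v_def w_def by (auto intro: kernel_mean_nonneg)
  have r: "1 \<le> r" "r * r = b z" using b by (auto simp: r_def)
  have y: "0 \<le> y" "y \<le> v" using v b by (auto simp: y_def divide_le_eq mult_le_cancel_left1 intro: order_trans)
  let ?m = "\<lambda>t. complex_of_real (M (snd z) (fst z) t)"
  let ?x = "\<lambda>t. c z t / r"
  have E1: "(\<Sum>t\<in>UNIV. ?m t * \<i> * complex_of_real (?x t)) = 0"
  proof -
    have "(\<Sum>t\<in>UNIV. ?m t * \<i> * complex_of_real (?x t)) = \<i> * complex_of_real (kernel_mean c z) / r"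
      by (simp add: kernel_mean_real sum_distrib_left sum_divide_distrib mult_ac)
    then show ?thesis by (simp add: mean)
  qed
  have E2: "(\<Sum>t\<in>UNIV. ?m t * complex_of_real ((?x t)\<^sup>2 / 2)) = complex_of_real y"
  proof -
    have "(\<Sum>t\<in>UNIV. ?m t * complex_of_real ((?x t)\<^sup>2 / 2)) = complex_of_real (v / (2 * (r * r)))"
      by (simp add: v_def kernel_mean_real sum_divide_distrib power_divide power2_eq_square mult_ac)
    then show ?thesis by (simp add: y_def r)
  qed
  have taylor: "cmod (iexp x - (1 + \<i> * complex_of_real x - complex_of_real (x\<^sup>2 / 2))) \<le> \<bar>x\<bar> ^ 3" for x
  proof -
    have "(\<Sum>k\<le>2. (\<i> * complex_of_real x) ^ k / fact k) = 1 + \<i> * complex_of_real x - complex_of_real (x\<^sup>2 / 2)"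
      by (simp add: numeral_2_eq_2 power2_eq_square complex_eq_iff)
    moreover have "\<bar>x\<bar> ^ Suc 2 / fact (Suc 2) \<le> \<bar>x\<bar> ^ 3"
      by (simp add: fact_numeral field_simps)
    ultimately show ?thesis using iexp_approx1[of x 2] by simp
  qed
  have "kernel_mean (\<lambda>z t. iexp (c z t / sqrt (b z)) * exp (kernel_mean (\<lambda>z t. (c z t)\<^sup>2) z / (2 * b z)) - 1) z =
      (\<Sum>t\<in>UNIV. ?m t * (iexp (?x t) * exp y - 1))"
    by (subst kernel_mean_def) (simp add: y_def v_def r_def)
  also have "\<dots> = exp y * (\<Sum>t\<in>UNIV. ?m t * (iexp (?x t) - (1 + \<i> * complex_of_real (?x t) - complex_of_real ((?x t)\<^sup>2 / 2))))
      + complex_of_real (exp y * (1 - y) - 1)"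
  proof -
    define A where "A = (\<Sum>t\<in>UNIV. ?m t * iexp (?x t))"
    have e1: "(\<Sum>t\<in>UNIV. ?m t * (iexp (?x t) - (1 + \<i> * complex_of_real (?x t) - complex_of_real ((?x t)\<^sup>2 / 2)))) =
        (\<Sum>t\<in>UNIV. ?m t * iexp (?x t)) - (\<Sum>t\<in>UNIV. ?m t) - (\<Sum>t\<in>UNIV. ?m t * \<i> * complex_of_real (?x t))
         + (\<Sum>t\<in>UNIV. ?m t * complex_of_real ((?x t)\<^sup>2 / 2))"
      unfolding sum.distrib[symmetric] sum_subtractf[symmetric]
      by (intro sum.cong refl) (simp only: right_diff_distrib distrib_left mult.assoc mult_1_right diff_add_eq_diff_diff_swap, simp)
    have e2: "(\<Sum>t\<in>UNIV. ?m t * (iexp (?x t) * exp y - 1)) = exp y * (\<Sum>t\<in>UNIV. ?m t * iexp (?x t)) - 1"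
      by (simp add: right_diff_distrib sum_subtractf M_sum_complex sum_distrib_left mult_ac)
    show ?thesis
      unfolding e1 e2 E1 E2 M_sum_complex A_def[symmetric] by (simp add: algebra_simps)
  qed
  finally have eq: "kernel_mean (\<lambda>z t. iexp (c z t / sqrt (b z)) * exp (kernel_mean (\<lambda>z t. (c z t)\<^sup>2) z / (2 * b z)) - 1) z =
      exp y * (\<Sum>t\<in>UNIV. ?m t * (iexp (?x t) - (1 + \<i> * complex_of_real (?x t) - complex_of_real ((?x t)\<^sup>2 / 2))))
      + complex_of_real (exp y * (1 - y) - 1)" .
  have "cmod (kernel_mean (\<lambda>z t. iexp (c z t / sqrt (b z)) * exp (kernel_mean (\<lambda>z t. (c z t)\<^sup>2) z / (2 * b z)) - 1) z)
      \<le> exp y * (\<Sum>t\<in>UNIV. M (snd z) (fst z) t * \<bar>?x t\<bar> ^ 3) + exp y * y\<^sup>2"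
    unfolding eq
  proof (rule order_trans[OF norm_triangle_ineq add_mono])
    have "cmod (\<Sum>t\<in>UNIV. ?m t * (iexp (?x t) - (1 + \<i> * complex_of_real (?x t) - complex_of_real ((?x t)\<^sup>2 / 2))))
        \<le> (\<Sum>t\<in>UNIV. M (snd z) (fst z) t * \<bar>?x t\<bar> ^ 3)"
      by (rule sum_norm_le) (simp only: norm_mult norm_of_real abs_of_nonneg[OF M_nonneg] mult_left_mono[OF taylor M_nonneg])
    then show "cmod (exp y * (\<Sum>t\<in>UNIV. ?m t * (iexp (?x t) - (1 + \<i> * complex_of_real (?x t) - complex_of_real ((?x t)\<^sup>2 / 2)))))
        \<le> exp y * (\<Sum>t\<in>UNIV. M (snd z) (fst z) t * \<bar>?x t\<bar> ^ 3)"
      unfolding norm_mult by (simp only: norm_of_real abs_exp_cancel mult_left_mono exp_ge_zero)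
    show "cmod (complex_of_real (exp y * (1 - y) - 1)) \<le> exp y * y\<^sup>2"
      unfolding norm_of_real by (rule exp_defect_bounds[OF y(1)])
  qed
  also have "(\<Sum>t\<in>UNIV. M (snd z) (fst z) t * \<bar>?x t\<bar> ^ 3) = w / (b z * r)"
    using r by (simp add: w_def kernel_mean_real sum_divide_distrib power_divide power3_eq_cube mult.assoc flip: r(2))
  also have "exp y * (w / (b z * r)) + exp y * y\<^sup>2 \<le> exp v * (w / (b z * r)) + exp v * (v\<^sup>2 / (b z * r))"
  proof -
    have "y\<^sup>2 \<le> v\<^sup>2 / (b z * r)"
    proof -
      have "r \<le> b z" using r(1) mult_left_mono[of 1 r r] r(2) by simp
      then have "b z * r \<le> (2 * b z)\<^sup>2" using b mult_left_mono[of r "b z" "b z"]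
        by (simp add: power2_eq_square)
      then have "v\<^sup>2 / (2 * b z)\<^sup>2 \<le> v\<^sup>2 / (b z * r)"
        using b r(1) by (intro divide_left_mono) auto
      then show ?thesis by (simp add: y_def power_divide)
    qed
    then show ?thesis using y w b r(1) by (intro add_mono mult_mono) auto
  qed
  also have "\<dots> = exp v * (w + v\<^sup>2) / (b z * sqrt (b z))"
    by (simp add: r_def add_divide_distrib distrib_left)
  finally show ?thesis .
qed

end

section \<open>Characteristic functions of self-normalised sums\<close>

lemma cmod_iexp_diff_le: "cmod (iexp x - iexp y) \<le> \<bar>x - y\<bar>"
proof -
  have "iexp x - iexp y = iexp y * (iexp (x - y) - 1)"
    by (simp add: right_diff_distrib flip: exp_add)
  then have "cmod (iexp x - iexp y) = cmod (iexp (x - y) - 1)"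
    by (simp only: norm_mult norm_exp_i_times mult_1)
  also have "\<dots> \<le> \<bar>x - y\<bar>" using iexp_approx1[of "x - y" 0] by simp
  finally show ?thesis .
qed

context controlled_chain
begin

text \<open>
  A Berry-Esseen type estimate, in which \<open>b z\<close> is a deterministic proxy for the number of visits
  to \<open>z\<close>.
\<close>

lemma char_self_normalised_bound:
  fixes c :: "'s \<times> 'l \<Rightarrow> 's \<Rightarrow> real" and b :: "'s \<times> 'l \<Rightarrow> real" and n :: nat
  assumes mean: "\<And>z. kernel_mean c z = 0" and b: "\<And>z. 1 \<le> b z" and \<epsilon>: "0 < \<epsilon>" "\<epsilon> \<le> 1 / 2"
  defines "v \<equiv> kernel_mean (\<lambda>z t. (c z t)\<^sup>2)" and "w \<equiv> kernel_mean (\<lambda>z t. \<bar>c z t\<bar> ^ 3)"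
  defines "V \<equiv> \<Sum>z\<in>UNIV. v z"
  defines "bad \<omega> \<equiv> \<exists>z. \<not> \<bar>real (visits n z \<omega>) - b z\<bar> \<le> \<epsilon> * b z"
  defines "T \<omega> \<equiv> \<Sum>z\<in>UNIV. (\<Sum>k<n. of_bool (Z k \<omega> = z) * c z (X (Suc k) \<omega>)) / sqrt (real (visits n z \<omega>))"
  shows "cmod ((LINT \<omega>|P. iexp (T \<omega>)) - exp (- V / 2)) \<le>
    (3 + exp (2 * V)) * \<P>(\<omega> in P. bad \<omega>) + \<epsilon> * ((\<Sum>z\<in>UNIV. 1 + 3 * v z) + V * exp V)
    + exp (2 * V) * (\<Sum>z\<in>UNIV. 3 * (exp (v z) * (w z + (v z)\<^sup>2)) / sqrt (b z))"
proof -
  \<comment> \<open>On the good event a count is at most \<open>2 * b z\<close>, so this cut-off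
    never acts there; \<open>1 \<le> b z\<close> pays for the rounding and keeps \<open>K z\<close>
    below \<open>3 * b z\<close>.\<close>
  define K where "K z = nat \<lceil>2 * b z\<rceil>" for z
  define \<phi> where "\<phi> z t = c z t / sqrt (b z)" for z t
  \<comment> \<open>Half the conditional variance of the increment \<open>\<phi>\<close>; with
    \<open>b z\<close> visits to each pair the compensator would be exactly
    \<open>V / 2\<close>.\<close>
  define \<psi> where "\<psi> z = v z / (2 * b z)" for z
  define S where "S = stopped_sum K \<phi> n"
  define W where "W = stopped_sum K (\<lambda>z t. \<psi> z) n"
  \<comment> \<open>The contribution of a single pair before normalisation: \<open>S\<close> divides
    it by \<open>sqrt (b z)\<close>, \<open>T\<close> by the root of the random count, so the two
    must be compared pair by pair.\<close>
  define U where "U z = stopped_sum K (\<lambda>y t. of_bool (y = z) * c z t) n" for z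
  define bad' where "bad' \<omega> = (of_bool (bad \<omega>) :: real)" for \<omega>
  have b0: "b z > 0" for z using b[of z] by linarith
  have K: "2 * b z \<le> real (K z)" "real (K z) \<le> 3 * b z" for z
    using b[of z] unfolding K_def by linarith+
  have v: "0 \<le> v z" for z unfolding v_def by (auto intro: kernel_mean_nonneg)
  have w: "0 \<le> w z" for z unfolding w_def by (auto intro: kernel_mean_nonneg)
  have V: "0 \<le> V" unfolding V_def by (intro sum_nonneg v)
  have \<psi>: "0 \<le> \<psi> z" for z unfolding \<psi>_def using v b0[of z] by (intro divide_nonneg_nonneg) auto
  have \<psi>K: "(\<Sum>z\<in>UNIV. \<psi> z * real (K z)) \<le> 3 / 2 * V"
  proof -
    have "(\<Sum>z\<in>UNIV. \<psi> z * real (K z)) \<le> (\<Sum>z\<in>UNIV. \<psi> z * (3 * b z))"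
      by (intro sum_mono mult_left_mono K \<psi>)
    also have "\<dots> = (\<Sum>z\<in>UNIV. 3 / 2 * v z)"
      using b0 by (intro sum.cong) (auto simp: \<psi>_def less_imp_neq[symmetric])
    finally show ?thesis by (simp only: V_def sum_distrib_left)
  qed
  have W_eq: "W \<omega> = (\<Sum>z\<in>UNIV. \<psi> z * real (min (visits n z \<omega>) (K z)))" for \<omega>
    unfolding W_def stopped_sum_def by (rule sum_active)
  have W_le: "W \<omega> \<le> 3 / 2 * V" for \<omega>
  proof -
    have "W \<omega> \<le> (\<Sum>z\<in>UNIV. \<psi> z * real (K z))"
      unfolding W_eq by (intro sum_mono mult_left_mono \<psi>) simp
    then show ?thesis using \<psi>K by linarith
  qed
  have S_eq: "S \<omega> = (\<Sum>z\<in>UNIV. U z \<omega> / sqrt (b z))" for \<omega>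
  proof -
    have "(\<Sum>z\<in>UNIV. U z \<omega> / sqrt (b z)) =
        (\<Sum>k<n. \<Sum>z\<in>UNIV. active K k \<omega> * (of_bool (Z k \<omega> = z) * c z (X (Suc k) \<omega>)) / sqrt (b z))"
      unfolding U_def stopped_sum_def sum_divide_distrib by (rule sum.swap)
    also have "\<dots> = (\<Sum>k<n. active K k \<omega> * \<phi> (Z k \<omega>) (X (Suc k) \<omega>))"
    proof (rule sum.cong[OF refl])
      fix k
      have "(\<Sum>z\<in>UNIV. active K k \<omega> * (of_bool (Z k \<omega> = z) * c z (X (Suc k) \<omega>)) / sqrt (b z)) =
          (\<Sum>z\<in>UNIV. if z = Z k \<omega> then active K k \<omega> * \<phi> z (X (Suc k) \<omega>) else 0)"
        by (intro sum.cong refl) (auto simp: \<phi>_def)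
      then show "(\<Sum>z\<in>UNIV. active K k \<omega> * (of_bool (Z k \<omega> = z) * c z (X (Suc k) \<omega>)) / sqrt (b z)) =
          active K k \<omega> * \<phi> (Z k \<omega>) (X (Suc k) \<omega>)"
        by (simp only: sum.delta finite) simp
    qed
    finally show ?thesis by (simp only: S_def stopped_sum_def)
  qed
  have good_N: "real (visits n z \<omega>) \<le> 2 * b z" "b z \<le> 2 * real (visits n z \<omega>)"
    "\<bar>real (visits n z \<omega>) - b z\<bar> \<le> \<epsilon> * b z" if "\<not> bad \<omega>" for z \<omega>
  proof -
    show 1: "\<bar>real (visits n z \<omega>) - b z\<bar> \<le> \<epsilon> * b z" using that unfolding bad_def by blast
    have "\<epsilon> * b z \<le> 1 / 2 * b z" using \<epsilon> b0[of z] by (intro mult_right_mono) auto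
    with 1 b0[of z] show "real (visits n z \<omega>) \<le> 2 * b z" "b z \<le> 2 * real (visits n z \<omega>)"
      by linarith+
  qed
  have good_U: "U z \<omega> = (\<Sum>k<n. of_bool (Z k \<omega> = z) * c z (X (Suc k) \<omega>))" if "\<not> bad \<omega>" for z \<omega>
  proof -
    have "active K k \<omega> = 1" if k: "k < n" for k
    proof -
      have "visits k (Z k \<omega>) \<omega> < visits (Suc k) (Z k \<omega>) \<omega>" by (subst visits_Suc) simp
      also have "\<dots> \<le> visits n (Z k \<omega>) \<omega>"
        using k unfolding visit_count_def by (intro sum_mono2) auto
      also have "\<dots> \<le> K (Z k \<omega>)"
        using good_N(1)[OF \<open>\<not> bad \<omega>\<close>, of "Z k \<omega>"] K(1)[of "Z k \<omega>"] by linarith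
      finally show ?thesis by (simp add: active_def)
    qed
    then show ?thesis unfolding U_def stopped_sum_def by (intro sum.cong) auto
  qed
  \<comment> \<open>On the good event the stop has not acted, \<open>T\<close> and \<open>S\<close>
    differ only in the normalisers, and \<open>W\<close> is within \<open>\<epsilon> * V / 2\<close>
    of \<open>V / 2\<close>; hence \<open>exp (- V / 2) * exp (W \<omega>)\<close> is close to
    1.\<close>
  have good: "cmod (iexp (T \<omega>) - exp (- V / 2) * (iexp (S \<omega>) * exp (W \<omega>))) \<le>
      \<epsilon> * ((\<Sum>z\<in>UNIV. 1 + (U z \<omega>)\<^sup>2 / b z) + V * exp V)" if G: "\<not> bad \<omega>" for \<omega>
  proof -
    have TS: "\<bar>T \<omega> - S \<omega>\<bar> \<le> \<epsilon> * (\<Sum>z\<in>UNIV. 1 + (U z \<omega>)\<^sup>2 / b z)"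
    proof -
      have "T \<omega> - S \<omega> = (\<Sum>z\<in>UNIV. U z \<omega> / sqrt (real (visits n z \<omega>)) - U z \<omega> / sqrt (b z))"
        unfolding T_def S_eq sum_subtractf by (simp only: good_U[OF G])
      also have "\<bar>\<dots>\<bar> \<le> (\<Sum>z\<in>UNIV. \<epsilon> * (1 + (U z \<omega>)\<^sup>2 / b z))"
      proof (rule order_trans[OF sum_abs sum_mono])
        fix z
        define N where "N = real (visits n z \<omega>)"
        define x where "x = U z \<omega> / sqrt (b z)"
        have N: "N > 0" using good_N(2)[OF G, of z] b0[of z] unfolding N_def by linarith
        have "\<bar>sqrt (b z / N) - 1\<bar> \<le> \<bar>b z / N - 1\<bar>"
          using N b0[of z] by (intro abs_sqrt_minus_one_le) auto
        also have "\<bar>b z / N - 1\<bar> = \<bar>N - b z\<bar> / N"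
        proof -
          have "b z / N - 1 = - ((N - b z) / N)" using N by (simp add: diff_divide_distrib)
          then show ?thesis using N by (simp add: abs_divide)
        qed
        also have "\<dots> \<le> (\<epsilon> * (2 * N)) / N"
        proof (rule divide_right_mono)
          have "\<epsilon> * b z \<le> \<epsilon> * (2 * N)"
            using good_N(2)[OF G, of z] \<epsilon>(1) unfolding N_def by (intro mult_left_mono) auto
          then show "\<bar>N - b z\<bar> \<le> \<epsilon> * (2 * N)"
            using good_N(3)[OF G, of z] unfolding N_def by linarith
        qed (use N in simp)
        also have "\<dots> = 2 * \<epsilon>" using N by simp
        finally have s: "\<bar>sqrt (b z / N) - 1\<bar> \<le> 2 * \<epsilon>" .
        have "U z \<omega> / sqrt N - U z \<omega> / sqrt (b z) = x * (sqrt (b z / N) - 1)"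
          using N b0[of z] by (simp add: x_def real_sqrt_divide field_simps)
        then have "\<bar>U z \<omega> / sqrt N - U z \<omega> / sqrt (b z)\<bar> = \<bar>x\<bar> * \<bar>sqrt (b z / N) - 1\<bar>"
          by (simp only: abs_mult)
        also have "\<dots> \<le> \<bar>x\<bar> * (2 * \<epsilon>)" using s by (intro mult_left_mono) auto
        also have "\<dots> = \<epsilon> * (2 * \<bar>x\<bar>)" by simp
        \<comment> \<open>The first power is traded for a square because orthogonality of the
          increments controls the mean of \<open>(U z \<omega>)\<^sup>2\<close>.\<close>
        also have "\<dots> \<le> \<epsilon> * (1 + x\<^sup>2)"
        proof (intro mult_left_mono)
          have "0 \<le> (\<bar>x\<bar> - 1)\<^sup>2" by simp
          then show "2 * \<bar>x\<bar> \<le> 1 + x\<^sup>2" by (simp add: power2_diff)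
        qed (use \<epsilon> in simp)
        also have "x\<^sup>2 = (U z \<omega>)\<^sup>2 / b z" using b0[of z] by (simp add: x_def power_divide)
        finally show "\<bar>U z \<omega> / sqrt (real (visits n z \<omega>)) - U z \<omega> / sqrt (b z)\<bar> \<le> \<epsilon> * (1 + (U z \<omega>)\<^sup>2 / b z)"
          unfolding N_def .
      qed
      finally show ?thesis by (simp only: sum_distrib_left)
    qed
    have WV: "\<bar>W \<omega> - V / 2\<bar> \<le> \<epsilon> * V / 2"
    proof -
      have "W \<omega> - V / 2 = (\<Sum>z\<in>UNIV. v z / 2 * ((real (visits n z \<omega>) - b z) / b z))"
      proof -
        have "\<psi> z * real (min (visits n z \<omega>) (K z)) - v z / 2 = v z / 2 * ((real (visits n z \<omega>) - b z) / b z)" for z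
        proof -
          have "min (visits n z \<omega>) (K z) = visits n z \<omega>"
            using good_N(1)[OF G, of z] K(1)[of z] by linarith
          then show ?thesis using b0[of z] by (simp add: \<psi>_def field_simps)
        qed
        then show ?thesis
          unfolding W_eq V_def sum_divide_distrib sum_subtractf[symmetric] by (intro sum.cong) auto
      qed
      also have "\<bar>\<dots>\<bar> \<le> (\<Sum>z\<in>UNIV. v z / 2 * \<epsilon>)"
      proof (rule order_trans[OF sum_abs sum_mono])
        fix z
        have "\<bar>(real (visits n z \<omega>) - b z) / b z\<bar> \<le> \<epsilon>"
          using good_N(3)[OF G, of z] b0[of z] by (simp add: abs_divide divide_le_eq)
        then show "\<bar>v z / 2 * ((real (visits n z \<omega>) - b z) / b z)\<bar> \<le> v z / 2 * \<epsilon>"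
          unfolding abs_mult using v[of z] by (intro mult_mono) auto
      qed
      also have "(\<Sum>z\<in>UNIV. v z / 2 * \<epsilon>) = \<epsilon> * V / 2"
        unfolding V_def sum_distrib_left sum_divide_distrib by (intro sum.cong) auto
      finally show ?thesis .
    qed
    have "iexp (T \<omega>) - exp (- V / 2) * (iexp (S \<omega>) * exp (W \<omega>)) =
        (iexp (T \<omega>) - iexp (S \<omega>)) + iexp (S \<omega>) * complex_of_real (1 - exp (W \<omega> - V / 2))"
    proof -
      have "exp (W \<omega> - V / 2) = exp (- V / 2) * exp (W \<omega>)" by (simp flip: exp_add)
      then show ?thesis by (simp add: right_diff_distrib mult_ac)
    qed
    then have "cmod (iexp (T \<omega>) - exp (- V / 2) * (iexp (S \<omega>) * exp (W \<omega>))) \<le>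
        cmod (iexp (T \<omega>) - iexp (S \<omega>)) + cmod (iexp (S \<omega>) * complex_of_real (1 - exp (W \<omega> - V / 2)))"
      by (simp only: norm_triangle_ineq)
    also have "cmod (iexp (S \<omega>) * complex_of_real (1 - exp (W \<omega> - V / 2))) = \<bar>1 - exp (W \<omega> - V / 2)\<bar>"
      by (simp only: norm_mult norm_exp_i_times mult_1 norm_of_real)
    also have "cmod (iexp (T \<omega>) - iexp (S \<omega>)) + \<bar>1 - exp (W \<omega> - V / 2)\<bar> \<le>
        \<epsilon> * (\<Sum>z\<in>UNIV. 1 + (U z \<omega>)\<^sup>2 / b z) + \<epsilon> * V * exp V"
    proof (rule add_mono)
      show "cmod (iexp (T \<omega>) - iexp (S \<omega>)) \<le> \<epsilon> * (\<Sum>z\<in>UNIV. 1 + (U z \<omega>)\<^sup>2 / b z)"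
        using cmod_iexp_diff_le TS by (rule order_trans)
      have \<epsilon>V: "0 \<le> \<epsilon> * V" "\<epsilon> * V \<le> V" using \<epsilon> V mult_right_mono[of \<epsilon> 1 V] by auto
      then have "\<bar>W \<omega> - V / 2\<bar> \<le> \<epsilon> * V" "\<bar>W \<omega> - V / 2\<bar> \<le> V" using WV by linarith+
      then have "\<bar>W \<omega> - V / 2\<bar> * exp \<bar>W \<omega> - V / 2\<bar> \<le> \<epsilon> * V * exp V"
        using \<epsilon>V(1) by (intro mult_mono) auto
      then show "\<bar>1 - exp (W \<omega> - V / 2)\<bar> \<le> \<epsilon> * V * exp V"
        using abs_one_minus_exp_le order_trans by blast
    qed
    also have "\<dots> = \<epsilon> * ((\<Sum>z\<in>UNIV. 1 + (U z \<omega>)\<^sup>2 / b z) + V * exp V)"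
      by (simp only: distrib_left mult.assoc)
    finally show ?thesis .
  qed
  \<comment> \<open>On the bad event only boundedness is available: the stop keeps \<open>W\<close>
    below \<open>3 / 2 * V\<close>, so the modulus is at most \<open>1 + exp V\<close>.\<close>
  have all: "cmod (iexp (T \<omega>) - exp (- V / 2) * (iexp (S \<omega>) * exp (W \<omega>))) \<le>
      (3 + exp (2 * V)) * bad' \<omega> + \<epsilon> * ((\<Sum>z\<in>UNIV. 1 + (U z \<omega>)\<^sup>2 / b z) + V * exp V)" for \<omega>
  proof (cases "bad \<omega>")
    case True
    have "cmod (iexp (T \<omega>) - exp (- V / 2) * (iexp (S \<omega>) * exp (W \<omega>))) \<le>
        cmod (iexp (T \<omega>)) + cmod (exp (- V / 2) * (iexp (S \<omega>) * exp (W \<omega>)))"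
      by (rule norm_triangle_ineq4)
    also have "\<dots> = 1 + exp (W \<omega> - V / 2)"
      by (simp add: norm_mult flip: exp_add)
    also have "\<dots> \<le> 3 + exp (2 * V)" using W_le[of \<omega>] V by (intro add_mono) auto
    also have "\<dots> = (3 + exp (2 * V)) * bad' \<omega>" using True by (simp add: bad'_def)
    moreover have "0 \<le> \<epsilon> * ((\<Sum>z\<in>UNIV. 1 + (U z \<omega>)\<^sup>2 / b z) + V * exp V)"
    proof (intro mult_nonneg_nonneg add_nonneg_nonneg sum_nonneg)
      show "0 \<le> (U z \<omega>)\<^sup>2 / b z" for z using b0[of z] by simp
    qed (use \<epsilon> V in auto)
    ultimately show ?thesis by linarith
  next
    case False
    then show ?thesis using good[OF False] by (simp add: bad'_def)
  qed
  have ad_S: "adapted (Suc n) S" and ad_W: "adapted (Suc n) W" and ad_U: "adapted (Suc n) (U z)" for z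
    unfolding S_def W_def U_def by (rule adapted_stopped_sum)+
  have N_cong: "visits n z \<omega> = visits n z \<omega>'" if "\<forall>j<Suc n. X j \<omega> = X j \<omega>' \<and> a j \<omega> = a j \<omega>'" for z \<omega> \<omega>'
    using that by (intro visits_cong) auto
  have ad_bad: "adapted (Suc n) bad'"
    unfolding adapted_def bad'_def bad_def
  proof (intro allI impI)
    fix \<omega> \<omega>' assume "\<forall>j<Suc n. X j \<omega> = X j \<omega>' \<and> a j \<omega> = a j \<omega>'"
    from N_cong[OF this] show "of_bool (\<exists>z. \<not> \<bar>real (visits n z \<omega>) - b z\<bar> \<le> \<epsilon> * b z) =
      (of_bool (\<exists>z. \<not> \<bar>real (visits n z \<omega>') - b z\<bar> \<le> \<epsilon> * b z) :: real)" by (simp only:)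
  qed
  have ad_T: "adapted (Suc n) T"
    unfolding adapted_def T_def
  proof (intro allI impI)
    fix \<omega> \<omega>' assume *: "\<forall>j<Suc n. X j \<omega> = X j \<omega>' \<and> a j \<omega> = a j \<omega>'"
    have "(\<Sum>k<n. of_bool (Z k \<omega> = z) * c z (X (Suc k) \<omega>)) = (\<Sum>k<n. of_bool (Z k \<omega>' = z) * c z (X (Suc k) \<omega>'))" for z
    proof (rule sum.cong[OF refl])
      fix k assume "k \<in> {..<n}"
      then have "Z k \<omega> = Z k \<omega>'" "X (Suc k) \<omega> = X (Suc k) \<omega>'" using * by auto
      then show "of_bool (Z k \<omega> = z) * c z (X (Suc k) \<omega>) = of_bool (Z k \<omega>' = z) * c z (X (Suc k) \<omega>')" by (simp only:)
    qed
    then show "(\<Sum>z\<in>UNIV. (\<Sum>k<n. of_bool (Z k \<omega> = z) * c z (X (Suc k) \<omega>)) / sqrt (real (visits n z \<omega>))) =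
      (\<Sum>z\<in>UNIV. (\<Sum>k<n. of_bool (Z k \<omega>' = z) * c z (X (Suc k) \<omega>')) / sqrt (real (visits n z \<omega>')))"
      by (simp only: N_cong[OF *])
  qed
  have U2: "(LINT \<omega>|P. (U z \<omega>)\<^sup>2) \<le> 3 * v z * b z" for z
  proof -
    have km: "kernel_mean (\<lambda>y t. of_bool (y = z) * c z t) y = of_bool (y = z) * kernel_mean c y" for y
      by (simp add: kernel_mean_real)
    have km2: "kernel_mean (\<lambda>y t. (of_bool (y = z) * c z t)\<^sup>2) y = of_bool (y = z) * v y" for y
      by (simp add: kernel_mean_real v_def)
    have "(LINT \<omega>|P. (U z \<omega>)\<^sup>2) = (LINT \<omega>|P. stopped_sum K (\<lambda>y t. of_bool (y = z) * v y) n \<omega>)"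
      unfolding U_def by (subst second_moment_stopped_sum) (simp_all only: km km2 mean mult_zero_right)
    also have "\<dots> \<le> (LINT \<omega>|P. v z * real (K z))"
    proof (rule integral_mono)
      show "integrable P (stopped_sum K (\<lambda>y t. of_bool (y = z) * v y) n)"
        by (rule adapted_integrable[OF adapted_stopped_sum])
      fix \<omega>
      have "stopped_sum K (\<lambda>y t. of_bool (y = z) * v y) n \<omega> =
          (\<Sum>y\<in>UNIV. of_bool (y = z) * v y * real (min (visits n y \<omega>) (K y)))"
        unfolding stopped_sum_def by (rule sum_active)
      also have "\<dots> = (\<Sum>y\<in>UNIV. if y = z then v y * real (min (visits n y \<omega>) (K y)) else 0)"
        by (intro sum.cong) auto
      also have "\<dots> = v z * real (min (visits n z \<omega>) (K z))" by (subst sum.delta) auto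
      also have "\<dots> \<le> v z * real (K z)" using v by (intro mult_left_mono) auto
      finally show "stopped_sum K (\<lambda>y t. of_bool (y = z) * v y) n \<omega> \<le> v z * real (K z)" .
    qed simp
    also have "\<dots> = v z * real (K z)" by (simp add: prob_space)
    also have "\<dots> \<le> v z * (3 * b z)" using v K by (intro mult_left_mono)
    finally show ?thesis by simp
  qed
  have int_U2: "integrable P (\<lambda>\<omega>. (U z \<omega>)\<^sup>2)" for z
    by (rule adapted_integrable[OF adapted_comp[OF ad_U]])
  have int_bad: "integrable P bad'" by (rule adapted_integrable[OF ad_bad])
  have E_bad: "(LINT \<omega>|P. bad' \<omega>) = \<P>(\<omega> in P. bad \<omega>)"
  proof -
    have "(LINT \<omega>|P. bad' \<omega>) = (LINT \<omega>|P. indicator {\<omega> \<in> space P. bad \<omega>} \<omega>)"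
      by (intro Bochner_Integration.integral_cong) (auto simp: bad'_def indicator_def)
    also have "\<dots> = \<P>(\<omega> in P. bad \<omega>)" by (simp add: Int_absorb2)
    finally show ?thesis .
  qed
  let ?Y = "\<lambda>\<omega>. iexp (S \<omega>) * complex_of_real (exp (W \<omega>))"
  have ad_Y: "adapted (Suc n) ?Y"
    by (rule adapted_comp2[OF ad_S ad_W, of "\<lambda>x y. iexp x * complex_of_real (exp y)"])
  have ad_D: "adapted (Suc n) (\<lambda>\<omega>. iexp (T \<omega>) - exp (- V / 2) * ?Y \<omega>)"
    by (rule adapted_comp2[OF ad_T ad_Y, of "\<lambda>x y. iexp x - exp (- V / 2) * y"])
  have int_T: "integrable P (\<lambda>\<omega>. iexp (T \<omega>))"
    by (rule adapted_integrable[OF adapted_comp[OF ad_T]])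
  have int_Y: "integrable P ?Y" by (rule adapted_integrable[OF ad_Y])
  \<comment> \<open>The first part compares \<open>T\<close> with the stopped, deterministically
    normalised sum; the second is the martingale defect, scaled by
    \<open>exp (- V / 2)\<close>.\<close>
  have "(LINT \<omega>|P. iexp (T \<omega>)) - exp (- V / 2) =
      (LINT \<omega>|P. iexp (T \<omega>) - exp (- V / 2) * ?Y \<omega>) + exp (- V / 2) * ((LINT \<omega>|P. ?Y \<omega>) - 1)"
    using int_T int_Y by (simp add: right_diff_distrib)
  then have "cmod ((LINT \<omega>|P. iexp (T \<omega>)) - exp (- V / 2)) \<le>
      cmod (LINT \<omega>|P. iexp (T \<omega>) - exp (- V / 2) * ?Y \<omega>) + cmod (exp (- V / 2) * ((LINT \<omega>|P. ?Y \<omega>) - 1))"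
    by (simp only: norm_triangle_ineq)
  moreover have "cmod (LINT \<omega>|P. iexp (T \<omega>) - exp (- V / 2) * ?Y \<omega>) \<le>
      (3 + exp (2 * V)) * \<P>(\<omega> in P. bad \<omega>) + \<epsilon> * ((\<Sum>z\<in>UNIV. 1 + 3 * v z) + V * exp V)"
  proof -
    have intR: "integrable P (\<lambda>\<omega>. (3 + exp (2 * V)) * bad' \<omega> + \<epsilon> * ((\<Sum>z\<in>UNIV. 1 + (U z \<omega>)\<^sup>2 / b z) + V * exp V))"
      using int_U2 int_bad by (intro Bochner_Integration.integrable_add integrable_mult_right
          Bochner_Integration.integrable_sum integrable_divide integrable_const) auto
    have "cmod (LINT \<omega>|P. iexp (T \<omega>) - exp (- V / 2) * ?Y \<omega>) \<le>
      (LINT \<omega>|P. (3 + exp (2 * V)) * bad' \<omega> + \<epsilon> * ((\<Sum>z\<in>UNIV. 1 + (U z \<omega>)\<^sup>2 / b z) + V * exp V))"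
      by (rule order_trans[OF integral_norm_bound integral_mono[OF _ intR all]])
         (rule integrable_norm[OF adapted_integrable[OF ad_D]])
    also have "\<dots> = (3 + exp (2 * V)) * \<P>(\<omega> in P. bad \<omega>) +
        \<epsilon> * ((\<Sum>z\<in>UNIV. 1 + (LINT \<omega>|P. (U z \<omega>)\<^sup>2) / b z) + V * exp V)"
      using int_U2 int_bad E_bad by (simp add: prob_space)
    also have "\<dots> \<le> (3 + exp (2 * V)) * \<P>(\<omega> in P. bad \<omega>) + \<epsilon> * ((\<Sum>z\<in>UNIV. 1 + 3 * v z) + V * exp V)"
    proof (intro add_mono mult_left_mono sum_mono order_refl)
      show "(LINT \<omega>|P. (U z \<omega>)\<^sup>2) / b z \<le> 3 * v z" for z
        using U2[of z] b0[of z] by (simp add: divide_le_eq)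
    qed (use \<epsilon> V in auto)
    finally show ?thesis .
  qed
  moreover have "cmod (exp (- V / 2) * ((LINT \<omega>|P. ?Y \<omega>) - 1)) \<le>
      exp (2 * V) * (\<Sum>z\<in>UNIV. 3 * (exp (v z) * (w z + (v z)\<^sup>2)) / sqrt (b z))"
  proof -
    let ?\<rho> = "\<lambda>z. cmod (kernel_mean (\<lambda>z t. iexp (\<phi> z t) * exp (\<psi> z) - 1) z)"
    have "cmod (exp (- V / 2) * ((LINT \<omega>|P. ?Y \<omega>) - 1)) = exp (- V / 2) * cmod ((LINT \<omega>|P. ?Y \<omega>) - 1)"
      by (simp only: norm_mult norm_of_real abs_exp_cancel)
    also have "\<dots> \<le> 1 * cmod ((LINT \<omega>|P. ?Y \<omega>) - 1)"
      using V by (intro mult_right_mono) auto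
    also have "\<dots> \<le> exp (2 * V) * (\<Sum>z\<in>UNIV. ?\<rho> z * real (K z))"
      unfolding S_def W_def mult_1 using \<psi>K V by (intro exponential_martingale_defect \<psi>) linarith
    also have "\<dots> \<le> exp (2 * V) * (\<Sum>z\<in>UNIV. 3 * (exp (v z) * (w z + (v z)\<^sup>2)) / sqrt (b z))"
    proof (intro mult_left_mono sum_mono)
      fix z
      let ?d = "exp (v z) * (w z + (v z)\<^sup>2)"
      have "?\<rho> z \<le> ?d / (b z * sqrt (b z))"
        using kernel_mean_iexp_defect[of c z b, OF mean b] unfolding \<phi>_def \<psi>_def v_def w_def .
      \<comment> \<open>A pair is active at most \<open>3 * b z\<close> times at a cost of order
        \<open>b z\<close> to the power -3/2 each, which leaves a factor
        \<open>1 / sqrt (b z)\<close>.\<close>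
      then have "?\<rho> z * real (K z) \<le> ?d / (b z * sqrt (b z)) * (3 * b z)"
        using v w b0[of z] K by (intro mult_mono) auto
      also have "\<dots> = 3 * ?d / sqrt (b z)" using b0[of z] by simp
      finally show "?\<rho> z * real (K z) \<le> 3 * ?d / sqrt (b z)" .
    qed simp
    finally show ?thesis .
  qed
  ultimately show ?thesis by linarith
qed

end

section \<open>Linear functionals of \<open>xi\<close> and the quadratic form of
  \<open>Lambda\<close>\<close>

lemma sum_triple_pair:
  "(\<Sum>i\<in>UNIV. f i) = (\<Sum>z\<in>UNIV. \<Sum>t\<in>UNIV. f (fst z, snd z, t))"
  for f :: "'s::finite \<times> 'l::finite \<times> 't::finite \<Rightarrow> real"
proof -
  have "(\<Sum>z\<in>UNIV. \<Sum>t\<in>UNIV. f (fst z, snd z, t)) = (\<Sum>(z, t)\<in>UNIV. f (fst z, snd z, t))"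
    by (simp add: sum.cartesian_product flip: UNIV_Times_UNIV)
  also have "\<dots> = (\<Sum>i\<in>UNIV. f i)"
    by (rule sum.reindex_bij_witness[where j="\<lambda>(z, t). (fst z, snd z, t)" and i="\<lambda>(s, l, t). ((s, l), t)"]) auto
  finally show ?thesis ..
qed

context controlled_chain
begin

text \<open>The increment of the functional \<open>u\<close> caused by a transition out of
  \<open>z\<close>. Centring under the kernel is what subtracting \<open>M\<close> from
  \<open>M_hat\<close> amounts to.\<close>

definition centred :: "real ^ ('s \<times> 'l \<times> 's) \<Rightarrow> 's \<times> 'l \<Rightarrow> 's \<Rightarrow> real" where
  "centred u z t = u $ (fst z, snd z, t) - kernel_mean (\<lambda>z t. u $ (fst z, snd z, t)) z"

lemma kernel_mean_diff: "kernel_mean (\<lambda>z t. \<phi> z t - \<psi> z t) z = kernel_mean \<phi> z - kernel_mean \<psi> z"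
  for \<phi> \<psi> :: "_ \<Rightarrow> _ \<Rightarrow> real"
  by (simp add: kernel_mean_real right_diff_distrib sum_subtractf)

lemma kernel_mean_centred: "kernel_mean (centred u) z = 0"
  unfolding centred_def by (simp add: kernel_mean_diff kernel_mean_const)

lemma kernel_mean_centred_square:
  "kernel_mean (\<lambda>z t. (centred u z t)\<^sup>2) z =
    kernel_mean (\<lambda>z t. (u $ (fst z, snd z, t))\<^sup>2) z - (kernel_mean (\<lambda>z t. u $ (fst z, snd z, t)) z)\<^sup>2"
proof -
  define m where "m = kernel_mean (\<lambda>z t. u $ (fst z, snd z, t)) z"
  let ?M = "M (snd z) (fst z)" and ?u = "\<lambda>t. u $ (fst z, snd z, t)"
  have m: "(\<Sum>t\<in>UNIV. ?M t * ?u t) = m" by (simp add: m_def kernel_mean_real)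
  have "kernel_mean (\<lambda>z t. (centred u z t)\<^sup>2) z = (\<Sum>t\<in>UNIV. ?M t * (?u t)\<^sup>2 - 2 * m * (?M t * ?u t) + ?M t * m\<^sup>2)"
    unfolding kernel_mean_real centred_def
    by (intro sum.cong refl) (simp add: m_def kernel_mean_real power2_diff algebra_simps)
  also have "\<dots> = (\<Sum>t\<in>UNIV. ?M t * (?u t)\<^sup>2) - 2 * m * m + m\<^sup>2"
    by (simp only: sum.distrib sum_subtractf sum_distrib_left[symmetric] sum_distrib_right[symmetric] m M_sum mult_1)
  finally show ?thesis by (simp add: m_def kernel_mean_real power2_eq_square)
qed

text \<open>\<open>Lambda M\<close> is block diagonal over the pairs, each block being the
  covariance of the indicator vector of one draw from a row of \<open>M\<close>; the quadratic form
  of a block is therefore a variance.\<close>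

lemma quadratic_form_Lambda:
  "u \<bullet> (Lambda M *v u) = (\<Sum>z\<in>UNIV. kernel_mean (\<lambda>z t. (centred u z t)\<^sup>2) z)"
proof -
  have row: "(Lambda M *v u) $ (s, l, t) =
      M l s t * (u $ (s, l, t) - kernel_mean (\<lambda>z t. u $ (fst z, snd z, t)) (s, l))" for s l t
  proof -
    have "(Lambda M *v u) $ (s, l, t) = (\<Sum>z\<in>UNIV. if z = (s, l) then
        (\<Sum>t'\<in>UNIV. (of_bool (t = t') * M l s t - M l s t * M (snd z) (fst z) t') * u $ (fst z, snd z, t')) else 0)"
      unfolding matrix_vector_mult_def Lambda_def vec_lambda_beta sum_triple_pair
      by (intro sum.cong refl) auto
    also have "\<dots> = (\<Sum>t'\<in>UNIV. (of_bool (t = t') * M l s t - M l s t * M l s t') * u $ (s, l, t'))"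
      by (subst sum.delta) auto
    also have "\<dots> = (\<Sum>t'\<in>UNIV. (if t' = t then M l s t * u $ (s, l, t') else 0) - M l s t * (M l s t' * u $ (s, l, t')))"
      by (intro sum.cong refl) (auto simp: left_diff_distrib)
    also have "\<dots> = M l s t * u $ (s, l, t) - M l s t * (\<Sum>t'\<in>UNIV. M l s t' * u $ (s, l, t'))"
      unfolding sum_subtractf sum_distrib_left[symmetric] by (subst sum.delta) auto
    finally show ?thesis by (simp add: kernel_mean_real right_diff_distrib)
  qed
  have "u \<bullet> (Lambda M *v u) = (\<Sum>z\<in>UNIV. \<Sum>t\<in>UNIV. u $ (fst z, snd z, t) *
      (M (snd z) (fst z) t * (u $ (fst z, snd z, t) - kernel_mean (\<lambda>z t. u $ (fst z, snd z, t)) z)))"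
    by (simp add: inner_vec_def sum_triple_pair row)
  also have "\<dots> = (\<Sum>z\<in>UNIV. kernel_mean (\<lambda>z t. (centred u z t)\<^sup>2) z)"
  proof (rule sum.cong[OF refl])
    fix z
    let ?M = "M (snd z) (fst z)" and ?u = "\<lambda>t. u $ (fst z, snd z, t)" and ?m = "kernel_mean (\<lambda>z t. u $ (fst z, snd z, t)) z"
    have m: "(\<Sum>t\<in>UNIV. ?M t * ?u t) = ?m" by (simp add: kernel_mean_real)
    have "(\<Sum>t\<in>UNIV. ?u t * (?M t * (?u t - ?m))) = (\<Sum>t\<in>UNIV. ?M t * (?u t)\<^sup>2 - ?M t * ?u t * ?m)"
      by (intro sum.cong refl) (simp add: algebra_simps power2_eq_square)
    also have "\<dots> = (\<Sum>t\<in>UNIV. ?M t * (?u t)\<^sup>2) - ?m * ?m"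
      by (simp only: sum_subtractf sum_distrib_right[symmetric] m)
    finally show "(\<Sum>t\<in>UNIV. ?u t * (?M t * (?u t - ?m))) = kernel_mean (\<lambda>z t. (centred u z t)\<^sup>2) z"
      unfolding kernel_mean_centred_square by (simp add: kernel_mean_real power2_eq_square)
  qed
  finally show ?thesis .
qed

text \<open>For a visited pair, \<open>sqrt N * (A / N - m) = (A - N * m) / sqrt N\<close>, and both
  \<open>A\<close> and \<open>N\<close> are sums over the visits to \<open>z\<close>. Grouping the
  coordinates by pair leaves one self-normalised martingale per pair.\<close>

lemma inner_xi:
  "u \<bullet> xi X a M n \<omega> = (\<Sum>z\<in>UNIV. (\<Sum>k<n. of_bool (Z k \<omega> = z) * centred u z (X (Suc k) \<omega>)) / sqrt (real (visits n z \<omega>)))"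
proof -
  have "u \<bullet> xi X a M n \<omega> = (\<Sum>z\<in>UNIV. \<Sum>t\<in>UNIV. u $ (fst z, snd z, t) * (sqrt (real (visits n z \<omega>)) *
      (M_hat X a n (snd z) (fst z) t \<omega> - M (snd z) (fst z) t)))"
    by (simp add: inner_vec_def sum_triple_pair xi_def)
  also have "\<dots> = (\<Sum>z\<in>UNIV. (\<Sum>k<n. of_bool (Z k \<omega> = z) * centred u z (X (Suc k) \<omega>)) / sqrt (real (visits n z \<omega>)))"
  proof (rule sum.cong[OF refl])
    fix z
    let ?N = "real (visits n z \<omega>)" and ?u = "\<lambda>t. u $ (fst z, snd z, t)" and ?M = "M (snd z) (fst z)"
    let ?A = "\<lambda>t. real (transition_count X a n (fst z) (snd z) t \<omega>)" and ?m = "kernel_mean (\<lambda>z t. u $ (fst z, snd z, t)) z"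
    show "(\<Sum>t\<in>UNIV. ?u t * (sqrt ?N * (M_hat X a n (snd z) (fst z) t \<omega> - ?M t))) =
        (\<Sum>k<n. of_bool (Z k \<omega> = z) * centred u z (X (Suc k) \<omega>)) / sqrt ?N"
    proof (cases "?N = 0")
      \<comment> \<open>An unvisited pair contributes 0 on both sides, on the left through
        \<open>sqrt 0\<close> and on the right through division by 0.\<close>
      case True
      then show ?thesis by simp
    next
      case False
      then have N: "?N > 0" by simp
      have m: "(\<Sum>t\<in>UNIV. ?u t * ?M t) = ?m" by (simp add: kernel_mean_real mult.commute)
      have A: "(\<Sum>t\<in>UNIV. ?u t * ?A t) = (\<Sum>k<n. of_bool (Z k \<omega> = z) * ?u (X (Suc k) \<omega>))"
      proof -
        have "(\<Sum>t\<in>UNIV. ?u t * ?A t) = (\<Sum>k<n. \<Sum>t\<in>UNIV. ?u t * of_bool (X k \<omega> = fst z \<and> X (Suc k) \<omega> = t \<and> a k \<omega> = snd z))"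
          unfolding transition_count_def of_nat_sum sum_distrib_left of_nat_of_bool by (rule sum.swap)
        also have "\<dots> = (\<Sum>k<n. of_bool (Z k \<omega> = z) * ?u (X (Suc k) \<omega>))"
        proof (rule sum.cong[OF refl])
          fix k
          have "(\<Sum>t\<in>UNIV. ?u t * of_bool (X k \<omega> = fst z \<and> X (Suc k) \<omega> = t \<and> a k \<omega> = snd z)) =
              (\<Sum>t\<in>UNIV. if t = X (Suc k) \<omega> then of_bool (Z k \<omega> = z) * ?u t else 0)"
            by (intro sum.cong refl) (cases z; auto)
          then show "(\<Sum>t\<in>UNIV. ?u t * of_bool (X k \<omega> = fst z \<and> X (Suc k) \<omega> = t \<and> a k \<omega> = snd z)) =
            of_bool (Z k \<omega> = z) * ?u (X (Suc k) \<omega>)"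
            by (simp only: sum.delta finite) simp
        qed
        finally show ?thesis .
      qed
      have Nsum: "?N = (\<Sum>k<n. of_bool (Z k \<omega> = z))"
        unfolding visit_count_def of_nat_sum of_nat_of_bool by (intro sum.cong refl) (cases z; simp)
      have "sqrt ?N * (M_hat X a n (snd z) (fst z) t \<omega> - ?M t) = (?A t - ?N * ?M t) / sqrt ?N" for t
      proof -
        have "sqrt ?N * (?A t / ?N) = ?A t / sqrt ?N" "sqrt ?N * ?M t = ?N * ?M t / sqrt ?N"
          using N by (simp_all add: real_div_sqrt field_simps)
        then show ?thesis by (simp only: M_hat_def right_diff_distrib diff_divide_distrib)
      qed
      then have "(\<Sum>t\<in>UNIV. ?u t * (sqrt ?N * (M_hat X a n (snd z) (fst z) t \<omega> - ?M t))) =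
          (\<Sum>t\<in>UNIV. ?u t * ?A t - ?N * (?u t * ?M t)) / sqrt ?N"
        unfolding sum_divide_distrib by (intro sum.cong refl) (simp add: algebra_simps)
      also have "(\<Sum>t\<in>UNIV. ?u t * ?A t - ?N * (?u t * ?M t)) = (\<Sum>k<n. of_bool (Z k \<omega> = z) * ?u (X (Suc k) \<omega>)) - ?N * ?m"
        by (simp only: sum_subtractf sum_distrib_left[symmetric] m A)
      also have "\<dots> = (\<Sum>k<n. of_bool (Z k \<omega> = z) * centred u z (X (Suc k) \<omega>))"
        unfolding Nsum sum_distrib_right sum_subtractf[symmetric] centred_def
        by (intro sum.cong refl) (simp add: algebra_simps)
      finally show ?thesis .
    qed
  qed
  finally show ?thesis .
qed

text \<open>The estimate for fixed \<open>n\<close> leaves an error \<open>\<epsilon> * C\<close>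
  that does not fade with \<open>n\<close>, so \<open>\<epsilon>\<close> is fixed before
  \<open>n\<close> grows. All that is asked of the counts is that they concentrate, in relative
  terms, around a diverging proxy.\<close>

theorem char_xi_tendsto:
  assumes b: "\<And>z. filterlim (\<lambda>n. b n z) at_top sequentially"
    and conc: "\<And>z \<epsilon>. 0 < \<epsilon> \<Longrightarrow>
      (\<lambda>n. \<P>(\<omega> in P. \<not> \<bar>real (visits n z \<omega>) - b n z\<bar> \<le> \<epsilon> * b n z)) \<longlonglongrightarrow> 0"
  shows "(\<lambda>n. LINT \<omega>|P. iexp (u \<bullet> xi X a M n \<omega>)) \<longlonglongrightarrow> exp (- (u \<bullet> (Lambda M *v u)) / 2)"
proof -
  define v where "v z = kernel_mean (\<lambda>z t. (centred u z t)\<^sup>2) z" for z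
  define w where "w z = kernel_mean (\<lambda>z t. \<bar>centred u z t\<bar> ^ 3) z" for z
  define V where "V = (\<Sum>z\<in>UNIV. v z)"
  define C where "C = (\<Sum>z\<in>UNIV. 1 + 3 * v z) + V * exp V"
  define h where "h \<epsilon> n = (3 + exp (2 * V)) * (\<Sum>z\<in>UNIV. \<P>(\<omega> in P. \<not> \<bar>real (visits n z \<omega>) - b n z\<bar> \<le> \<epsilon> * b n z))
    + exp (2 * V) * (\<Sum>z\<in>UNIV. 3 * (exp (v z) * (w z + (v z)\<^sup>2)) / sqrt (b n z))" for \<epsilon> n
  have v: "0 \<le> v z" for z unfolding v_def by (auto intro: kernel_mean_nonneg)
  have C: "C > 0"
  proof -
    have "0 < (\<Sum>z\<in>UNIV. 1 + 3 * v z)" using v by (intro sum_pos) (auto simp: add_pos_nonneg)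
    moreover have "0 \<le> V * exp V" unfolding V_def by (intro mult_nonneg_nonneg sum_nonneg v) auto
    ultimately show ?thesis unfolding C_def by linarith
  qed
  have h0: "h \<epsilon> \<longlonglongrightarrow> 0" if "0 < \<epsilon>" for \<epsilon>
  proof -
    have 1: "(\<lambda>n. 3 * (exp (v z) * (w z + (v z)\<^sup>2)) / sqrt (b n z)) \<longlonglongrightarrow> 0" for z
      by (rule tendsto_divide_0[OF tendsto_const])
         (rule filterlim_at_top_imp_at_infinity[OF filterlim_compose[OF sqrt_at_top b]])
    have "h \<epsilon> \<longlonglongrightarrow> (3 + exp (2 * V)) * (\<Sum>z\<in>(UNIV::('s \<times> 'l) set). 0) + exp (2 * V) * (\<Sum>z\<in>(UNIV::('s \<times> 'l) set). 0)"
      unfolding h_def by (intro tendsto_add tendsto_mult tendsto_const tendsto_sum conc that 1)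
    then show ?thesis by simp
  qed
  have ev: "\<forall>\<^sub>F n in sequentially. \<forall>z. 1 \<le> b n z"
    using b by (intro eventually_all_finite) (auto simp: filterlim_at_top)
  have bound: "cmod ((LINT \<omega>|P. iexp (u \<bullet> xi X a M n \<omega>)) - exp (- V / 2)) \<le> h \<epsilon> n + \<epsilon> * C"
    if \<epsilon>: "0 < \<epsilon>" "\<epsilon> \<le> 1 / 2" and bn: "\<forall>z. 1 \<le> b n z" for \<epsilon> n
  proof -
    let ?bad = "\<lambda>z. {\<omega> \<in> space P. \<not> \<bar>real (visits n z \<omega>) - b n z\<bar> \<le> \<epsilon> * b n z}"
    have "\<P>(\<omega> in P. \<exists>z. \<not> \<bar>real (visits n z \<omega>) - b n z\<bar> \<le> \<epsilon> * b n z) = prob (\<Union>z. ?bad z)"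
      by (rule arg_cong[of _ _ prob]) blast
    also have "\<dots> \<le> (\<Sum>z\<in>UNIV. prob (?bad z))"
      by (rule finite_measure_subadditive_finite) auto
    finally have "(3 + exp (2 * V)) * \<P>(\<omega> in P. \<exists>z. \<not> \<bar>real (visits n z \<omega>) - b n z\<bar> \<le> \<epsilon> * b n z)
        \<le> (3 + exp (2 * V)) * (\<Sum>z\<in>UNIV. prob (?bad z))"
      by (intro mult_left_mono) auto
    then show ?thesis
      using char_self_normalised_bound[of "centred u" "b n" \<epsilon> n, OF kernel_mean_centred _ \<epsilon>] bn
      unfolding h_def C_def V_def v_def w_def inner_xi by auto
  qed
  have "(\<lambda>n. LINT \<omega>|P. iexp (u \<bullet> xi X a M n \<omega>)) \<longlonglongrightarrow> exp (- V / 2)"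
  proof (rule tendstoI)
    fix r :: real assume r: "r > 0"
    define \<epsilon> where "\<epsilon> = min (1 / 2) (r / (2 * C))"
    have \<epsilon>: "0 < \<epsilon>" "\<epsilon> \<le> 1 / 2" using r C by (auto simp: \<epsilon>_def)
    have "\<epsilon> \<le> r / (2 * C)" by (simp add: \<epsilon>_def)
    then have \<epsilon>C: "\<epsilon> * C \<le> r / 2" using C by (simp add: pos_le_divide_eq)
    have "\<forall>\<^sub>F n in sequentially. h \<epsilon> n < r / 2"
      using order_tendstoD(2)[OF h0[OF \<epsilon>(1)], of "r / 2"] r by simp
    with ev show "\<forall>\<^sub>F n in sequentially. dist (LINT \<omega>|P. iexp (u \<bullet> xi X a M n \<omega>)) (complex_of_real (exp (- V / 2))) < r"
    proof eventually_elim
      case (elim n)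
      then show ?case using bound[OF \<epsilon> elim(1)] \<epsilon>C unfolding dist_norm by linarith
    qed
  qed
  then show ?thesis unfolding quadratic_form_Lambda V_def v_def .
qed

end

section \<open>Conditioning on the initial pair\<close>

context finite_process
begin

lemma trajectory_0_1: "trajectory X a 0 (length [z]) \<omega> = [z] \<longleftrightarrow> (X 0 \<omega>, a 0 \<omega>) = z"
  by (simp add: trajectory_def)

lemma on_path_single: "on_path f [z] = (LINT \<omega>|P. of_bool ((X 0 \<omega>, a 0 \<omega>) = z) * f \<omega>)"
  unfolding on_path_def trajectory_0_1 ..

text \<open>Chebyshev's inequality on the event of starting in \<open>z\<close>, without dividing by
  its probability. Since \<open>b\<close> is the conditional mean, expanding the square around
  \<open>b\<close> leaves exactly the difference that the variance bound controls.\<close>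

lemma visit_count_deviation:
  fixes s :: 's and l :: 'l
  assumes C: "Delta_norm P X a n \<le> C" and n: "n > 0" and pos: "path_prob [z] > 0" and \<epsilon>: "\<epsilon> > 0"
  defines "b \<equiv> on_path (\<lambda>\<omega>. real (visit_count X a n s l \<omega>)) [z] / path_prob [z]"
  assumes b: "b > 0"
  shows "\<P>(\<omega> in P. (X 0 \<omega>, a 0 \<omega>) = z \<and> \<not> \<bar>real (visit_count X a n s l \<omega>) - b\<bar> \<le> \<epsilon> * b)
    \<le> n * C\<^sup>2 * path_prob [z] / (\<epsilon> * b)\<^sup>2"
proof -
  let ?f = "\<lambda>\<omega>. real (visit_count X a n s l \<omega>)" and ?p = "path_prob [z]"
  let ?I = "\<lambda>\<omega>. of_bool (trajectory X a 0 (length [z]) \<omega> = [z]) :: real"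
  let ?bad = "{\<omega> \<in> space P. (X 0 \<omega>, a 0 \<omega>) = z \<and> \<not> \<bar>?f \<omega> - b\<bar> \<le> \<epsilon> * b}"
  have f: "?f \<in> borel_measurable P" by measurable
  have f2: "(\<lambda>\<omega>. (?f \<omega>)\<^sup>2) \<in> borel_measurable P" by measurable
  have B: "norm (?f \<omega>) \<le> real n" "norm ((?f \<omega>)\<^sup>2) \<le> (real n)\<^sup>2" for \<omega>
  proof -
    show *: "norm (?f \<omega>) \<le> real n" using visit_count_le[of X a n s l \<omega>] by simp
    show "norm ((?f \<omega>)\<^sup>2) \<le> (real n)\<^sup>2" using power_mono[OF *, where n=2] by simp
  qed
  have int: "integrable P (\<lambda>\<omega>. ?I \<omega> * ?f \<omega>)" "integrable P (\<lambda>\<omega>. ?I \<omega> * (?f \<omega>)\<^sup>2)" "integrable P (\<lambda>\<omega>. ?I \<omega> * 1)"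
    using integrable_on_path[OF f B(1)] integrable_on_path[OF f2 B(2)] integrable_on_path[of "\<lambda>_. 1 :: real" 1] by auto
  have meas: "?bad \<in> sets P" by measurable
  have "(\<epsilon> * b)\<^sup>2 * prob ?bad = (LINT \<omega>|P. (\<epsilon> * b)\<^sup>2 * indicator ?bad \<omega>)"
    using meas by simp
  also have "\<dots> \<le> (LINT \<omega>|P. ?I \<omega> * (?f \<omega>)\<^sup>2 - 2 * b * (?I \<omega> * ?f \<omega>) + b\<^sup>2 * (?I \<omega> * 1))"
  proof (rule integral_mono)
    show "integrable P (\<lambda>\<omega>. (\<epsilon> * b)\<^sup>2 * indicator ?bad \<omega>)"
      using meas by (intro integrable_mult_right integrable_real_indicator) (auto simp: emeasure_eq_measure)
    show "integrable P (\<lambda>\<omega>. ?I \<omega> * (?f \<omega>)\<^sup>2 - 2 * b * (?I \<omega> * ?f \<omega>) + b\<^sup>2 * (?I \<omega> * 1))"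
      by (intro Bochner_Integration.integrable_add Bochner_Integration.integrable_diff integrable_mult_right int)
    fix \<omega>
    have "?I \<omega> * (?f \<omega>)\<^sup>2 - 2 * b * (?I \<omega> * ?f \<omega>) + b\<^sup>2 * (?I \<omega> * 1) = ?I \<omega> * (?f \<omega> - b)\<^sup>2"
      by (simp add: power2_diff algebra_simps)
    moreover have "(\<epsilon> * b)\<^sup>2 * indicator ?bad \<omega> \<le> ?I \<omega> * (?f \<omega> - b)\<^sup>2"
    proof (cases "\<omega> \<in> ?bad")
      case True
      then have "\<epsilon> * b \<le> \<bar>?f \<omega> - b\<bar>" "?I \<omega> = 1" using trajectory_0_1[of z \<omega>] by auto
      moreover from this have "(\<epsilon> * b)\<^sup>2 \<le> \<bar>?f \<omega> - b\<bar>\<^sup>2" using \<epsilon> b by (intro power_mono) auto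
      ultimately show ?thesis using True by simp
    qed simp
    ultimately show "(\<epsilon> * b)\<^sup>2 * indicator ?bad \<omega> \<le> ?I \<omega> * (?f \<omega>)\<^sup>2 - 2 * b * (?I \<omega> * ?f \<omega>) + b\<^sup>2 * (?I \<omega> * 1)"
      by linarith
  qed
  also have "\<dots> = (LINT \<omega>|P. ?I \<omega> * (?f \<omega>)\<^sup>2) - 2 * b * (LINT \<omega>|P. ?I \<omega> * ?f \<omega>) + b\<^sup>2 * (LINT \<omega>|P. ?I \<omega> * 1)"
    by (subst Bochner_Integration.integral_add, intro Bochner_Integration.integrable_diff integrable_mult_right int,
        intro integrable_mult_right int, subst Bochner_Integration.integral_diff, rule int,
        intro integrable_mult_right int, simp only: integral_mult_right_zero)
  also have "\<dots> = on_path (\<lambda>\<omega>. (?f \<omega>)\<^sup>2) [z] - 2 * b * on_path ?f [z] + b\<^sup>2 * ?p"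
    unfolding on_path_def ..
  also have "\<dots> = on_path (\<lambda>\<omega>. (?f \<omega>)\<^sup>2) [z] - (on_path ?f [z])\<^sup>2 / ?p"
    using pos by (simp add: b_def power2_eq_square field_simps)
  also have "\<dots> \<le> n * C\<^sup>2 * ?p"
    using visit_count_variance[OF C n pos, of s l] by linarith
  finally show ?thesis
    using \<epsilon> b by (simp add: pos_le_divide_eq mult.commute)
qed

end

section \<open>Integrals and transitions under the conditional measure\<close>

lemma uniform_measure_eq_density:
  assumes "finite_measure M" "A \<in> sets M" "measure M A > 0"
  shows "uniform_measure M A = density M (\<lambda>x. ennreal (indicator A x / measure M A))"
proof -
  interpret finite_measure M by fact
  show ?thesis
    unfolding uniform_measure_def using assms(3)
    by (intro arg_cong[of _ _ "density M"] ext)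
       (simp add: emeasure_eq_measure ennreal_indicator[symmetric] divide_ennreal del: ennreal_indicator)
qed

lemma integral_uniform_measure:
  fixes f :: "'a \<Rightarrow> 'b::{banach, second_countable_topology}"
  assumes "finite_measure M" and [measurable]: "A \<in> sets M" and "measure M A > 0" and [measurable]: "f \<in> borel_measurable M"
  shows "(LINT x|uniform_measure M A. f x) = (LINT x|M. indicator A x *\<^sub>R f x) /\<^sub>R measure M A"
proof -
  have "(LINT x|uniform_measure M A. f x) = (LINT x|M. (indicator A x / measure M A) *\<^sub>R f x)"
    unfolding uniform_measure_eq_density[OF assms(1-3)] by (rule integral_density) auto
  also have "\<dots> = (LINT x|M. (inverse (measure M A)) *\<^sub>R (indicator A x *\<^sub>R f x))"
    by (intro Bochner_Integration.integral_cong) (auto simp: divide_inverse mult.commute)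
  finally show ?thesis by (simp only: integral_scaleR_right)
qed

text \<open>
  The mixing coefficients start at time \<open>1\<close>, so they say nothing about how strongly the visit counts
  depend on the initial pair. One therefore conditions on it.
\<close>

lemma (in controlled_chain) controlled_chain_given_start:
  fixes z
  defines "E \<equiv> {\<omega> \<in> space P. Z 0 \<omega> = z}"
  assumes pos: "prob E > 0"
  shows "controlled_chain (uniform_measure P E) X a M"
proof -
  let ?Q = "uniform_measure P E"
  have E: "E \<in> sets P" unfolding E_def by measurable
  have Q: "measure ?Q A = prob (E \<inter> A) / prob E" if "A \<in> sets P" for A
    using that E pos by (intro measure_uniform_measure) (auto simp: emeasure_eq_measure)
  interpret Q: finite_process ?Q X a
  proof (intro finite_process.intro finite_process_axioms.intro)
    show "prob_space ?Q" using pos by (intro prob_space_uniform_measure) (auto simp: emeasure_eq_measure)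
  qed (simp_all add: X_measurable a_measurable)
  show ?thesis
  proof (intro controlled_chain.intro controlled_chain_axioms.intro M_nonneg M_sum)
    show "finite_process ?Q X a" by (rule Q.finite_process_axioms)
    fix h s l t
    let ?A = "{\<omega> \<in> space P. trajectory X a 0 (Suc (length h)) \<omega> = h @ [(s, l)] \<and> X (Suc (length h)) \<omega> = t}"
    let ?B = "{\<omega> \<in> space P. trajectory X a 0 (Suc (length h)) \<omega> = h @ [(s, l)]}"
    have m: "?A \<in> sets P" "?B \<in> sets P" by measurable
    have start: "Z 0 \<omega> = hd (h @ [(s, l)])" if "trajectory X a 0 (Suc (length h)) \<omega> = h @ [(s, l)]" for \<omega>
      unfolding that[symmetric] by (simp add: trajectory_def upt_conv_Cons del: upt_Suc)
    \<comment> \<open>The starting pair is the head of the path, so \<open>E\<close> either contains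
      both events or is disjoint from both; the step equation survives the conditioning in either
      case.\<close>
    have "prob (E \<inter> ?A) = M l s t * prob (E \<inter> ?B)"
    proof (cases "hd (h @ [(s, l)]) = z")
      case True
      then have "E \<inter> ?A = ?A" "E \<inter> ?B = ?B" using start unfolding E_def by auto
      then show ?thesis using step[of h s l t] by (simp add: path_prob_eq)
    next
      case False
      then have "E \<inter> ?A = {}" "E \<inter> ?B = {}" using start unfolding E_def by auto
      then show ?thesis by simp
    qed
    then show "\<P>(\<omega> in ?Q. trajectory X a 0 (Suc (length h)) \<omega> = h @ [(s, l)] \<and> X (Suc (length h)) \<omega> = t) =
        M l s t * Q.on_path (\<lambda>_. 1) (h @ [(s, l)])"
      using Q[OF m(1)] Q[OF m(2)] by (simp add: Q.path_prob_eq)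
  qed
qed

lemma controlled_markov_chain_step:
  fixes X :: "nat \<Rightarrow> 'w \<Rightarrow> 's::finite" and a :: "nat \<Rightarrow> 'w \<Rightarrow> 'l::finite"
  assumes "controlled_markov_chain P X a M"
  shows "finite_process P X a"
    and "\<P>(\<omega> in P. trajectory X a 0 (Suc (length h)) \<omega> = h @ [(s, l)] \<and> X (Suc (length h)) \<omega> = t) =
      M l s t * finite_process.on_path P X a (\<lambda>_. 1) (h @ [(s, l)])"
proof -
  show fp: "finite_process P X a"
    using assms by (simp add: controlled_markov_chain_def finite_process_def finite_process_axioms_def)
  interpret finite_process P X a by (rule fp)
  let ?g = "h @ [(s, l)]"
  let ?C = "\<lambda>\<omega>. \<forall>j\<le>length h. X j \<omega> = fst (?g ! j) \<and> a j \<omega> = snd (?g ! j)"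
  have C: "?C \<omega> \<longleftrightarrow> trajectory X a 0 (Suc (length h)) \<omega> = ?g" for \<omega>
    unfolding trajectory_eq_iff by (auto simp: less_Suc_eq_le prod_eq_iff)
  \<comment> \<open>Histories in the definition are functions of time; they are instantiated by the
    coordinates of the list \<open>?g\<close>.\<close>
  have rule: "\<P>(\<omega> in P. ?C \<omega>) > 0 \<Longrightarrow> \<P>(\<omega> in P. X (Suc (length h)) \<omega> = t \<bar> ?C \<omega>) = M l s t"
    using assms unfolding controlled_markov_chain_def
    by (elim conjE allE[of _ "length h"] allE[of _ "\<lambda>j. fst (?g ! j)"] allE[of _ "\<lambda>j. snd (?g ! j)"] allE[of _ t]) auto
  have p: "path_prob ?g = \<P>(\<omega> in P. ?C \<omega>)" unfolding path_prob_eq C by simp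
  show "\<P>(\<omega> in P. trajectory X a 0 (Suc (length h)) \<omega> = ?g \<and> X (Suc (length h)) \<omega> = t) = M l s t * path_prob ?g"
  proof (cases "path_prob ?g = 0")
    case True
    have "\<P>(\<omega> in P. trajectory X a 0 (Suc (length h)) \<omega> = ?g \<and> X (Suc (length h)) \<omega> = t) \<le> path_prob ?g"
      unfolding path_prob_eq by (rule finite_measure_mono) auto
    then show ?thesis using True measure_nonneg[of P] by (simp add: order_antisym)
  next
    case False
    then have pos: "path_prob ?g > 0" using path_prob_nonneg[of ?g] by linarith
    then have "\<P>(\<omega> in P. X (Suc (length h)) \<omega> = t \<bar> ?C \<omega>) = M l s t" using rule p by simp
    then have "\<P>(\<omega> in P. X (Suc (length h)) \<omega> = t \<and> ?C \<omega>) = M l s t * path_prob ?g"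
      using pos unfolding cond_prob_def p by (simp add: field_simps)
    then show ?thesis unfolding C by (simp add: conj_commute)
  qed
qed

theorem theorem6:
  fixes P :: "'w measure"
    and X :: "nat \<Rightarrow> 'w \<Rightarrow> 's::finite"
    and a :: "nat \<Rightarrow> 'w \<Rightarrow> 'l::finite"
    and M :: "'l \<Rightarrow> 's \<Rightarrow> 's \<Rightarrow> real"
  assumes cmc: "controlled_markov_chain P X a M"
    and return_times:
      "\<forall>s l. \<exists>\<alpha> T. 0 < \<alpha> \<and> \<alpha> < 1 \<and> T \<in> O(\<lambda>i. real i powr \<alpha>) \<and>
         (\<forall>i\<ge>1. AE \<omega> in P. expected_return_time P X a s l i \<omega> \<le> ennreal (T i))"
    and mixing: "\<exists>C\<^sub>\<Delta>>1. \<forall>n\<ge>1. Delta_norm P X a n \<le> C\<^sub>\<Delta>"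
  shows "\<exists>\<nu>. multivariate_normal 0 (Lambda M) \<nu> \<and>
             converges_in_distribution P (xi X a M) \<nu>"
proof -
  interpret finite_process P X a by (rule controlled_markov_chain_step(1)[OF cmc])
  note step = controlled_markov_chain_step(2)[OF cmc]
  have growth: "\<exists>m. (\<lambda>n. sqrt n / real (m n)) \<longlonglongrightarrow> 0 \<and> filterlim m at_top sequentially \<and>
      (\<forall>n>0. \<P>(\<omega> in P. visit_count X a n s l \<omega> < m n) \<le> \<epsilon>)" if "\<epsilon> > 0" for s l and \<epsilon> :: real
  proof -
    obtain \<alpha> T where T: "0 < \<alpha>" "\<alpha> < 1" "T \<in> O(\<lambda>i. real i powr \<alpha>)"
      "\<And>i. i \<ge> 1 \<Longrightarrow> AE \<omega> in P. expected_return_time P X a s l i \<omega> \<le> ennreal (T i)"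
      using return_times by blast
    show ?thesis
      by (rule visit_count_growth[OF prob_space_axioms X_measurable a_measurable T that])
         (assumption, rule exI, rule conjI, assumption, rule conjI, assumption, simp)
  qed
  \<comment> \<open>At a pair that never occurs the definition of the chain says nothing about
    \<open>M\<close>, so nonnegativity and unit row sums must come from the growth of the counts.
    Failure probability \<open>1 / 2\<close> suffices: such a pair would have fewer than
    \<open>m n\<close> visits with probability 1.\<close>
  have visited: "\<exists>h. path_prob (h @ [(s, l)]) > 0" for s l
  proof -
    obtain m where m: "filterlim m at_top sequentially" "\<And>n. n > 0 \<Longrightarrow> \<P>(\<omega> in P. visit_count X a n s l \<omega> < m n) \<le> 1 / 2"
      using growth[of "1 / 2" s l] by auto
    have "\<forall>\<^sub>F n in sequentially. 1 \<le> m n \<and> n > 0"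
      using m(1) by (intro eventually_conj eventually_gt_at_top) (simp add: filterlim_at_top)
    then obtain n where n: "1 \<le> m n" "n > 0" by (auto simp: eventually_sequentially)
    show ?thesis
    proof (rule ccontr)
      assume none: "\<not> ?thesis"
      have "\<P>(\<omega> in P. X k \<omega> = s \<and> a k \<omega> = l) = 0" for k
      proof -
        have "{\<omega> \<in> space P. X k \<omega> = s \<and> a k \<omega> = l} \<subseteq>
            (\<Union>h\<in>{h. length h = k}. {\<omega> \<in> space P. trajectory X a 0 (length (h @ [(s, l)])) \<omega> = h @ [(s, l)]})"
          by (auto simp: trajectory_Suc)
        then have "\<P>(\<omega> in P. X k \<omega> = s \<and> a k \<omega> = l) \<le>
            (\<Sum>h | length h = k. \<P>(\<omega> in P. trajectory X a 0 (length (h @ [(s, l)])) \<omega> = h @ [(s, l)]))"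
          by (intro order_trans[OF finite_measure_mono finite_measure_subadditive_finite]) auto
        also have "\<dots> = (\<Sum>h | length h = k. path_prob (h @ [(s, l)]))" by (simp only: path_prob_eq)
        also have "\<dots> \<le> 0" using none by (intro sum_nonpos) (auto simp: not_less)
        finally show ?thesis using measure_nonneg[of P] by (simp add: order_antisym)
      qed
      then have "AE \<omega> in P. \<not> (X k \<omega> = s \<and> a k \<omega> = l)" for k
        by (subst (asm) prob_eq_0) auto
      then have "AE \<omega> in P. \<forall>k. \<not> (X k \<omega> = s \<and> a k \<omega> = l)" by (simp add: AE_all_countable)
      then have "AE \<omega> in P. visit_count X a n s l \<omega> < m n"
      proof eventually_elim
        case (elim \<omega>)
        then have "visit_count X a n s l \<omega> = 0" unfolding visit_count_def by (intro sum.neutral) auto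
        then show ?case using n by simp
      qed
      then have "\<P>(\<omega> in P. visit_count X a n s l \<omega> < m n) = 1"
        by (intro prob_Collect_eq_1[THEN iffD2]) auto
      then show False using m(2)[OF n(2)] by simp
    qed
  qed
  have M_nonneg: "0 \<le> M l s t" for l s t
  proof -
    obtain h where h: "path_prob (h @ [(s, l)]) > 0" using visited by blast
    have "0 \<le> M l s t * path_prob (h @ [(s, l)])" unfolding step[symmetric] by (rule measure_nonneg)
    then show ?thesis using h by (simp add: zero_le_mult_iff)
  qed
  have M_sum: "(\<Sum>t\<in>UNIV. M l s t) = 1" for l s
  proof -
    obtain h where h: "path_prob (h @ [(s, l)]) > 0" using visited by blast
    let ?A = "\<lambda>t. {\<omega> \<in> space P. trajectory X a 0 (Suc (length h)) \<omega> = h @ [(s, l)] \<and> X (Suc (length h)) \<omega> = t}"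
    have "(\<Sum>t\<in>UNIV. M l s t) * path_prob (h @ [(s, l)]) = (\<Sum>t\<in>UNIV. prob (?A t))"
      by (simp only: step sum_distrib_right)
    also have "\<dots> = prob (\<Union>t. ?A t)"
      by (rule finite_measure_finite_Union[symmetric]) (auto simp: disjoint_family_on_def)
    also have "(\<Union>t. ?A t) = {\<omega> \<in> space P. trajectory X a 0 (length (h @ [(s, l)])) \<omega> = h @ [(s, l)]}" by auto
    also have "prob \<dots> = path_prob (h @ [(s, l)])" by (rule path_prob_eq[symmetric])
    finally show ?thesis using h by simp
  qed
  interpret controlled_chain P X a M
    by standard (fact step, fact M_nonneg, fact M_sum)
  obtain C where C: "\<And>n. n \<ge> 1 \<Longrightarrow> Delta_norm P X a n \<le> C" using mixing by blast
  have xi_adapted: "adapted (Suc n) (\<lambda>\<omega>. xi X a M n \<omega>)" for n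
    unfolding adapted_def
  proof (intro allI impI)
    fix \<omega> \<omega>' assume *: "\<forall>j<Suc n. X j \<omega> = X j \<omega>' \<and> a j \<omega> = a j \<omega>'"
    have "visit_count X a n s l \<omega> = visit_count X a n s l \<omega>'" "transition_count X a n s l t \<omega> = transition_count X a n s l t \<omega>'" for s l t
      using * unfolding visit_count_def transition_count_def by (auto intro!: sum.cong)
    then show "xi X a M n \<omega> = xi X a M n \<omega>'" by (simp add: xi_def M_hat_def)
  qed
  have xi_measurable [measurable]: "xi X a M n \<in> borel_measurable P" for n
    using adapted_measurable[OF xi_adapted] .
  let ?G = "\<lambda>u. complex_of_real (exp (- (u \<bullet> (Lambda M *v u)) / 2))"
  \<comment> \<open>Left unnormalised, so that null starting pairs are harmless and summing over
    \<open>z\<close> recovers the expectation under \<open>P\<close>.\<close>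
  have start_limit: "(\<lambda>n. on_path (\<lambda>\<omega>. iexp (u \<bullet> xi X a M n \<omega>)) [z]) \<longlonglongrightarrow> complex_of_real (path_prob [z]) * ?G u" for u z
  proof (cases "path_prob [z] = 0")
    case True
    then show ?thesis by (simp add: on_path_eq_0)
  next
    case False
    define p where "p = path_prob [z]"
    have p: "p > 0" using False path_prob_nonneg[of "[z]"] unfolding p_def by linarith
    define E where "E = {\<omega> \<in> space P. Z 0 \<omega> = z}"
    have E[measurable]: "E \<in> sets P" unfolding E_def by measurable
    have pE: "p = prob E" unfolding p_def path_prob_eq trajectory_0_1 E_def ..
    define Q where "Q = uniform_measure P E"
    interpret Q: controlled_chain Q X a M
      using controlled_chain_given_start[of z] p unfolding pE E_def Q_def by simp
    have prob_Q: "\<P>(\<omega> in Q. A \<omega>) = \<P>(\<omega> in P. Z 0 \<omega> = z \<and> A \<omega>) / p" if [measurable]: "Measurable.pred P A" for A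
    proof -
      have "\<P>(\<omega> in Q. A \<omega>) = prob (E \<inter> {\<omega> \<in> space P. A \<omega>}) / prob E"
        using p unfolding Q_def pE by (subst measure_uniform_measure) (auto simp: emeasure_eq_measure)
      also have "E \<inter> {\<omega> \<in> space P. A \<omega>} = {\<omega> \<in> space P. Z 0 \<omega> = z \<and> A \<omega>}" by (auto simp: E_def)
      finally show ?thesis by (simp only: pE)
    qed
    define b where "b n y = on_path (\<lambda>\<omega>. real (visits n y \<omega>)) [z] / p" for n y
    \<comment> \<open>With failure probability \<open>p / 2\<close>, at least half of the mass of
      \<open>E\<close> sees \<open>m y n\<close> visits; this forces the conditional mean
      \<open>b n y\<close> up to half of \<open>m y n\<close>.\<close>
    obtain m where m: "\<And>y. (\<lambda>n. sqrt n / real (m y n)) \<longlonglongrightarrow> 0" "\<And>y. filterlim (m y) at_top sequentially"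
      "\<And>y n. n > 0 \<Longrightarrow> \<P>(\<omega> in P. visits n y \<omega> < m y n) \<le> p / 2"
    proof -
      have "\<forall>y. \<exists>m. (\<lambda>n. sqrt n / real (m n)) \<longlonglongrightarrow> 0 \<and> filterlim m at_top sequentially \<and>
          (\<forall>n>0. \<P>(\<omega> in P. visits n y \<omega> < m n) \<le> p / 2)"
        using growth[of "p / 2"] p by simp
      from choice[OF this] obtain m where m: "\<forall>y. (\<lambda>n. sqrt n / real (m y n)) \<longlonglongrightarrow> 0 \<and> filterlim (m y) at_top sequentially \<and>
          (\<forall>n>0. \<P>(\<omega> in P. visits n y \<omega> < m y n) \<le> p / 2)" ..
      show thesis by (rule that[of m]) (use m in blast)+
    qed
    have b_ge: "real (m y n) / 2 \<le> b n y" if n: "n > 0" for y n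
    proof -
      let ?S = "{\<omega> \<in> space P. visits n y \<omega> < m y n}"
      have S: "?S \<in> sets P" by measurable
      have "p - p / 2 \<le> prob E - prob ?S" using m(3)[OF n, of y] pE by linarith
      also have "\<dots> \<le> prob (E - ?S)"
      proof -
        have "prob E \<le> prob ((E - ?S) \<union> ?S)" using S E by (intro finite_measure_mono) auto
        also have "\<dots> \<le> prob (E - ?S) + prob ?S" using S E by (intro measure_Un_le) auto
        finally show ?thesis by linarith
      qed
      finally have half: "p / 2 \<le> prob (E - ?S)" by simp
      have "real (m y n) * (p / 2) \<le> real (m y n) * prob (E - ?S)" using half by (intro mult_left_mono) auto
      also have "\<dots> = (LINT \<omega>|P. real (m y n) * indicator (E - ?S) \<omega>)" using S E by simp
      also have "\<dots> \<le> (LINT \<omega>|P. of_bool (trajectory X a 0 (length [z]) \<omega> = [z]) * real (visits n y \<omega>))"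
      proof (rule integral_mono)
        show "integrable P (\<lambda>\<omega>. real (m y n) * indicator (E - ?S) \<omega>)"
          using S E by (intro integrable_mult_right integrable_real_indicator) (auto simp: emeasure_eq_measure)
        show "integrable P (\<lambda>\<omega>. of_bool (trajectory X a 0 (length [z]) \<omega> = [z]) * real (visits n y \<omega>))"
          by (rule integrable_on_path[of _ "real n"]) (auto simp: visit_count_le)
        fix \<omega> assume "\<omega> \<in> space P"
        then show "real (m y n) * indicator (E - ?S) \<omega> \<le> of_bool (trajectory X a 0 (length [z]) \<omega> = [z]) * real (visits n y \<omega>)"
          unfolding trajectory_0_1 by (auto simp: E_def indicator_def)
      qed
      also have "\<dots> = b n y * p" using p by (simp add: b_def on_path_def)
      finally show ?thesis using p by simp
    qed
    have b_top: "filterlim (\<lambda>n. b n y) at_top sequentially" for y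
    proof (rule filterlim_at_top_mono)
      show "filterlim (\<lambda>n. 1 / 2 * real (m y n)) at_top sequentially"
        by (rule filterlim_tendsto_pos_mult_at_top[OF tendsto_const _ filterlim_compose[OF filterlim_real_sequentially m(2)]]) simp
      show "\<forall>\<^sub>F n in sequentially. 1 / 2 * real (m y n) \<le> b n y"
        using eventually_gt_at_top[of 0] by eventually_elim (use b_ge in auto)
    qed
    \<comment> \<open>Chebyshev leaves \<open>n * C\<^sup>2 / (\<epsilon> * b n y)\<^sup>2\<close>;
      inserting \<open>b n y \<ge> m y n / 2\<close> produces the factor 4 and the square of the
      null sequence \<open>sqrt n / m y n\<close>.\<close>
    have conc: "(\<lambda>n. \<P>(\<omega> in Q. \<not> \<bar>real (visits n y \<omega>) - b n y\<bar> \<le> \<epsilon> * b n y)) \<longlonglongrightarrow> 0" if \<epsilon>: "0 < \<epsilon>" for y \<epsilon>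
    proof (rule Lim_null_comparison)
      have "\<forall>\<^sub>F n in sequentially. 1 \<le> m y n" using m(2)[of y] by (simp add: filterlim_at_top)
      then show "\<forall>\<^sub>F n in sequentially. norm (\<P>(\<omega> in Q. \<not> \<bar>real (visits n y \<omega>) - b n y\<bar> \<le> \<epsilon> * b n y)) \<le>
          (4 * C\<^sup>2 / \<epsilon>\<^sup>2) * (sqrt n / real (m y n))\<^sup>2"
        using eventually_gt_at_top[of 0]
      proof eventually_elim
        case (elim n)
        have bm: "real (m y n) / 2 \<le> b n y" by (rule b_ge[OF elim(2)])
        have b0: "b n y > 0" using bm elim(1) by linarith
        have "\<P>(\<omega> in P. Z 0 \<omega> = z \<and> \<not> \<bar>real (visits n y \<omega>) - b n y\<bar> \<le> \<epsilon> * b n y) \<le> n * C\<^sup>2 * p / (\<epsilon> * b n y)\<^sup>2"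
          using visit_count_deviation[of n C z \<epsilon> "fst y" "snd y"] C[of n] elim(2) p \<epsilon> b0
          unfolding p_def b_def by simp
        then have "\<P>(\<omega> in Q. \<not> \<bar>real (visits n y \<omega>) - b n y\<bar> \<le> \<epsilon> * b n y) \<le> n * C\<^sup>2 / (\<epsilon> * b n y)\<^sup>2"
          using p by (subst prob_Q) (auto simp: field_simps)
        also have "\<dots> \<le> n * C\<^sup>2 / (\<epsilon> * (real (m y n) / 2))\<^sup>2"
          using bm \<epsilon> elim(1) b0 by (intro divide_left_mono power_mono mult_left_mono mult_pos_pos zero_less_power) auto
        also have "\<dots> = (4 * C\<^sup>2 / \<epsilon>\<^sup>2) * (sqrt n / real (m y n))\<^sup>2"
          by (simp add: power_mult_distrib power_divide)
        finally show ?case by simp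
      qed
      have "(\<lambda>n. (4 * C\<^sup>2 / \<epsilon>\<^sup>2) * (sqrt n / real (m y n))\<^sup>2) \<longlonglongrightarrow> (4 * C\<^sup>2 / \<epsilon>\<^sup>2) * 0\<^sup>2"
        by (intro tendsto_mult tendsto_power tendsto_const m(1))
      then show "(\<lambda>n. (4 * C\<^sup>2 / \<epsilon>\<^sup>2) * (sqrt n / real (m y n))\<^sup>2) \<longlonglongrightarrow> 0" by simp
    qed
    have lim: "(\<lambda>n. LINT \<omega>|Q. iexp (u \<bullet> xi X a M n \<omega>)) \<longlonglongrightarrow> ?G u"
      by (rule Q.char_xi_tendsto[OF b_top conc])
    have "on_path (\<lambda>\<omega>. iexp (u \<bullet> xi X a M n \<omega>)) [z] = complex_of_real p * (LINT \<omega>|Q. iexp (u \<bullet> xi X a M n \<omega>))" for n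
    proof -
      have "on_path (\<lambda>\<omega>. iexp (u \<bullet> xi X a M n \<omega>)) [z] = (LINT \<omega>|P. indicator E \<omega> *\<^sub>R iexp (u \<bullet> xi X a M n \<omega>))"
        unfolding on_path_single by (intro Bochner_Integration.integral_cong) (auto simp: E_def indicator_def)
      moreover have "(LINT \<omega>|Q. iexp (u \<bullet> xi X a M n \<omega>)) = (LINT \<omega>|P. indicator E \<omega> *\<^sub>R iexp (u \<bullet> xi X a M n \<omega>)) /\<^sub>R p"
        unfolding Q_def pE using p pE by (intro integral_uniform_measure finite_measure_axioms) auto
      ultimately show ?thesis using p by (simp add: scaleR_conv_of_real)
    qed
    then show ?thesis using tendsto_mult_left[OF lim, of "complex_of_real p"] by (simp only: p_def)
  qed
  have char: "(\<lambda>n. LINT \<omega>|P. iexp (u \<bullet> xi X a M n \<omega>)) \<longlonglongrightarrow> ?G u" for u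
  proof -
    have "(LINT \<omega>|P. iexp (u \<bullet> xi X a M n \<omega>)) = (\<Sum>h | length h = 1. on_path (\<lambda>\<omega>. iexp (u \<bullet> xi X a M n \<omega>)) h)" for n
      by (rule integral_eq_sum_on_path[of _ 1]) auto
    moreover have "(\<lambda>n. \<Sum>h | length h = 1. on_path (\<lambda>\<omega>. iexp (u \<bullet> xi X a M n \<omega>)) h) \<longlonglongrightarrow>
        (\<Sum>h | length h = 1. complex_of_real (path_prob h) * ?G u)"
    proof (rule tendsto_sum)
      fix h :: "('s \<times> 'l) list" assume "h \<in> {h. length h = 1}"
      then obtain z where h: "h = [z]" by (auto simp: length_Suc_conv)
      show "(\<lambda>n. on_path (\<lambda>\<omega>. iexp (u \<bullet> xi X a M n \<omega>)) h) \<longlonglongrightarrow> complex_of_real (path_prob h) * ?G u"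
        unfolding h by (rule start_limit)
    qed
    moreover have "(\<Sum>h | length h = 1. complex_of_real (path_prob h) * ?G u) = ?G u"
    proof -
      have "(\<Sum>h | length h = 1. path_prob h) = 1"
        using integral_eq_sum_on_path[of "\<lambda>_. 1 :: real" 1 1] by (simp add: prob_space)
      then have "(\<Sum>h | length h = 1. complex_of_real (path_prob h)) = 1" by (simp flip: of_real_sum)
      then show ?thesis by (simp only: sum_distrib_right[symmetric] mult_1)
    qed
    ultimately show ?thesis by (simp only:)
  qed
  obtain \<nu> where \<nu>: "multivariate_normal 0 (Lambda M) \<nu>" "\<And>u. (LINT x|\<nu>. iexp (u \<bullet> x)) = ?G u"
    using multivariate_normal_exists[of "Lambda_root M"] unfolding Lambda_root[OF M_nonneg M_sum] by blast
  have "converges_in_distribution P (xi X a M) \<nu>"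
    using \<nu>(1) char by (intro converges_in_distribution_if_char prob_space_axioms xi_measurable)
      (auto simp: \<nu>(2) multivariate_normal_def)
  with \<nu>(1) show ?thesis by blast
qed

end
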